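(* Assume that conditions $\mathbf{A}$, $\mathbf{B}$, $\mathbf{C}$, $\mathbf{D}$ (with a fixed integer $k\ge 1$) and $\mathbf{E}$ stated in the context hold for the family of discrete time semi-Markov processes $\xi^{(\varepsilon)}(n)$, $\varepsilon\ge 0$, on $X=\{0,1,\ldots,N\}$. Then: (i) For $\varepsilon$ sufficiently small, there exists a unique root $\rho^{(\varepsilon)}$ of the characteristic equation $\phi_{ii}^{(\varepsilon)}(\rho)=1$, and it does not depend on the choice of the initial state $i\neq 0$. Moreover, we have the asymptotic expansion $$\rho^{(\varepsilon)}=\rho^{(0)}+c_1\varepsilon+\cdots+c_k\varepsilon^k+o(\varepsilon^k),\quad \varepsilon\to 0,$$ where $c_1=-b_i[0,1]/b_i[1,0]$ and for $n=2,\ldots,k$, $$c_n=-\frac{1}{b_i[1,0]}\Bigg(b_i[0,n]+\sum_{q=1}^{n-1}b_i[1,n-q]\,c_q+\sum_{m=2}^n\sum_{q=m}^n b_i[m,n-q]\cdot\sum_{(n_1,\ldots,n_{q-1})\in D_{m,q}}\ \prod_{p=1}^{q-1}\frac{c_p^{n_p}}{n_p!}\Bigg),$$ with $D_{m,q}$ being the set of all non-negative integer solutions $(n_1,\ldots,n_{q-1})$ of the system $$n_1+\cdots+n_{q-1}=m,\qquad n_1+2n_2+\cdots+(q-1)n_{q-1}=q.$$ (ii) For any non-negative integer valued function $n^{(\varepsilon)}\to\infty$ as $\varepsilon\to 0$ in such a way that $\varepsilon^r n^{(\varepsilon)}\to\lambda_r\in[0,\infty)$ for some $1\le r\le k$,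 we have $$\frac{\mathsf{P}_i\{\xi^{(\varepsilon)}(n^{(\varepsilon)})=j,\ \mu_0^{(\varepsilon)}>n^{(\varepsilon)}\}}{\exp\big(-(\rho^{(0)}+c_1\varepsilon+\cdots+c_{r-1}\varepsilon^{r-1})\,n^{(\varepsilon)}\big)}\ \to\ \frac{\widetilde{\pi}_{ij}^{(0)}}{e^{\lambda_r c_r}}\quad\text{as }\varepsilon\to 0,\qquad i,j\neq 0.$$
   Context: **Model.** For every $\varepsilon\ge 0$, $(\eta_n^{(\varepsilon)},\kappa_n^{(\varepsilon)})$, $n=0,1,\ldots$, is a time-homogeneous discrete time Markov chain with state space $X\times\mathbb{N}$, $X=\{0,1,\ldots,N\}$, $\mathbb{N}=\{1,2,\ldots\}$, whose transition probabilities do not depend on the current value of the second component: $Q_{ij}^{(\varepsilon)}(k)=\mathsf{P}\{\eta_{n+1}^{(\varepsilon)}=j,\ \kappa_{n+1}^{(\varepsilon)}=k\mid\eta_n^{(\varepsilon)}=i\}$, $i,j\in X$, $k\in\mathbb{N}$ (and $Q_{ij}^{(\varepsilon)}(0)=0$). The embedded Markov chain $\eta_n^{(\varepsilon)}$ has transition probabilities $p_{ij}^{(\varepsilon)}=\sum_{k\ge1}Q_{ij}^{(\varepsilon)}(k)$, and one writes $Q_{ij}^{(\varepsilon)}(k)=p_{ij}^{(\varepsilon)}f_{ij}^{(\varepsilon)}(k)$, where $f_{ij}^{(\varepsilon)}(k)=\mathsf{P}\{\kappa_{n+1}^{(\varepsilon)}=k\mid\eta_n^{(\varepsilon)}=i,\eta_{n+1}^{(\varepsilon)}=j\}$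 are the (probability) distributions on $\mathbb{N}$ of transition times. Let $\tau^{(\varepsilon)}(0)=0$, $\tau^{(\varepsilon)}(n)=\kappa_1^{(\varepsilon)}+\cdots+\kappa_n^{(\varepsilon)}$, $\nu^{(\varepsilon)}(n)=\max\{k\ge0:\tau^{(\varepsilon)}(k)\le n\}$. The semi-Markov process is $\xi^{(\varepsilon)}(n)=\eta^{(\varepsilon)}_{\nu^{(\varepsilon)}(n)}$, $n=0,1,\ldots$. State $0$ is regarded as an absorbing state (the quantities in the claim do not depend on the transition probabilities out of state $0$). First hitting times: $\nu_j^{(\varepsilon)}=\min\{n\ge1:\eta_n^{(\varepsilon)}=j\}$ and $\mu_j^{(\varepsilon)}=\tau^{(\varepsilon)}(\nu_j^{(\varepsilon)})$ (both possibly $+\infty$). $\mathsf{P}_i$ and $\mathsf{E}_i$ denote probability and expectation conditional on $\eta_0^{(\varepsilon)}=i$. "$i\ne0$" means $i\in\{1,\ldots,N\}$. Define $g_{ij}^{(\varepsilon)}(n)=\mathsf{P}_i\{\mu_j^{(\varepsilon)}=n,\ \nu_0^{(\varepsilon)}>\nu_j^{(\varepsilon)}\}$, $g_{ij}^{(\varepsilon)}=\mathsf{P}_i\{\nu_0^{(\varepsilon)}>\nu_j^{(\varepsilon)}\}$, $h_{ij}^{(\varepsilon)}(n)=\mathsf{P}_i\{\xi^{(\varepsilon)}(n)=j,\ \mu_0^{(\varepsilon)}\wedge\mu_i^{(\varepsilon)}>n\}$. **Generating functions** ($\rho\in\mathbb{R}$, $r=0,1,\ldots$, values in $[0,\infty]$):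 $\phi_{ij}^{(\varepsilon)}(\rho,r)=\sum_{n\ge0}n^re^{\rho n}g_{ij}^{(\varepsilon)}(n)$, $\phi_{ij}^{(\varepsilon)}(\rho)=\phi_{ij}^{(\varepsilon)}(\rho,0)$; $p_{ij}^{(\varepsilon)}(\rho,r)=\sum_{n\ge0}n^re^{\rho n}Q_{ij}^{(\varepsilon)}(n)$, $p_{ij}^{(\varepsilon)}(\rho)=p_{ij}^{(\varepsilon)}(\rho,0)$; $\psi_{ij}^{(\varepsilon)}(\rho)=\sum_{n\ge0}e^{\rho n}f_{ij}^{(\varepsilon)}(n)$ (here $n^0=1$). **Conditions.** All limits $\varepsilon\to0$ are from the right, and $\limsup_{0\le\varepsilon\to0}$ includes the value at $\varepsilon=0$, i.e. it is $\lim_{\eta\downarrow0}\sup_{0\le\varepsilon\le\eta}$. - $\mathbf{A}$: (a) $p_{ij}^{(\varepsilon)}\to p_{ij}^{(0)}$ as $\varepsilon\to0$ for all $i\ne0$, $j\in X$; (b) $f_{ij}^{(\varepsilon)}(n)\to f_{ij}^{(0)}(n)$ as $\varepsilon\to0$ for all $i\neq0$, $j\in X$, $n\in\mathbb{N}$. - $\mathbf{B}$: $g_{ij}^{(0)}>0$ for all $i,j\ne0$. - $\mathbf{C}$: there exists $\beta>0$ such that (a) $\limsup_{0\le\varepsilon\to0}\psi_{ij}^{(\varepsilon)}(\beta)<\infty$ for all $i\ne0$, $j\in X$; (b) $\phi_{ii}^{(0)}(\beta_i)>1$ for some $i\ne0$ and some $\beta_i\le\beta$. - $\mathbf{D}$: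 with $\rho^{(0)}$ the root of $\phi_{ii}^{(0)}(\rho)=1$ (under $\mathbf{A}$–$\mathbf{C}$ it exists, is non-negative, and does not depend on $i\ne0$), for $r=0,\ldots,k$ and $i,j\ne0$, $p_{ij}^{(\varepsilon)}(\rho^{(0)},r)=p_{ij}^{(0)}(\rho^{(0)},r)+p_{ij}[\rho^{(0)},r,1]\varepsilon+\cdots+p_{ij}[\rho^{(0)},r,k-r]\varepsilon^{k-r}+o(\varepsilon^{k-r})$, with all $|p_{ij}[\rho^{(0)},r,n]|<\infty$. Put $p_{ij}[\rho^{(0)},r,0]=p_{ij}^{(0)}(\rho^{(0)},r)$. - $\mathbf{E}$: $g_{jj}^{(0)}(n)$ is non-periodic for some $j\neq0$, i.e. $\gcd\{n\in\mathbb{N}:g_{jj}^{(0)}(n)>0\}=1$. **Coefficients $b_i[r,n]$.** Write $\rho=\rho^{(0)}$ and fix $i\ne0$. Let $\mathbf{p}_i[\rho,r,n]$ be the column vector $(p_{1i}[\rho,r,n],\ldots,p_{Ni}[\rho,r,n])^T$; let ${}_i\mathbf{P}[\rho,r,n]$ be the $N\times N$ matrix whose $(s,l)$ entry is $p_{sl}[\rho,r,n]$ if $l\ne i$ and $0$ if $l=i$; let $\mathsf{\Phi}_i^{(0)}(\rho,r)=(\phi_{1i}^{(0)}(\rho,r),\ldots,\phi_{Ni}^{(0)}(\rho,r))^T$. Define recursively ${}_i\mathbf{U}[\rho,0]=(\mathbf{I}-{}_i\mathbf{P}[\rho,0,0])^{-1}$, ${}_i\mathbf{U}[\rho,n]={}_i\mathbf{U}[\rho,0]\sum_{q=1}^n{}_i\mathbf{P}[\rho,0,q]\,{}_i\mathbf{U}[\rho,n-q]$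 for $n=1,\ldots,k$; $\mathsf{\Phi}_i[\rho,r,0]=\mathsf{\Phi}_i^{(0)}(\rho,r)$ for $r=0,\ldots,k$; $\mathsf{\Phi}_i[\rho,0,n]=\sum_{q=0}^n{}_i\mathbf{U}[\rho,q]\,\mathbf{p}_i[\rho,0,n-q]$ for $n=1,\ldots,k$; and for $r=1,\ldots,k$, $n=1,\ldots,k-r$, $\mathsf{\Phi}_i[\rho,r,n]=\sum_{q=0}^n{}_i\mathbf{U}[\rho,q]\,\boldsymbol{\lambda}_i[\rho,r,n-q]$, where for $s=0,\ldots,k-r$, $\boldsymbol{\lambda}_i[\rho,r,s]=\mathbf{p}_i[\rho,r,s]+\sum_{m=1}^r\binom{r}{m}\sum_{q=0}^s{}_i\mathbf{P}[\rho,m,q]\,\mathsf{\Phi}_i[\rho,r-m,s-q]$. Then $b_i[r,n]$ is the $i$-th component of $\mathsf{\Phi}_i[\rho^{(0)},r,n]$, $r=0,\ldots,k$, $n=0,\ldots,k-r$; in particular $b_i[r,0]=\phi_{ii}^{(0)}(\rho^{(0)},r)$. These are the coefficients in the expansion $\phi_{ii}^{(\varepsilon)}(\rho^{(0)},r)=b_i[r,0]+b_i[r,1]\varepsilon+\cdots+b_i[r,k-r]\varepsilon^{k-r}+o(\varepsilon^{k-r})$, which holds under $\mathbf{A}$–$\mathbf{D}$. **Limit constants.** $$\widetilde{\pi}_{ij}^{(0)}=\frac{\sum_{n=0}^\infty e^{\rho^{(0)}n}h_{ij}^{(0)}(n)}{\sum_{n=0}^\infty ne^{\rho^{(0)}n}g_{ii}^{(0)}(n)},\quad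 i,j\ne0.$$ *)

theory Defs
  imports "HOL-Probability.Probability" "HOL-Library.Landau_Symbols"
begin

text \<open>
  The state space \<open>{0, 1, \<dots>, N}\<close> is rendered as \<open>'n option\<close> for a finite type \<open>'n\<close> with
  \<open>N = CARD('n)\<close>: the state \<open>0\<close> is \<open>None\<close>, the states \<open>i \<noteq> 0\<close> are the \<open>Some i\<close>. Vectors and
  matrices over the non-zero states then are the library's \<open>real^'n\<close> and \<open>real^'n^'n\<close>.

  A family of Markov renewal chains, indexed by the perturbation parameter \<open>\<epsilon>\<close> (only \<open>\<epsilon> \<ge> 0\<close>
  matters). \<open>law S \<epsilon> i\<close> is the probability measure \<open>P\<^sub>i\<close>; \<open>emb S \<epsilon> n\<close> and \<open>dur S \<epsilon> n\<close> are
  \<open>\<eta>\<^sub>n\<close> and \<open>\<kappa>\<^sub>n\<close>; \<open>pmf (kern S \<epsilon> i) (j, k)\<close> is \<open>Q\<^sub>i\<^sub>j(k)\<close>; \<open>pmf (dist_time S \<epsilon> i j) k\<close> is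
  \<open>f\<^sub>i\<^sub>j(k)\<close>.
\<close>

record ('n, 'a) smp_family =
  law :: "real \<Rightarrow> 'n option \<Rightarrow> 'a measure"
  emb :: "real \<Rightarrow> nat \<Rightarrow> 'a \<Rightarrow> 'n option"
  dur :: "real \<Rightarrow> nat \<Rightarrow> 'a \<Rightarrow> nat"
  kern :: "real \<Rightarrow> 'n option \<Rightarrow> ('n option \<times> nat) pmf"
  dist_time :: "real \<Rightarrow> 'n option \<Rightarrow> 'n option \<Rightarrow> nat pmf"

definition trans_prob :: "('n, 'a) smp_family \<Rightarrow> real \<Rightarrow> 'n option \<Rightarrow> 'n option \<Rightarrow> real" where
  "trans_prob S \<epsilon> i j = (\<Sum>k. pmf (kern S \<epsilon> i) (j, k))"

definition markov_renewal ::
  "'a measure \<Rightarrow> (nat \<Rightarrow> 'a \<Rightarrow> 's) \<Rightarrow> (nat \<Rightarrow> 'a \<Rightarrow> nat) \<Rightarrow> ('s \<Rightarrow> ('s \<times> nat) pmf) \<Rightarrow> bool" where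
  "markov_renewal M \<eta> \<kappa> Q \<longleftrightarrow>
     prob_space M \<and>
     (\<forall>n. \<eta> n \<in> M \<rightarrow>\<^sub>M count_space UNIV) \<and>
     (\<forall>n. \<kappa> n \<in> M \<rightarrow>\<^sub>M count_space {1..}) \<and>
     (\<forall>n x s j k. \<P>(\<omega> in M. \<forall>m\<le>n. \<eta> m \<omega> = x m \<and> \<kappa> m \<omega> = s m) > 0 \<longrightarrow>
        \<P>(\<omega> in M. \<eta> (Suc n) \<omega> = j \<and> \<kappa> (Suc n) \<omega> = k \<bar> \<forall>m\<le>n. \<eta> m \<omega> = x m \<and> \<kappa> m \<omega> = s m)
          = pmf (Q (x n)) (j, k))"

text \<open>
  When \<open>p\<^sub>i\<^sub>j = 0\<close> the conditional distribution \<open>f\<^sub>i\<^sub>j\<close> is an arbitrary distribution on the positive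
  integers. Nothing is assumed on the transitions out of state \<open>0\<close>.
\<close>

definition semi_markov_family :: "('n, 'a) smp_family \<Rightarrow> bool" where
  "semi_markov_family S \<longleftrightarrow>
     (\<forall>\<epsilon>\<ge>0. \<forall>i.
        markov_renewal (law S \<epsilon> i) (emb S \<epsilon>) (dur S \<epsilon>) (kern S \<epsilon>) \<and>
        (AE \<omega> in law S \<epsilon> i. emb S \<epsilon> 0 \<omega> = i)) \<and>
     (\<forall>\<epsilon>\<ge>0. \<forall>i j.
        pmf (kern S \<epsilon> i) (j, 0) = 0 \<and>
        pmf (dist_time S \<epsilon> i j) 0 = 0 \<and>
        (\<forall>k. pmf (kern S \<epsilon> i) (j, k) = trans_prob S \<epsilon> i j * pmf (dist_time S \<epsilon> i j) k))"

definition renewal_time :: "('n, 'a) smp_family \<Rightarrow> real \<Rightarrow> nat \<Rightarrow> 'a \<Rightarrow> nat" where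
  "renewal_time S \<epsilon> n \<omega> = (\<Sum>m=1..n. dur S \<epsilon> m \<omega>)"

definition renewal_count :: "('n, 'a) smp_family \<Rightarrow> real \<Rightarrow> nat \<Rightarrow> 'a \<Rightarrow> nat" where
  "renewal_count S \<epsilon> n \<omega> = Max {k. renewal_time S \<epsilon> k \<omega> \<le> n}"

definition semi_markov :: "('n, 'a) smp_family \<Rightarrow> real \<Rightarrow> nat \<Rightarrow> 'a \<Rightarrow> 'n option" where
  "semi_markov S \<epsilon> n \<omega> = emb S \<epsilon> (renewal_count S \<epsilon> n \<omega>) \<omega>"

text \<open>The hitting times \<open>\<nu>\<^sub>j\<close> and \<open>\<mu>\<^sub>j = \<tau>(\<nu>\<^sub>j)\<close>; the infimum of the empty set is \<open>\<infinity>\<close>.\<close>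

definition hit_step :: "('n, 'a) smp_family \<Rightarrow> real \<Rightarrow> 'n option \<Rightarrow> 'a \<Rightarrow> enat" where
  "hit_step S \<epsilon> j \<omega> = (INF n\<in>{n. 1 \<le> n \<and> emb S \<epsilon> n \<omega> = j}. enat n)"

definition hit_time :: "('n, 'a) smp_family \<Rightarrow> real \<Rightarrow> 'n option \<Rightarrow> 'a \<Rightarrow> enat" where
  "hit_time S \<epsilon> j \<omega> =
     (case hit_step S \<epsilon> j \<omega> of enat m \<Rightarrow> enat (renewal_time S \<epsilon> m \<omega>) | \<infinity> \<Rightarrow> \<infinity>)"

definition g_time :: "('n, 'a) smp_family \<Rightarrow> real \<Rightarrow> 'n option \<Rightarrow> 'n option \<Rightarrow> nat \<Rightarrow> real" where
  "g_time S \<epsilon> i j n =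
     \<P>(\<omega> in law S \<epsilon> i. hit_time S \<epsilon> j \<omega> = enat n \<and> hit_step S \<epsilon> None \<omega> > hit_step S \<epsilon> j \<omega>)"

definition g_total :: "('n, 'a) smp_family \<Rightarrow> real \<Rightarrow> 'n option \<Rightarrow> 'n option \<Rightarrow> real" where
  "g_total S \<epsilon> i j = \<P>(\<omega> in law S \<epsilon> i. hit_step S \<epsilon> None \<omega> > hit_step S \<epsilon> j \<omega>)"

definition h_time :: "('n, 'a) smp_family \<Rightarrow> real \<Rightarrow> 'n option \<Rightarrow> 'n option \<Rightarrow> nat \<Rightarrow> real" where
  "h_time S \<epsilon> i j n =
     \<P>(\<omega> in law S \<epsilon> i. semi_markov S \<epsilon> n \<omega> = j \<and>
        min (hit_time S \<epsilon> None \<omega>) (hit_time S \<epsilon> i \<omega>) > enat n)"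

definition phi ::
  "('n, 'a) smp_family \<Rightarrow> real \<Rightarrow> 'n option \<Rightarrow> 'n option \<Rightarrow> real \<Rightarrow> nat \<Rightarrow> ennreal" where
  "phi S \<epsilon> i j \<rho> r = (\<Sum>n. ennreal (real n ^ r * exp (\<rho> * real n) * g_time S \<epsilon> i j n))"

definition p_gen ::
  "('n, 'a) smp_family \<Rightarrow> real \<Rightarrow> 'n option \<Rightarrow> 'n option \<Rightarrow> real \<Rightarrow> nat \<Rightarrow> ennreal" where
  "p_gen S \<epsilon> i j \<rho> r = (\<Sum>n. ennreal (real n ^ r * exp (\<rho> * real n) * pmf (kern S \<epsilon> i) (j, n)))"

definition psi :: "('n, 'a) smp_family \<Rightarrow> real \<Rightarrow> 'n option \<Rightarrow> 'n option \<Rightarrow> real \<Rightarrow> ennreal" where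
  "psi S \<epsilon> i j \<rho> = (\<Sum>n. ennreal (exp (\<rho> * real n) * pmf (dist_time S \<epsilon> i j) n))"

definition char_root :: "('n, 'a) smp_family \<Rightarrow> real \<Rightarrow> real" where
  "char_root S \<epsilon> = (THE \<rho>. \<forall>i. phi S \<epsilon> (Some i) (Some i) \<rho> 0 = 1)"

definition cond_A :: "('n, 'a) smp_family \<Rightarrow> bool" where
  "cond_A S \<longleftrightarrow>
     (\<forall>i j. ((\<lambda>\<epsilon>. trans_prob S \<epsilon> (Some i) j) \<longlongrightarrow> trans_prob S 0 (Some i) j) (at_right 0)) \<and>
     (\<forall>i j. \<forall>n\<ge>1. ((\<lambda>\<epsilon>. pmf (dist_time S \<epsilon> (Some i) j) n)
        \<longlongrightarrow> pmf (dist_time S 0 (Some i) j) n) (at_right 0))"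

definition cond_B :: "('n, 'a) smp_family \<Rightarrow> bool" where
  "cond_B S \<longleftrightarrow> (\<forall>i j. g_total S 0 (Some i) (Some j) > 0)"

text \<open>The filter in (a), unlike \<open>at_right 0\<close>, takes the value at \<open>\<epsilon> = 0\<close> into account.\<close>

definition cond_C :: "('n, 'a) smp_family \<Rightarrow> bool" where
  "cond_C S \<longleftrightarrow>
     (\<exists>\<beta>>0.
        (\<forall>i j. Limsup (inf (nhds 0) (principal {0..})) (\<lambda>\<epsilon>. psi S \<epsilon> (Some i) j \<beta>) < \<infinity>) \<and>
        (\<exists>i \<beta>'. \<beta>' \<le> \<beta> \<and> phi S 0 (Some i) (Some i) \<beta>' 0 > 1))"

text \<open>
  \<open>pc i j r n\<close> is the coefficient \<open>p\<^sub>i\<^sub>j[\<rho>\<^sup>(\<^sup>0\<^sup>), r, n]\<close>. Under the other conditions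
  \<open>\<rho>\<^sup>(\<^sup>0\<^sup>) < \<beta>\<close>, so for small \<open>\<epsilon>\<close> the generating functions below are finite and \<open>enn2real\<close> loses
  nothing.
\<close>

definition cond_D ::
  "('n, 'a) smp_family \<Rightarrow> nat \<Rightarrow> ('n \<Rightarrow> 'n \<Rightarrow> nat \<Rightarrow> nat \<Rightarrow> real) \<Rightarrow> bool" where
  "cond_D S k pc \<longleftrightarrow>
     (\<forall>r\<le>k. \<forall>i j.
        pc i j r 0 = enn2real (p_gen S 0 (Some i) (Some j) (char_root S 0) r) \<and>
        (\<lambda>\<epsilon>. enn2real (p_gen S \<epsilon> (Some i) (Some j) (char_root S 0) r)
              - (\<Sum>n=0..k-r. pc i j r n * \<epsilon> ^ n)) \<in> o[at_right 0](\<lambda>\<epsilon>. \<epsilon> ^ (k - r)))"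

definition cond_E :: "('n, 'a) smp_family \<Rightarrow> bool" where
  "cond_E S \<longleftrightarrow> (\<exists>j. Gcd {n. 1 \<le> n \<and> g_time S 0 (Some j) (Some j) n > 0} = 1)"

definition p_vec :: "('n \<Rightarrow> 'n \<Rightarrow> nat \<Rightarrow> nat \<Rightarrow> real) \<Rightarrow> 'n \<Rightarrow> nat \<Rightarrow> nat \<Rightarrow> real^'n" where
  "p_vec pc i r n = (\<chi> s. pc s i r n)"

definition P_mat :: "('n \<Rightarrow> 'n \<Rightarrow> nat \<Rightarrow> nat \<Rightarrow> real) \<Rightarrow> 'n \<Rightarrow> nat \<Rightarrow> nat \<Rightarrow> real^'n^'n" where
  "P_mat pc i r n = (\<chi> s l. if l = i then 0 else pc s l r n)"

definition Phi0 :: "('n, 'a) smp_family \<Rightarrow> 'n \<Rightarrow> nat \<Rightarrow> real^'n" where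
  "Phi0 S i r = (\<chi> s. enn2real (phi S 0 (Some s) (Some i) (char_root S 0) r))"

lemmas [fundef_cong] = sum.cong

fun U_mat :: "('n::finite \<Rightarrow> 'n \<Rightarrow> nat \<Rightarrow> nat \<Rightarrow> real) \<Rightarrow> 'n \<Rightarrow> nat \<Rightarrow> real^'n^'n" where
  "U_mat pc i 0 = matrix_inv (mat 1 - P_mat pc i 0 0)"
| "U_mat pc i (Suc n) =
     U_mat pc i 0 ** (\<Sum>q=1..Suc n. P_mat pc i 0 q ** U_mat pc i (Suc n - q))"

function Phi_vec :: "('n::finite, 'a) smp_family \<Rightarrow> ('n \<Rightarrow> 'n \<Rightarrow> nat \<Rightarrow> nat \<Rightarrow> real) \<Rightarrow>
    'n \<Rightarrow> nat \<Rightarrow> nat \<Rightarrow> real^'n"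
  and lambda_vec :: "('n, 'a) smp_family \<Rightarrow> ('n \<Rightarrow> 'n \<Rightarrow> nat \<Rightarrow> nat \<Rightarrow> real) \<Rightarrow>
    'n \<Rightarrow> nat \<Rightarrow> nat \<Rightarrow> real^'n" where
  "Phi_vec S pc i r 0 = Phi0 S i r"
| "Phi_vec S pc i 0 (Suc n) = (\<Sum>q=0..Suc n. U_mat pc i q *v p_vec pc i 0 (Suc n - q))"
| "Phi_vec S pc i (Suc r) (Suc n) =
     (\<Sum>q=0..Suc n. U_mat pc i q *v lambda_vec S pc i (Suc r) (Suc n - q))"
| "lambda_vec S pc i r s =
     p_vec pc i r s +
     (\<Sum>m=1..r. real (r choose m) *\<^sub>R
        (\<Sum>q=0..s. P_mat pc i m q *v Phi_vec S pc i (r - m) (s - q)))"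
  by pat_completeness auto
termination
  by (relation "Wellfounded.measure (case_sum (\<lambda>(S, pc, i, r, n). 2 * r + 1) (\<lambda>(S, pc, i, r, s). 2 * r))") auto

definition b_coeff :: "('n::finite, 'a) smp_family \<Rightarrow> ('n \<Rightarrow> 'n \<Rightarrow> nat \<Rightarrow> nat \<Rightarrow> real) \<Rightarrow>
    'n \<Rightarrow> nat \<Rightarrow> nat \<Rightarrow> real" where
  "b_coeff S pc i r n = Phi_vec S pc i r n $ i"

text \<open>The tuples \<open>(n\<^sub>1, \<dots>, n\<^sub>q\<^sub>-\<^sub>1)\<close> are extensional functions on \<open>{1..<q}\<close>.\<close>

definition D_set :: "nat \<Rightarrow> nat \<Rightarrow> (nat \<Rightarrow> nat) set" where
  "D_set m q = {ns \<in> {1..<q} \<rightarrow>\<^sub>E UNIV. (\<Sum>p\<in>{1..<q}. ns p) = m \<and> (\<Sum>p\<in>{1..<q}. p * ns p) = q}"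

text \<open>Both series converge under the conditions above.\<close>

definition pi_tilde :: "('n, 'a) smp_family \<Rightarrow> 'n option \<Rightarrow> 'n option \<Rightarrow> real" where
  "pi_tilde S i j =
     (\<Sum>n. exp (char_root S 0 * real n) * h_time S 0 i j n) /
     (\<Sum>n. real n * exp (char_root S 0 * real n) * g_time S 0 i i n)"

end

theory Submission
  imports Defs
begin

text \<open>
  Three facts carry the proof. Write \<open>g\<close> for the return times to a fixed state \<open>i\<close> before absorption, \<open>\<phi>\<close>
  for their generating function and \<open>P(\<rho>)\<close> for the matrix of transition generating functions over the
  non-absorbing states.

  First, the finiteness of \<open>\<phi>\<close> is stable. First-passage generating functions are the minimal solutions of
  linear first-step equations (\<open>supersolution_bound\<close>). If they are finite, a finite Neumann sum is a strict
  supersolution \<open>w\<close> of the homogeneous equation (\<open>strict_supersolution_exists\<close>), and by continuity the same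
  \<open>w\<close> serves at a slightly larger argument and for all small \<open>\<epsilon>\<close> (\<open>uniform_supersolution\<close>). This gives
  exponential bounds, uniform in \<open>\<epsilon>\<close> and with a rate beyond the unperturbed root, for the
  first-passage times and for the occupation probabilities (\<open>uniform_control\<close>). So \<open>\<phi>\<close> is finite and continuous
  slightly beyond any point where it is at most one. Hence it cannot jump over the value one, which yields
  the unperturbed root (\<open>root_exists_0\<close>). Near it the perturbed generating functions cross one by the
  intermediate value theorem (\<open>root_near\<close>). The root is the same for all states because \<open>\<phi> = 1\<close> for one
  state means that \<open>P(\<rho>)\<close> has a positive eigenvector for the eigenvalue one (\<open>return_solidarity\<close>).

  Second, the expansion. The moments \<open>\<phi>(\<rho>\<^sup>(\<^sup>0\<^sup>), r)\<close> satisfy a linear system whose data have the given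
  expansions. The formal solution of the system is the recursion for the coefficients \<open>b\<close>, and since the
  system is a contraction uniformly in \<open>\<epsilon>\<close>, the formal solution is asymptotic to the true one
  (\<open>first_passage_expansion\<close>). The recursion for \<open>c\<close> says that the polynomial
  \<open>P(\<epsilon>) = c\<^sub>1 \<epsilon> + \<dots> + c\<^sub>k \<epsilon>\<^sup>k\<close> solves the Taylor-expanded characteristic equation up to order \<open>k\<close>
  (\<open>root_polynomial_solves\<close>, with the multinomial theorem accounting for the sums over \<open>D\<close>). As \<open>\<phi>\<close>
  increases with a slope bounded below, the true root differs from this approximate root by \<open>o(\<epsilon>\<^sup>k)\<close>
  (\<open>char_root_expansion\<close>).

  Third, the limit. Let \<open>x(n)\<close> be the probability of being in \<open>j\<close> at time \<open>n\<close> without absorption. With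
  \<open>\<rho>\<^sup>(\<^sup>\<epsilon>\<^sup>)\<close> the root, the decomposition of \<open>e\<^sup>\<rho>\<^sup>n x(n)\<close> at the first return is a proper renewal
  equation. A renewal theorem that is uniform in the parameter (\<open>perturbed_renewal_theorem\<close>) is obtained by
  compactness: every cluster point of the solutions, seen from a time that tends to infinity, is a bounded
  harmonic function on the integers, hence constant, and a summed form of the equation identifies the constant.
  So \<open>e\<^sup>\<rho>\<^sup>n x(n)\<close> tends to \<open>pi_tilde\<close> along every \<open>n\<^sup>(\<^sup>\<epsilon>\<^sup>) \<rightarrow> \<infinity>\<close>, and the expansion of the root compares
  \<open>\<rho>\<^sup>(\<^sup>\<epsilon>\<^sup>) n\<^sup>(\<^sup>\<epsilon>\<^sup>)\<close> with the truncated exponent, the difference being \<open>c\<^sub>r \<lambda>\<^sub>r\<close> in the limit.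

  The probabilistic input is confined to the first-step equations (\<open>g_time_first_step\<close>,
  \<open>occupation_first_step\<close>) and to \<open>g_total_sums\<close>: the events up to time \<open>n\<close> are decided by the first
  \<open>n + 1\<close> jumps, whose joint law is an explicit product.
\<close>

section \<open>Bounded harmonic functions on the integers\<close>

lemma tannery:
  fixes a :: "nat \<Rightarrow> 'e \<Rightarrow> real"
  assumes lim: "\<And>k. ((\<lambda>e. a k e) \<longlongrightarrow> b k) F"
    and bd: "eventually (\<lambda>e. \<forall>k. \<bar>a k e\<bar> \<le> M k) F" and M: "summable M"
  shows "((\<lambda>e. \<Sum>k. a k e) \<longlongrightarrow> (\<Sum>k. b k)) F"
proof (cases "F = bot")
  case False
  have "eventually (\<lambda>(k,e). norm (a k e) \<le> M k) (at_top \<times>\<^sub>F F)"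
    unfolding eventually_prod_filter
    by (rule exI[of _ "\<lambda>_. True"], rule exI[of _ "\<lambda>e. \<forall>k. \<bar>a k e\<bar> \<le> M k"]) (use bd in auto)
  from tannerys_theorem[of a b F M, OF lim this M False] show ?thesis by blast
qed simp

text \<open>
  Compactness of \<open>[-B, B]\<close> to the power \<open>\<int>\<close>, phrased with filters: refining the filter takes the place
  of choosing a diagonal subsequence.
\<close>

lemma bounded_family_cluster:
  fixes z :: "'e \<Rightarrow> int \<Rightarrow> real"
  assumes F: "F \<noteq> bot" and bd: "eventually (\<lambda>e. \<forall>k. \<bar>z e k\<bar> \<le> B) F"
  obtains G v where "G \<noteq> bot" "G \<le> F" "\<And>k. ((\<lambda>e. z e k) \<longlongrightarrow> v k) G"
proof -
  define U where "U = (PiE UNIV (\<lambda>_::int. {-B..B}))"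
  have "compactin (product_topology (\<lambda>_::int. euclidean :: real topology) UNIV) U"
    unfolding U_def by (subst compactin_PiE) auto
  hence "compact U" by (simp add: euclidean_product_topology)
  moreover have "eventually (\<lambda>w. w \<in> U) (filtermap z F)"
    unfolding eventually_filtermap by (rule eventually_mono[OF bd]) (auto simp: U_def abs_le_iff minus_le_iff)
  moreover have "filtermap z F \<noteq> bot" using F by (simp add: filtermap_bot_iff)
  ultimately obtain v where v: "inf (nhds v) (filtermap z F) \<noteq> bot"
    unfolding compact_filter by blast
  define G where "G = inf (filtercomap z (nhds v)) F"
  have G: "G \<noteq> bot"
  proof
    assume "G = bot"
    hence "eventually (\<lambda>_. False) G" by simp
    then obtain Q R where Q: "eventually Q (filtercomap z (nhds v))" and R: "eventually R F"
      and QR: "\<And>x. Q x \<Longrightarrow> R x \<Longrightarrow> False" unfolding G_def eventually_inf by blast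
    from Q obtain Q' where Q': "eventually Q' (nhds v)" "\<And>x. Q' (z x) \<Longrightarrow> Q x"
      unfolding eventually_filtercomap by blast
    have "eventually (\<lambda>w. \<not> Q' w) (filtermap z F)"
      unfolding eventually_filtermap by (rule eventually_mono[OF R]) (use Q' QR in blast)
    hence "eventually (\<lambda>_. False) (inf (nhds v) (filtermap z F))"
      unfolding eventually_inf using Q'(1) by blast
    with v show False by (simp add: eventually_False)
  qed
  have "filterlim z (nhds v) G"
    unfolding filterlim_def G_def
    by (rule order_trans[OF filtermap_mono[OF inf_le1] filtermap_filtercomap])
  moreover have "isCont (\<lambda>w. w k) v" for k :: int
    using continuous_on_product_coordinates[of k] continuous_on_eq_continuous_at[OF open_UNIV]
    by blast
  ultimately have lim: "((\<lambda>e. z e k) \<longlongrightarrow> v k) G" for k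
    by (rule isCont_tendsto_compose[rotated])
  show thesis by (rule that[OF G _ lim]) (simp add: G_def)
qed

text \<open>
  The maximum principle for increments. Let \<open>D\<close> be the supremum of \<open>v k - v (k - a)\<close>. Translating \<open>v\<close>
  along a maximizing sequence and passing to a cluster point gives a harmonic \<open>w\<close> whose increment
  attains \<open>D\<close> at \<open>0\<close>. An average of increments that are at most \<open>D\<close> can only equal \<open>D\<close> if
  those of positive weight are \<open>D\<close>, so the increment is \<open>D\<close> at \<open>-a, -2a, \<dots>\<close> as well, and \<open>w\<close>
  would be unbounded if \<open>D\<close> were positive.
\<close>

lemma harmonic_increment_nonpos:
  fixes f :: "nat \<Rightarrow> real" and v :: "int \<Rightarrow> real"
  assumes f: "\<And>n. f n \<ge> 0" "f sums 1" and a: "f a > 0"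
    and v: "\<And>k. \<bar>v k\<bar> \<le> B" "\<And>k. (\<lambda>m. f m * v (k - int m)) sums v k"
  shows "v k \<le> v (k - int a)"
proof -
  have sf: "summable f" using f(2) by (rule sums_summable)
  define d where "d k = v k - v (k - int a)" for k
  have dB: "d k \<le> 2 * B" for k using v(1)[of k] v(1)[of "k - int a"] unfolding d_def by linarith
  have bdd: "bdd_above (range d)" using dB by (auto intro!: bdd_aboveI)
  define D where "D = (SUP k. d k)"
  have dD: "d k \<le> D" for k unfolding D_def by (rule cSUP_upper[OF _ bdd]) auto
  have "\<exists>k. D - 1 / real (Suc n) < d k" for n
    using less_cSUP_iff[OF _ bdd, of "D - 1 / real (Suc n)"] unfolding D_def[symmetric] by auto
  then obtain K where K: "\<And>n. D - 1 / real (Suc n) < d (K n)" by metis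
  have dK: "(\<lambda>n. d (K n)) \<longlonglongrightarrow> D"
  proof (rule tendsto_sandwich)
    show "eventually (\<lambda>n. D - 1 / real (Suc n) \<le> d (K n)) sequentially"
      using K by (auto intro!: always_eventually less_imp_le)
    show "eventually (\<lambda>n. d (K n) \<le> D) sequentially" using dD by auto
    have "(\<lambda>n. D - 1 / real (Suc n)) \<longlonglongrightarrow> D - 0"
      by (intro tendsto_intros LIMSEQ_Suc[OF lim_1_over_n])
    thus "(\<lambda>n. D - 1 / real (Suc n)) \<longlonglongrightarrow> D" by simp
  qed auto
  obtain G w where G: "G \<noteq> bot" "G \<le> sequentially"
    and w: "\<And>k. ((\<lambda>n. v (K n + k)) \<longlongrightarrow> w k) G"
    by (rule bounded_family_cluster[of sequentially "\<lambda>n k. v (K n + k)" B]) (use v(1) in auto)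
  have wB: "\<bar>w k\<bar> \<le> B" for k
    using tendsto_upperbound[OF tendsto_rabs[OF w[of k]] always_eventually] v(1) G(1) by blast
  have wharm: "(\<lambda>m. f m * w (k - int m)) sums w k" for k
  proof -
    have "((\<lambda>n. \<Sum>m. f m * v (K n + k - int m)) \<longlongrightarrow> (\<Sum>m. f m * w (k - int m))) G"
    proof (rule tannery[where M = "\<lambda>m. f m * B"])
      fix m
      show "((\<lambda>n. f m * v (K n + k - int m)) \<longlongrightarrow> f m * w (k - int m)) G"
        using tendsto_mult_left[OF w[of "k - int m"], of "f m"] by (simp add: algebra_simps)
    next
      show "eventually (\<lambda>n. \<forall>m. \<bar>f m * v (K n + k - int m)\<bar> \<le> f m * B) G"
        using v(1) f(1) by (auto simp: abs_mult intro!: always_eventually mult_left_mono)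
    qed (use sf in \<open>auto intro: summable_mult2\<close>)
    moreover have "(\<Sum>m. f m * v (K n + k - int m)) = v (K n + k)" for n
      by (rule sums_unique[OF v(2), symmetric])
    ultimately have "((\<lambda>n. v (K n + k)) \<longlongrightarrow> (\<Sum>m. f m * w (k - int m))) G" by simp
    hence "(\<Sum>m. f m * w (k - int m)) = w k" using tendsto_unique[OF G(1)] w by blast
    moreover have "summable (\<lambda>m. f m * w (k - int m))"
      by (rule summable_comparison_test'[where g = "\<lambda>m. f m * B" and N = 0])
         (use sf wB f(1) in \<open>auto simp: abs_mult intro: summable_mult2 mult_left_mono\<close>)
    ultimately show ?thesis by (metis summable_sums)
  qed
  define e where "e k = w k - w (k - int a)" for k
  have "((\<lambda>n. d (K n + k)) \<longlongrightarrow> e k) G" for k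
    using tendsto_diff[OF w[of k] w[of "k - int a"]] unfolding d_def e_def by (simp add: algebra_simps)
  note de = this
  have "((\<lambda>n. d (K n)) \<longlongrightarrow> D) G" using dK G(2) by (rule tendsto_mono[rotated])
  hence e0: "e 0 = D" using tendsto_unique[OF G(1) de[of 0]] by simp
  have e: "e k \<le> D" for k
    by (rule tendsto_upperbound[OF de _ G(1)]) (use dD in auto)
  have step: "e (k - int a) = D" if "e k = D" for k
  proof -
    have "(\<lambda>m. f m * w (k - int m) - f m * w (k - int a - int m)) sums (w k - w (k - int a))"
      by (intro sums_diff wharm)
    hence 1: "(\<lambda>m. f m * e (k - int m)) sums D"
      unfolding that[symmetric] e_def by (simp add: algebra_simps)
    have "(\<lambda>m. f m * D - f m * e (k - int m)) sums (1 * D - D)"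
      by (intro sums_diff 1 sums_mult2 f(2))
    hence 2: "(\<lambda>m. f m * (D - e (k - int m))) sums 0" by (simp add: algebra_simps)
    have nn: "f m * (D - e (k - int m)) \<ge> 0" for m using f(1) e by simp
    have "f a * (D - e (k - int a)) = 0"
      using nn iffD1[OF suminf_eq_zero_iff[OF sums_summable[OF 2]] sums_unique[OF 2, symmetric]] by blast
    thus ?thesis using a by simp
  qed
  have eD: "e (- int (n * a)) = D" for n
  proof (induction n)
    case (Suc n)
    have "- int (Suc n * a) = - int (n * a) - int a" by simp
    thus ?case using step[OF Suc] by metis
  qed (use e0 in simp)
  have "w 0 - w (- int (n * a)) = real n * D" for n
  proof (induction n)
    case (Suc n)
    have "- int (Suc n * a) = - int (n * a) - int a" by simp
    hence "w (- int (n * a)) - w (- int (Suc n * a)) = D" using eD[of n] unfolding e_def by metis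
    thus ?case using Suc by (simp add: algebra_simps)
  qed simp
  hence "real n * D \<le> 2 * B" for n using wB[of 0] wB[of "- int (n * a)"] by (smt (verit))
  hence "D \<le> 0"
    by (metis linorder_not_le reals_Archimedean3)
  thus ?thesis using dD[of k] unfolding d_def by linarith
qed

text \<open>
  The Choquet-Deny theorem on the integers. By the increment bound for \<open>v\<close> and \<open>-v\<close> every element of
  the support of \<open>f\<close> is a period of \<open>v\<close>; the periods are closed under remainders, so the least positive
  one divides the support and hence is \<open>1\<close>.
\<close>

lemma bounded_harmonic_constant:
  fixes f :: "nat \<Rightarrow> real" and v :: "int \<Rightarrow> real"
  assumes f: "\<And>n. f n \<ge> 0" "f sums 1" and gcd: "Gcd {n. f n > 0} = 1"
    and v: "\<And>k. \<bar>v k\<bar> \<le> B" "\<And>k. (\<lambda>m. f m * v (k - int m)) sums v k"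
  shows "v k = v 0"
proof -
  have per: "v (k - int a) = v k" if "f a > 0" for a k
  proof (rule antisym)
    show "v k \<le> v (k - int a)" by (rule harmonic_increment_nonpos[OF f that v])
    have "- v k \<le> - v (k - int a)"
      by (rule harmonic_increment_nonpos[OF f that, of "\<lambda>k. - v k" B])
         (use v in \<open>auto dest: sums_minus\<close>)
    thus "v (k - int a) \<le> v k" by simp
  qed
  define P where "P = {a::nat. \<forall>k. v (k - int a) = v k}"
  have P_mod: "a mod b \<in> P" if "a \<in> P" "b \<in> P" for a b
  proof -
    have mul: "v (k - int (n * b)) = v k" for n k
    proof (induction n)
      case (Suc n)
      have "k - int (Suc n * b) = (k - int (n * b)) - int b" by simp
      hence "v (k - int (Suc n * b)) = v ((k - int (n * b)) - int b)" by (simp add: algebra_simps)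
      also have "\<dots> = v (k - int (n * b))" using that(2) unfolding P_def by blast
      finally show ?case using Suc by simp
    qed simp
    have "v (k - int (a mod b)) = v k" for k
    proof -
      have "v (k - int (a mod b)) = v ((k - int (a mod b)) - int (a div b * b))"
        using mul by simp
      also have "(k - int (a mod b)) - int (a div b * b) = k - int a"
        by (metis diff_diff_eq mod_div_mult_eq of_nat_add)
      finally show ?thesis using that(1) unfolding P_def by simp
    qed
    thus ?thesis unfolding P_def by simp
  qed
  have sub: "{n. f n > 0} \<subseteq> P" using per unfolding P_def by auto
  have "\<exists>n. n > 0 \<and> n \<in> P"
  proof (rule ccontr)
    assume "\<not> ?thesis"
    hence "{n. f n > 0} \<subseteq> {0}" using sub by auto
    hence "Gcd {n. f n > 0} = 0" by (simp add: Gcd_0_iff)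
    with gcd show False by simp
  qed
  define p where "p = (LEAST n. n > 0 \<and> n \<in> P)"
  have p: "p > 0 \<and> p \<in> P" unfolding p_def by (rule LeastI_ex) fact
  have "p dvd n" if "f n > 0" for n
  proof -
    have "n mod p \<in> P" using P_mod that sub p by blast
    hence "n mod p = 0" using p not_less_Least[of "n mod p" "\<lambda>n. n > 0 \<and> n \<in> P"]
      unfolding p_def[symmetric] by auto
    thus ?thesis by auto
  qed
  hence "p dvd Gcd {n. f n > 0}" by (intro Gcd_greatest) auto
  hence "p = 1" using gcd by simp
  hence one: "v (k - 1) = v k" for k using p unfolding P_def by auto
  show ?thesis
  proof (induction k rule: int_induct[where k = 0])
    case (step1 i) thus ?case using one[of "i + 1"] by simp
  next
    case (step2 i) thus ?case using one[of i] by simp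
  qed simp
qed

section \<open>A renewal theorem with a parameter\<close>

lemma summable_geometric_tail:
  fixes f :: "nat \<Rightarrow> real"
  assumes f: "\<And>n. f n \<ge> 0" "\<And>n. f n \<le> C * t ^ n" and t: "0 \<le> t" "t < 1"
  shows "summable f" "0 \<le> (\<Sum>j. f (j + m))" "(\<Sum>j. f (j + m)) \<le> C / (1 - t) * t ^ m"
proof -
  have g: "(\<lambda>j. C * t ^ m * t ^ j) sums (C * t ^ m * (1 / (1 - t)))"
    using t by (intro sums_mult geometric_sums) auto
  have le: "f (j + m) \<le> C * t ^ m * t ^ j" for j m
    using f(2)[of "j + m"] by (simp add: power_add mult_ac)
  show sf: "summable f"
    by (rule summable_comparison_test'[of "\<lambda>n. C * t ^ n" 0]) (use f t in \<open>auto intro: summable_mult\<close>)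
  have s: "summable (\<lambda>j. f (j + m))" using sf by (rule summable_ignore_initial_segment)
  show "0 \<le> (\<Sum>j. f (j + m))" by (rule suminf_nonneg[OF s]) (use f in auto)
  have "(\<Sum>j. f (j + m)) \<le> (\<Sum>j. C * t ^ m * t ^ j)"
    by (rule suminf_le[OF le s sums_summable[OF g]])
  also have "\<dots> = C / (1 - t) * t ^ m" using sums_unique[OF g] by simp
  finally show "(\<Sum>j. f (j + m)) \<le> C / (1 - t) * t ^ m" .
qed

lemma suminf_tail_Suc:
  fixes f :: "nat \<Rightarrow> real" assumes "summable f"
  shows "(\<Sum>j. f (j + m)) = f m + (\<Sum>j. f (j + Suc m))"
  using suminf_split_initial_segment[of "\<lambda>j. f (j + m)" 1] assms
  by (simp add: summable_ignore_initial_segment)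

text \<open>
  The summed form of the renewal equation: with \<open>R\<close> the tail of \<open>f\<close>, the generating functions satisfy
  \<open>R(z) = (1 - f(z)) / (1 - z)\<close>, so \<open>R(z) x(z) = y(z) / (1 - z)\<close>. It is what identifies the limit.
\<close>

lemma renewal_tail_identity:
  fixes f x y :: "nat \<Rightarrow> real"
  assumes f: "f sums 1" "f 0 = 0" and x: "\<And>n. x n = y n + (\<Sum>m\<le>n. f m * x (n - m))"
  shows "(\<Sum>m\<le>n. (\<Sum>j. f (j + Suc m)) * x (n - m)) = (\<Sum>j\<le>n. y j)"
proof (induction n)
  case 0
  have "(\<Sum>j. f (j + 0)) = 1" using sums_unique[OF f(1)] by simp
  hence "(\<Sum>j. f (Suc j)) = 1" using suminf_tail_Suc[OF sums_summable[OF f(1)], of 0] f(2) by simp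
  thus ?case using x[of 0] f(2) by simp
next
  case (Suc n)
  define R where "R m = (\<Sum>j. f (j + m))" for m
  have R: "R m = f m + R (Suc m)" for m
    unfolding R_def by (rule suminf_tail_Suc) (rule sums_summable[OF f(1)])
  have R0: "R 0 = 1" "R 1 = 1" using R[of 0] f sums_unique[OF f(1)] by (simp_all add: R_def)
  have "(\<Sum>m\<le>Suc n. R (Suc m) * x (Suc n - m)) = R 1 * x (Suc n) + (\<Sum>m\<le>n. R (Suc (Suc m)) * x (n - m))"
    by (subst sum.atMost_Suc_shift) simp
  also have "\<dots> = x (Suc n) + (\<Sum>m\<le>n. (R (Suc m) - f (Suc m)) * x (n - m))"
    using R R0 by (metis (no_types, lifting) add_diff_cancel_left' mult_1 sum.cong)
  also have "\<dots> = (x (Suc n) - (\<Sum>m\<le>n. f (Suc m) * x (n - m))) + (\<Sum>m\<le>n. R (Suc m) * x (n - m))"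
    by (simp add: algebra_simps sum_subtractf)
  also have "(\<Sum>m\<le>n. f (Suc m) * x (n - m)) = (\<Sum>m\<le>Suc n. f m * x (Suc n - m))"
    by (subst sum.atMost_Suc_shift) (simp add: f)
  also have "x (Suc n) - \<dots> = y (Suc n)" using x[of "Suc n"] by simp
  finally show ?case using Suc unfolding R_def by simp
qed

lemma renewal_solution_bound:
  fixes f x y :: "nat \<Rightarrow> real"
  assumes f: "f sums 1" "f 0 = 0" "\<And>n. f n \<ge> 0" and x: "\<And>n. x n = y n + (\<Sum>m\<le>n. f m * x (n - m))"
  shows "\<bar>x n\<bar> \<le> (\<Sum>j\<le>n. \<bar>y j\<bar>)"
proof (induction n rule: less_induct)
  case (less n)
  have "\<bar>f m * x (n - m)\<bar> \<le> f m * (\<Sum>j<n. \<bar>y j\<bar>)" if "m \<le> n" for m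
  proof (cases "m = 0")
    case False
    hence lt: "n - m < n" using that by simp
    have "\<bar>x (n - m)\<bar> \<le> (\<Sum>j\<le>n - m. \<bar>y j\<bar>)" using less.IH[OF lt] .
    also have "\<dots> \<le> (\<Sum>j<n. \<bar>y j\<bar>)" using lt by (intro sum_mono2) auto
    finally show ?thesis using f(3)[of m] by (simp add: abs_mult mult_left_mono)
  qed (use f in simp)
  hence "\<bar>\<Sum>m\<le>n. f m * x (n - m)\<bar> \<le> (\<Sum>m\<le>n. f m * (\<Sum>j<n. \<bar>y j\<bar>))"
    by (intro order_trans[OF sum_abs] sum_mono) auto
  also have "\<dots> = (\<Sum>m\<le>n. f m) * (\<Sum>j<n. \<bar>y j\<bar>)" by (simp add: sum_distrib_right)
  also have "\<dots> \<le> 1 * (\<Sum>j<n. \<bar>y j\<bar>)"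
  proof (rule mult_right_mono)
    have "(\<Sum>m\<le>n. f m) \<le> (\<Sum>m. f m)"
      by (rule sum_le_suminf) (use f in \<open>auto intro: sums_summable\<close>)
    thus "(\<Sum>m\<le>n. f m) \<le> 1" using sums_unique[OF f(1)] by simp
  qed (auto intro: sum_nonneg)
  finally have "\<bar>\<Sum>m\<le>n. f m * x (n - m)\<bar> \<le> (\<Sum>j<n. \<bar>y j\<bar>)" by simp
  moreover have "(\<Sum>j\<le>n. \<bar>y j\<bar>) = \<bar>y n\<bar> + (\<Sum>j<n. \<bar>y j\<bar>)"
    by (simp add: lessThan_Suc_atMost[symmetric])
  moreover have "\<bar>x n\<bar> \<le> \<bar>y n\<bar> + \<bar>\<Sum>m\<le>n. f m * x (n - m)\<bar>" by (subst x) (rule abs_triangle_ineq)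
  ultimately show ?case by linarith
qed

text \<open>
  Summation by parts; the geometric bound makes the boundary term \<open>N * P(\<ge> N)\<close> vanish.
\<close>

lemma suminf_tails_eq_mean:
  fixes f :: "nat \<Rightarrow> real"
  assumes f: "\<And>n. f n \<ge> 0" "\<And>n. f n \<le> C * t ^ n" and t: "0 \<le> t" "t < 1" and C: "C \<ge> 0"
  shows "(\<lambda>m. \<Sum>j. f (j + Suc m)) sums (\<Sum>n. real n * f n)"
proof -
  define R where "R m = (\<Sum>j. f (j + m))" for m
  have R: "R m = f m + R (Suc m)" for m
    unfolding R_def by (rule suminf_tail_Suc) (rule summable_geometric_tail[OF f t])
  have part: "(\<Sum>m<N. R (Suc m)) = (\<Sum>n<N. real n * f n) + real N * R N" for N
  proof (induction N)
    case (Suc N)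
    have "(\<Sum>m<Suc N. R (Suc m)) = (\<Sum>n<N. real n * f n) + real N * R N + R (Suc N)" using Suc by simp
    also have "R N = f N + R (Suc N)" by (rule R)
    finally show ?case by (simp add: algebra_simps)
  qed simp
  have nt: "summable (\<lambda>n. real n * t ^ n)"
    by (rule summable_comparison_test'[OF sums_summable[OF geometric_deriv_sums[of t]], of 0])
       (use t in \<open>auto intro!: mult_right_mono\<close>)
  have "(\<lambda>N. real N * R N) \<longlonglongrightarrow> 0"
  proof (rule tendsto_sandwich[of "\<lambda>_. 0" _ _ "\<lambda>N. C / (1 - t) * (real N * t ^ N)"])
    show "eventually (\<lambda>N. real N * R N \<le> C / (1 - t) * (real N * t ^ N)) sequentially"
      using summable_geometric_tail(3)[OF f t] unfolding R_def
      by (intro always_eventually allI) (metis mult.left_commute mult_left_mono of_nat_0_le_iff)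
    show "eventually (\<lambda>N. 0 \<le> real N * R N) sequentially"
      using summable_geometric_tail(2)[OF f t] unfolding R_def by (intro always_eventually allI) simp
    show "(\<lambda>N. C / (1 - t) * (real N * t ^ N)) \<longlonglongrightarrow> 0"
      using tendsto_mult_right_zero[OF summable_LIMSEQ_zero[OF nt]] by blast
  qed auto
  moreover have "summable (\<lambda>n. real n * f n)"
    by (rule summable_comparison_test'[OF summable_mult[OF nt, of C], of 0])
       (use f in \<open>auto simp: abs_mult mult.left_commute[of C] intro!: mult_left_mono\<close>)
  hence "(\<lambda>N. \<Sum>n<N. real n * f n) \<longlonglongrightarrow> (\<Sum>n. real n * f n)" by (rule summable_LIMSEQ)
  ultimately have "(\<lambda>N. (\<Sum>n<N. real n * f n) + real N * R N) \<longlonglongrightarrow> (\<Sum>n. real n * f n) + 0"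
    by (intro tendsto_add)
  hence "(\<lambda>m. R (Suc m)) sums (\<Sum>n. real n * f n)" unfolding sums_def part by simp
  thus ?thesis unfolding R_def .
qed

text \<open>
  The renewal theorem uniformly in a parameter. Suppose that \<open>x e (T e)\<close> stays away from the claimed
  limit along some finer filter. The solutions seen from \<open>T e\<close> are bounded functions on \<open>\<int>\<close>, so along
  a still finer filter they converge pointwise to some \<open>v\<close>; as \<open>T e\<close> tends to infinity, the
  inhomogeneous term dies out and \<open>v\<close> is harmonic for \<open>f0\<close>, hence constant. Passing to the limit in the
  summed renewal equation gives \<open>v * (\<Sum>n. n * f0 n) = (\<Sum>n. y0 n)\<close>, a contradiction. The common
  geometric bound on \<open>f\<close> and \<open>y\<close> justifies all interchanges of limit and sum.
\<close>

theorem perturbed_renewal_theorem: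
  fixes f x y :: "'e \<Rightarrow> nat \<Rightarrow> real"
  assumes f: "eventually (\<lambda>e. (\<forall>n. 0 \<le> f e n \<and> f e n \<le> C * t ^ n) \<and> f e sums 1 \<and> f e 0 = 0) F"
    and y: "eventually (\<lambda>e. \<forall>n. \<bar>y e n\<bar> \<le> C * t ^ n) F"
    and x: "eventually (\<lambda>e. \<forall>n. x e n = y e n + (\<Sum>m\<le>n. f e m * x e (n - m))) F"
    and flim: "\<And>n. ((\<lambda>e. f e n) \<longlongrightarrow> f0 n) F" and ylim: "\<And>n. ((\<lambda>e. y e n) \<longlongrightarrow> y0 n) F"
    and t: "0 \<le> t" "t < 1" and gcd: "Gcd {n. f0 n > 0} = 1"
    and T: "filterlim T at_top F"
  shows "((\<lambda>e. x e (T e)) \<longlongrightarrow> (\<Sum>n. y0 n) / (\<Sum>n. real n * f0 n)) F"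
proof (rule ccontr)
  define L where "L = (\<Sum>n. y0 n) / (\<Sum>n. real n * f0 n)"
  assume "\<not> ((\<lambda>e. x e (T e)) \<longlongrightarrow> (\<Sum>n. y0 n) / (\<Sum>n. real n * f0 n)) F"
  then obtain d where d: "d > 0" and nev: "\<not> eventually (\<lambda>e. dist (x e (T e)) L < d) F"
    unfolding tendsto_iff L_def by blast
  \<comment> \<open>The filter on which the limit fails; every finer filter inherits the failure.\<close>
  define F' where "F' = inf F (principal {e. \<not> dist (x e (T e)) L < d})"
  have F': "F' \<le> F" "F' \<noteq> bot"
    using nev by (auto simp: F'_def trivial_limit_def eventually_inf_principal)
  have evF': "eventually (\<lambda>e. \<not> dist (x e (T e)) L < d) F'"
    unfolding F'_def eventually_inf_principal by simp
  have C: "C \<ge> 0"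
  proof -
    have "eventually (\<lambda>e. 0 \<le> C) F'"
      using filter_leD[OF F'(1) f] by (rule eventually_mono) (metis order_trans mult_1_right power_0)
    thus ?thesis using F'(2) by simp
  qed
  define B where "B = C / (1 - t)"
  have B: "eventually (\<lambda>e. \<forall>n. \<bar>x e n\<bar> \<le> B) F"
    using f y x
  proof eventually_elim
    case (elim e)
    show ?case
    proof
      fix n
      have "\<bar>x e n\<bar> \<le> (\<Sum>j\<le>n. \<bar>y e j\<bar>)" by (rule renewal_solution_bound[of "f e"]) (use elim in blast)+
      also have "\<dots> \<le> (\<Sum>j\<le>n. C * t ^ j)" using elim(2) by (intro sum_mono) auto
      also have "\<dots> \<le> (\<Sum>j. C * t ^ j)" using C t by (intro sum_le_suminf summable_mult) auto
      also have "\<dots> = B" using t by (simp add: B_def suminf_mult suminf_geometric)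
      finally show "\<bar>x e n\<bar> \<le> B" .
    qed
  qed
  \<comment> \<open>The solution seen from time \<open>T e\<close>, extended by zero to negative times; every fixed \<open>k\<close> is
    eventually beyond that range.\<close>
  define z where "z e k = (if int (T e) + k < 0 then 0 else x e (nat (int (T e) + k)))" for e k
  have Bp: "B \<ge> 0" using C t by (simp add: B_def)
  have zB: "eventually (\<lambda>e. \<forall>k. \<bar>z e k\<bar> \<le> B) F"
    using B by eventually_elim (auto simp: z_def Bp)
  obtain G v where G: "G \<noteq> bot" "G \<le> F'" and v: "\<And>k. ((\<lambda>e. z e k) \<longlongrightarrow> v k) G"
    using bounded_family_cluster[OF F'(2) filter_leD[OF F'(1) zB]] by blast
  have GF: "G \<le> F" using G(2) F'(1) by simp
  note ev = filter_leD[OF GF]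
  have fG: "((\<lambda>e. f e n) \<longlongrightarrow> f0 n) G" and yG: "((\<lambda>e. y e n) \<longlongrightarrow> y0 n) G" for n
    using tendsto_mono[OF GF] flim ylim by blast+
  have TG: "filterlim T at_top G" using filterlim_mono[OF T _ GF] by blast
  have Tlarge: "eventually (\<lambda>e. int (T e) + k \<ge> 0) G" for k
  proof -
    have "eventually (\<lambda>e. nat (- k) \<le> T e) G" using TG unfolding filterlim_at_top by blast
    thus ?thesis by eventually_elim simp
  qed
  have summ: "summable (\<lambda>n. C * t ^ n)" "summable (\<lambda>n. C * t ^ n * B)"
    using t by (auto intro!: summable_mult summable_mult2)
  have f0nn: "f0 n \<ge> 0" for n
    by (rule tendsto_lowerbound[OF fG eventually_mono[OF ev[OF f]] G(1)]) auto
  have f0le: "f0 n \<le> C * t ^ n" for n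
    by (rule tendsto_upperbound[OF fG eventually_mono[OF ev[OF f]] G(1)]) auto
  have y0le: "\<bar>y0 n\<bar> \<le> C * t ^ n" for n
    by (rule tendsto_upperbound[OF tendsto_rabs[OF yG] eventually_mono[OF ev[OF y]] G(1)]) auto
  have sf0: "summable f0" by (rule summable_geometric_tail[OF f0nn f0le t])
  have f0: "f0 sums 1"
  proof -
    have "((\<lambda>e. \<Sum>n. f e n) \<longlongrightarrow> (\<Sum>n. f0 n)) G"
      by (rule tannery[OF fG _ summ(1)]) (use ev[OF f] in \<open>eventually_elim, auto\<close>)
    moreover have "((\<lambda>e. \<Sum>n. f e n) \<longlongrightarrow> 1) G"
      by (rule tendsto_eventually) (use ev[OF f] in \<open>eventually_elim, auto dest: sums_unique\<close>)
    ultimately have "(\<Sum>n. f0 n) = 1" using tendsto_unique[OF G(1)] by blast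
    thus ?thesis using summable_sums[OF sf0] by simp
  qed
  have vB: "\<bar>v k\<bar> \<le> B" for k
    by (rule tendsto_upperbound[OF tendsto_rabs[OF v] eventually_mono[OF ev[OF zB]] G(1)]) auto
  have y_T: "((\<lambda>e. C * t ^ (nat (int (T e) + k))) \<longlongrightarrow> 0) G" for k
  proof -
    have "filterlim (\<lambda>e. nat (int (T e) + k)) at_top G"
      unfolding filterlim_at_top
    proof
      fix Z
      have "eventually (\<lambda>e. nat (int Z - k) \<le> T e) G" using TG unfolding filterlim_at_top by blast
      thus "eventually (\<lambda>e. Z \<le> nat (int (T e) + k)) G" by eventually_elim simp
    qed
    hence "((\<lambda>e. t ^ (nat (int (T e) + k))) \<longlongrightarrow> 0) G"
      using filterlim_compose[OF LIMSEQ_power_zero[of t]] t by simp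
    thus ?thesis by (rule tendsto_mult_right_zero)
  qed
  have zsum: "((\<lambda>e. \<Sum>m. R e m * z e (k - int m)) \<longlongrightarrow> (\<Sum>m. R0 m * v (k - int m))) G"
    if "\<And>m. ((\<lambda>e. R e m) \<longlongrightarrow> R0 m) G" "eventually (\<lambda>e. \<forall>m. \<bar>R e m\<bar> \<le> D * t ^ m) G" for R R0 k D
  proof (rule tannery[where M = "\<lambda>m. D * t ^ m * B"])
    show "eventually (\<lambda>e. \<forall>m. \<bar>R e m * z e (k - int m)\<bar> \<le> D * t ^ m * B) G"
      using that(2) ev[OF zB]
    proof eventually_elim
      case (elim e)
      thus ?case unfolding abs_mult by (metis abs_ge_zero mult_mono order_trans)
    qed
  qed (use t in \<open>auto intro!: tendsto_mult that v summable_mult2 summable_mult\<close>)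
  have zconv: "(\<Sum>m. R m * z e (k - int m)) = (\<Sum>m\<le>nat (int (T e) + k). R m * x e (nat (int (T e) + k) - m))"
    if "int (T e) + k \<ge> 0" for e k and R :: "nat \<Rightarrow> real"
  proof -
    define n where "n = nat (int (T e) + k)"
    have n: "int (T e) + k = int n" using that unfolding n_def by simp
    have zz: "z e (k - int m) = (if m \<le> n then x e (n - m) else 0)" for m
    proof -
      have "int (T e) + (k - int m) = int n - int m" using n by simp
      moreover have "nat (int n - int m) = n - m" by simp
      ultimately show ?thesis unfolding z_def by (cases "m \<le> n") (simp_all only: if_True if_False, auto)
    qed
    have "(\<Sum>m. R m * z e (k - int m)) = (\<Sum>m\<le>n. R m * z e (k - int m))"
      by (rule suminf_finite) (auto simp: zz)
    also have "\<dots> = (\<Sum>m\<le>n. R m * x e (n - m))" by (intro sum.cong) (auto simp: zz)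
    finally show ?thesis unfolding n_def .
  qed
  have harm: "(\<lambda>m. f0 m * v (k - int m)) sums v k" for k
  proof -
    have "((\<lambda>e. \<Sum>m. f e m * z e (k - int m)) \<longlongrightarrow> (\<Sum>m. f0 m * v (k - int m))) G"
      by (rule zsum[OF fG]) (use ev[OF f] in \<open>eventually_elim, auto\<close>)
    moreover have "((\<lambda>e. z e k - (\<Sum>m. f e m * z e (k - int m))) \<longlongrightarrow> 0) G"
    proof (rule Lim_null_comparison[OF _ y_T])
      show "eventually (\<lambda>e. norm (z e k - (\<Sum>m. f e m * z e (k - int m))) \<le> C * t ^ (nat (int (T e) + k))) G"
        using Tlarge[of k] ev[OF x] ev[OF y]
      proof eventually_elim
        case (elim e)
        define n where "n = nat (int (T e) + k)"
        have "z e k = x e n" using elim(1) unfolding z_def n_def by simp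
        moreover have "x e n = y e n + (\<Sum>m\<le>n. f e m * x e (n - m))" using elim(2) by blast
        ultimately have "z e k - (\<Sum>m. f e m * z e (k - int m)) = y e n"
          using zconv[OF elim(1), of "f e"] unfolding n_def[symmetric] by linarith
        thus ?case using elim(3) unfolding n_def by simp
      qed
    qed
    ultimately have "((\<lambda>e. z e k - (\<Sum>m. f e m * z e (k - int m)) + (\<Sum>m. f e m * z e (k - int m)))
        \<longlongrightarrow> 0 + (\<Sum>m. f0 m * v (k - int m))) G" by (intro tendsto_add)
    hence "((\<lambda>e. z e k) \<longlongrightarrow> (\<Sum>m. f0 m * v (k - int m))) G" by simp
    hence eq: "(\<Sum>m. f0 m * v (k - int m)) = v k" using v tendsto_unique[OF G(1)] by blast
    have "summable (\<lambda>m. f0 m * v (k - int m))"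
    proof (rule summable_comparison_test'[OF summable_mult2[OF sf0, of B], of 0])
      fix m show "norm (f0 m * v (k - int m)) \<le> f0 m * B"
        using vB f0nn by (simp add: abs_mult mult_left_mono)
    qed
    thus ?thesis using eq by (metis summable_sums)
  qed
  have const: "v k = v 0" for k by (rule bounded_harmonic_constant[OF f0nn f0 gcd vB harm])
  have f00: "f0 0 = 0"
    by (rule tendsto_unique[OF G(1) fG tendsto_eventually]) (use ev[OF f] in \<open>eventually_elim, auto\<close>)
  have Rlim: "((\<lambda>e. \<Sum>j. f e (j + Suc m)) \<longlongrightarrow> (\<Sum>j. f0 (j + Suc m))) G" for m
  proof (rule tannery[where M = "\<lambda>j. C * t ^ (j + Suc m)"])
    show "eventually (\<lambda>e. \<forall>j. \<bar>f e (j + Suc m)\<bar> \<le> C * t ^ (j + Suc m)) G"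
      using ev[OF f] by eventually_elim (metis abs_of_nonneg)
    show "summable (\<lambda>j. C * t ^ (j + Suc m))" using summ(1) by (rule summable_ignore_initial_segment)
  qed (rule fG)
  have Rbd: "eventually (\<lambda>e. \<forall>m. \<bar>\<Sum>j. f e (j + Suc m)\<bar> \<le> C / (1 - t) * t ^ m) G"
    using ev[OF f]
  proof eventually_elim
    case (elim e)
    show ?case
    proof
      fix m
      have "C / (1 - t) * t ^ Suc m \<le> C / (1 - t) * t ^ m"
        using C t by (intro mult_left_mono power_decreasing) auto
      thus "\<bar>\<Sum>j. f e (j + Suc m)\<bar> \<le> C / (1 - t) * t ^ m"
        using summable_geometric_tail(2)[of "f e" C t "Suc m"]
          summable_geometric_tail(3)[of "f e" C t "Suc m"] elim t by fastforce
    qed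
  qed
  have "((\<lambda>e. \<Sum>m. (\<Sum>j. f e (j + Suc m)) * z e (0 - int m)) \<longlongrightarrow> (\<Sum>m. (\<Sum>j. f0 (j + Suc m)) * v (0 - int m))) G"
    by (rule zsum[OF Rlim Rbd])
  moreover have "((\<lambda>e. \<Sum>m. (\<Sum>j. f e (j + Suc m)) * z e (0 - int m)) \<longlongrightarrow> (\<Sum>n. y0 n)) G"
  proof -
    have "((\<lambda>e. \<Sum>n. if n \<le> T e then y e n else 0) \<longlongrightarrow> (\<Sum>n. y0 n)) G"
    proof (rule tannery[OF _ _ summ(1)])
      fix n
      have "eventually (\<lambda>e. y e n = (if n \<le> T e then y e n else 0)) G"
        using TG unfolding filterlim_at_top by (auto elim: eventually_mono)
      thus "((\<lambda>e. if n \<le> T e then y e n else 0) \<longlongrightarrow> y0 n) G"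
        by (rule Lim_transform_eventually[OF yG])
    next
      show "eventually (\<lambda>e. \<forall>n. \<bar>if n \<le> T e then y e n else 0\<bar> \<le> C * t ^ n) G"
        using ev[OF y] by eventually_elim (use C t in auto)
    qed
    moreover have "eventually (\<lambda>e. (\<Sum>n. if n \<le> T e then y e n else 0)
        = (\<Sum>m. (\<Sum>j. f e (j + Suc m)) * z e (0 - int m))) G"
      using ev[OF f] ev[OF x]
    proof eventually_elim
      case (elim e)
      have "(\<Sum>n. if n \<le> T e then y e n else 0) = (\<Sum>n\<le>T e. if n \<le> T e then y e n else 0)"
        by (rule suminf_finite) auto
      also have "\<dots> = (\<Sum>n\<le>T e. y e n)" by (intro sum.cong) auto
      also have "\<dots> = (\<Sum>m\<le>T e. (\<Sum>j. f e (j + Suc m)) * x e (T e - m))"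
        by (rule renewal_tail_identity[symmetric]) (use elim in blast)+
      also have "\<dots> = (\<Sum>m. (\<Sum>j. f e (j + Suc m)) * z e (0 - int m))"
        using zconv[of e 0 "\<lambda>m. \<Sum>j. f e (j + Suc m)"] by simp
      finally show ?case .
    qed
    ultimately show ?thesis by (rule Lim_transform_eventually)
  qed
  ultimately have eq: "(\<Sum>m. (\<Sum>j. f0 (j + Suc m)) * v (0 - int m)) = (\<Sum>n. y0 n)"
    using tendsto_unique[OF G(1)] by blast
  have Rs: "(\<lambda>m. \<Sum>j. f0 (j + Suc m)) sums (\<Sum>n. real n * f0 n)"
    by (rule suminf_tails_eq_mean[OF f0nn f0le t C])
  have "(\<Sum>m. (\<Sum>j. f0 (j + Suc m)) * v (0 - int m)) = (\<Sum>n. real n * f0 n) * v 0"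
    unfolding const[of "0 - int _"] using sums_unique[OF sums_mult2[OF Rs]] by simp
  hence eq': "(\<Sum>n. real n * f0 n) * v 0 = (\<Sum>n. y0 n)" using eq by simp
  have "(\<Sum>n. real n * f0 n) \<ge> 1"
  proof -
    have Rnn: "0 \<le> (\<Sum>j. f0 (j + Suc m))" for m by (rule summable_geometric_tail[OF f0nn f0le t])
    have "(\<Sum>m\<in>{0}. (\<Sum>j. f0 (j + Suc m))) \<le> (\<Sum>m. (\<Sum>j. f0 (j + Suc m)))"
      by (rule sum_le_suminf[OF sums_summable[OF Rs]]) (use Rnn in auto)
    moreover have "(\<Sum>j. f0 (j + Suc 0)) = 1"
      using suminf_tail_Suc[OF sf0, of 0] f00 sums_unique[OF f0] by simp
    ultimately show ?thesis using sums_unique[OF Rs] by simp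
  qed
  hence "v 0 = L" using eq' unfolding L_def by (simp add: field_simps)
  moreover have "((\<lambda>e. x e (T e)) \<longlongrightarrow> v 0) G" using v[of 0] by (simp add: z_def)
  ultimately have "eventually (\<lambda>e. dist (x e (T e)) L < d) G" using d unfolding tendsto_iff by blast
  moreover have "eventually (\<lambda>e. \<not> dist (x e (T e)) L < d) G" using filter_leD[OF G(2) evF'] .
  ultimately have "eventually (\<lambda>e. False) G" by eventually_elim simp
  thus False using G(1) by simp
qed

section \<open>The law of an itinerary\<close>

text \<open>
  The law of the first \<open>n\<close> jumps of the chain started in \<open>i\<close>, as a distribution on lists. The
  recursion splits off the first jump, which turns first-step analysis into an unfolding.
\<close>

primrec walk :: "('s \<Rightarrow> ('s \<times> nat) pmf) \<Rightarrow> nat \<Rightarrow> 's \<Rightarrow> ('s \<times> nat) list pmf" where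
  "walk Q 0 i = return_pmf []"
| "walk Q (Suc n) i = bind_pmf (Q i) (\<lambda>(j, k). map_pmf ((#) (j, k)) (walk Q n j))"

text \<open>
  Position \<open>0\<close> is left out: the initial state is known and the initial duration never enters.
\<close>

definition itinerary :: "(nat \<Rightarrow> 's) \<Rightarrow> (nat \<Rightarrow> nat) \<Rightarrow> nat \<Rightarrow> ('s \<times> nat) list" where
  "itinerary e d N = map (\<lambda>m. (e (Suc m), d (Suc m))) [0..<N]"

lemma itinerary_Suc: "itinerary e d (Suc N) = (e 1, d 1) # itinerary (\<lambda>m. e (Suc m)) (\<lambda>m. d (Suc m)) N"
  unfolding itinerary_def by (subst upt_conv_Cons) (auto simp: map_Suc_upt[symmetric] simp del: upt_Suc)

lemma pmf_map_Cons: "pmf (map_pmf ((#) y) p) (z # xs) = (if y = z then pmf p xs else 0)"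
proof (cases "y = z")
  case True thus ?thesis using pmf_map_inj'[of "(#) z" p xs] by simp
next
  case False thus ?thesis by (auto intro!: pmf_map_outside)
qed

lemma pmf_walk:
  "length xs = N \<Longrightarrow> pmf (walk Q N i) xs = (\<Prod>m<N. pmf (Q (if m = 0 then i else fst (xs ! (m - 1)))) (xs ! m))"
proof (induction N arbitrary: xs i)
  case (Suc N)
  then obtain j k ys where xs: "xs = (j, k) # ys" and ys: "length ys = N" by (cases xs) auto
  have "pmf (walk Q (Suc N) i) xs = (\<integral>y. pmf (walk Q N (fst y)) ys * indicator {(j, k)} y \<partial>measure_pmf (Q i))"
    unfolding walk.simps pmf_bind xs
    by (intro Bochner_Integration.integral_cong) (auto simp: pmf_map_Cons split: prod.splits)
  also have "\<dots> = (\<Sum>y\<in>{(j, k)}. (pmf (walk Q N (fst y)) ys * indicator {(j, k)} y) * pmf (Q i) y)"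
    by (subst integral_measure_pmf_real[of "{(j, k)}"]) (auto split: if_splits simp: indicator_def)
  also have "\<dots> = pmf (Q i) (j, k) * pmf (walk Q N j) ys" by simp
  also have "pmf (walk Q N j) ys = (\<Prod>m<N. pmf (Q (if m = 0 then j else fst (ys ! (m - 1)))) (ys ! m))"
    by (rule Suc.IH[OF ys])
  also have "\<dots> = (\<Prod>m<N. pmf (Q (fst (xs ! m))) (xs ! Suc m))"
    by (intro prod.cong) (auto simp: xs nth_Cons')
  finally show ?case by (subst prod.lessThan_Suc_shift) (simp add: xs)
qed (simp add: pmf_return)

lemma set_pmf_walk_length: "xs \<in> set_pmf (walk Q N i) \<Longrightarrow> length xs = N"
  by (induction N arbitrary: xs i) auto

lemma markov_renewal_measurable:
  assumes "markov_renewal M \<eta> \<kappa> Q"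
  shows "\<eta> n \<in> M \<rightarrow>\<^sub>M count_space UNIV" "\<kappa> n \<in> M \<rightarrow>\<^sub>M count_space UNIV"
    and "\<omega> \<in> space M \<Longrightarrow> \<kappa> n \<omega> \<ge> 1"
proof -
  have k: "\<kappa> n \<in> M \<rightarrow>\<^sub>M count_space {1..}" using assms unfolding markov_renewal_def by blast
  show "\<eta> n \<in> M \<rightarrow>\<^sub>M count_space UNIV" using assms unfolding markov_renewal_def by blast
  have "(\<lambda>k. k) \<in> count_space {1..} \<rightarrow>\<^sub>M count_space (UNIV :: nat set)" by simp
  from measurable_compose[OF k this] show "\<kappa> n \<in> M \<rightarrow>\<^sub>M count_space UNIV" by simp
  show "\<omega> \<in> space M \<Longrightarrow> \<kappa> n \<omega> \<ge> 1" using measurable_space[OF k] by auto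
qed

text \<open>
  Conditioning on a null history says nothing, but then both sides vanish for all longer histories.
\<close>

lemma history_prob:
  assumes mr: "markov_renewal M \<eta> \<kappa> Q"
  shows "\<P>(\<omega> in M. \<forall>m\<le>N. \<eta> m \<omega> = x m \<and> \<kappa> m \<omega> = s m)
       = \<P>(\<omega> in M. \<eta> 0 \<omega> = x 0 \<and> \<kappa> 0 \<omega> = s 0) * (\<Prod>m<N. pmf (Q (x m)) (x (Suc m), s (Suc m)))"
proof (induction N)
  case (Suc N)
  interpret prob_space M using mr unfolding markov_renewal_def by blast
  note [measurable] = markov_renewal_measurable(1,2)[OF mr]
  let ?H = "\<lambda>N \<omega>. \<forall>m\<le>N. \<eta> m \<omega> = x m \<and> \<kappa> m \<omega> = s m"
  let ?S = "\<lambda>\<omega>. \<eta> (Suc N) \<omega> = x (Suc N) \<and> \<kappa> (Suc N) \<omega> = s (Suc N)"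
  have eq: "{\<omega> \<in> space M. ?H (Suc N) \<omega>} = {\<omega> \<in> space M. ?S \<omega> \<and> ?H N \<omega>}"
    using le_Suc_eq by auto
  have "\<P>(\<omega> in M. ?H (Suc N) \<omega>) = \<P>(\<omega> in M. ?H N \<omega>) * pmf (Q (x N)) (x (Suc N), s (Suc N))"
  proof (cases "\<P>(\<omega> in M. ?H N \<omega>) > 0")
    case True
    hence "\<P>(\<omega> in M. ?S \<omega> \<bar> ?H N \<omega>) = pmf (Q (x N)) (x (Suc N), s (Suc N))"
      using mr unfolding markov_renewal_def by blast
    hence "\<P>(\<omega> in M. ?S \<omega> \<and> ?H N \<omega>) / \<P>(\<omega> in M. ?H N \<omega>) = pmf (Q (x N)) (x (Suc N), s (Suc N))"
      unfolding cond_prob_def .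
    thus ?thesis using True eq by (simp add: field_simps)
  next
    case False
    hence z: "\<P>(\<omega> in M. ?H N \<omega>) = 0" using zero_less_measure_iff by fastforce
    have "\<P>(\<omega> in M. ?H (Suc N) \<omega>) \<le> \<P>(\<omega> in M. ?H N \<omega>)"
      by (rule finite_measure_mono) (auto, measurable)
    thus ?thesis using z by (simp add: measure_le_0_iff)
  qed
  thus ?case using Suc by simp
qed simp

lemma countable_itineraries: "countable (UNIV :: ('n::finite option \<times> nat) list set)"
proof -
  have "countable ((UNIV :: 'n option set) \<times> (UNIV :: nat set))"
    by (rule countable_SIGMA[OF countable_finite[OF finite]]) simp
  hence "countable (UNIV :: ('n option \<times> nat) set)" by simp
  thus ?thesis using countable_lists[of "UNIV :: ('n option \<times> nat) set"] by (simp add: lists_UNIV)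
qed

text \<open>
  Histories include the initial duration, whose law is arbitrary; summing over its values removes it and
  leaves a product of kernel weights. Itineraries form a countable set, so these point masses determine
  the law.
\<close>

lemma
  fixes \<eta> :: "nat \<Rightarrow> 'a \<Rightarrow> 'n::finite option"
  assumes mr: "markov_renewal M \<eta> \<kappa> Q" and start: "AE \<omega> in M. \<eta> 0 \<omega> = i"
  shows itinerary_measurable: "(\<lambda>\<omega>. itinerary (\<lambda>m. \<eta> m \<omega>) (\<lambda>m. \<kappa> m \<omega>) N) \<in> M \<rightarrow>\<^sub>M count_space UNIV"
    and itinerary_prob: "\<P>(\<omega> in M. E (itinerary (\<lambda>m. \<eta> m \<omega>) (\<lambda>m. \<kappa> m \<omega>) N)) = measure_pmf.prob (walk Q N i) {xs. E xs}"
proof -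
  interpret prob_space M using mr unfolding markov_renewal_def by blast
  note [measurable] = markov_renewal_measurable(1,2)[OF mr]
  let ?tr = "\<lambda>\<omega>. itinerary (\<lambda>m. \<eta> m \<omega>) (\<lambda>m. \<kappa> m \<omega>) N"
  have eq: "?tr \<omega> = xs \<longleftrightarrow> length xs = N \<and> (\<forall>m<N. \<eta> (Suc m) \<omega> = fst (xs ! m) \<and> \<kappa> (Suc m) \<omega> = snd (xs ! m))" for xs \<omega>
    by (auto simp: itinerary_def list_eq_iff_nth_eq prod_eq_iff)
  have tr_sets: "{\<omega> \<in> space M. ?tr \<omega> = xs} \<in> sets M" for xs
    unfolding eq by measurable
  show meas: "?tr \<in> M \<rightarrow>\<^sub>M count_space UNIV"
  proof (subst measurable_count_space_eq_countable[OF countable_itineraries], intro conjI ballI)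
    fix xs
    have "?tr -` {xs} \<inter> space M = {\<omega> \<in> space M. ?tr \<omega> = xs}" by blast
    thus "?tr -` {xs} \<inter> space M \<in> sets M" using tr_sets[of xs] by argo
  qed simp
  have single: "\<P>(\<omega> in M. ?tr \<omega> = xs) = pmf (walk Q N i) xs" for xs
  proof (cases "length xs = N")
    case False
    hence "xs \<notin> set_pmf (walk Q N i)" using set_pmf_walk_length[of xs Q N i] by meson
    moreover have "{\<omega> \<in> space M. ?tr \<omega> = xs} = {}" using False unfolding eq by blast
    ultimately show ?thesis by (simp only: set_pmf_iff measure_empty not_not)
  next
    case True
    \<comment> \<open>The history that belongs to \<open>xs\<close>, with \<open>k\<close> as the free initial duration.\<close>
    define x where "x m = (if m = 0 then i else fst (xs ! (m - 1)))" for m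
    define s where "s k m = (if m = 0 then k else snd (xs ! (m - 1)))" for k m :: nat
    let ?P = "\<Prod>m<N. pmf (Q (x m)) (x (Suc m), s 0 (Suc m))"
    let ?H = "\<lambda>k. {\<omega> \<in> space M. \<forall>m\<le>N. \<eta> m \<omega> = x m \<and> \<kappa> m \<omega> = s k m}"
    let ?I = "\<lambda>k. {\<omega> \<in> space M. \<eta> 0 \<omega> = i \<and> \<kappa> 0 \<omega> = k}"
    have Hp: "prob (?H k) = prob (?I k) * ?P" for k
    proof -
      have "(\<Prod>m<N. pmf (Q (x m)) (x (Suc m), s k (Suc m))) = ?P" by (simp add: s_def)
      moreover have "x 0 = i" "s k 0 = k" by (simp_all add: x_def s_def)
      ultimately show ?thesis using history_prob[OF mr, of N x "s k"] by metis
    qed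
    have "(\<lambda>k. prob (?H k)) sums prob (\<Union>k. ?H k)"
    proof (rule finite_measure_UNION)
      show "disjoint_family ?H"
        unfolding disjoint_family_on_def
      proof (intro ballI impI equals0I)
        fix k l \<omega> assume "k \<noteq> l" "\<omega> \<in> ?H k \<inter> ?H l"
        hence "\<kappa> 0 \<omega> = s k 0" "\<kappa> 0 \<omega> = s l 0" by blast+
        thus False using \<open>k \<noteq> l\<close> by (simp add: s_def)
      qed
      show "range ?H \<subseteq> sets M" by auto
    qed
    moreover have "(\<lambda>k. prob (?I k)) sums prob (\<Union>k. ?I k)"
      by (rule finite_measure_UNION) (auto simp: disjoint_family_on_def)
    moreover have "(\<Union>k. ?I k) = {\<omega> \<in> space M. \<eta> 0 \<omega> = i}" by auto
    moreover have "prob {\<omega> \<in> space M. \<eta> 0 \<omega> = i} = 1"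
      using start by (subst prob_Collect_eq_1) auto
    ultimately have "prob (\<Union>k. ?H k) = 1 * ?P" 
      by (intro sums_unique2[OF _ sums_mult2[of "\<lambda>k. prob (?I k)" 1 ?P]]) (simp_all only: Hp)
    moreover have "prob (\<Union>k. ?H k) = \<P>(\<omega> in M. ?tr \<omega> = xs)"
    proof (rule finite_measure_eq_AE)
      show "AE \<omega> in M. (\<omega> \<in> (\<Union>k. ?H k)) = (\<omega> \<in> {\<omega> \<in> space M. ?tr \<omega> = xs})"
        using start
      proof (eventually_elim)
        case (elim \<omega>)
        have "(\<forall>m\<le>N. \<eta> m \<omega> = x m \<and> \<kappa> m \<omega> = s k m) \<longleftrightarrow>
          \<kappa> 0 \<omega> = k \<and> (\<forall>m<N. \<eta> (Suc m) \<omega> = fst (xs ! m) \<and> \<kappa> (Suc m) \<omega> = snd (xs ! m))" for k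
        proof -
          have "(\<forall>m\<le>N. R m) \<longleftrightarrow> R 0 \<and> (\<forall>m<N. R (Suc m))" for R
            by (metis Suc_le_eq le0 not0_implies_Suc)
          thus ?thesis by (simp add: x_def s_def elim)
        qed
        thus ?case using True by (auto simp: eq)
      qed
    qed (use tr_sets in auto)
    moreover have "pmf (walk Q N i) xs = ?P"
      unfolding pmf_walk[OF True] by (intro prod.cong) (auto simp: x_def s_def)
    ultimately show ?thesis by simp
  qed
  have "distr M (count_space UNIV) ?tr = measure_pmf (walk Q N i)"
  proof (rule measure_eqI_countable[of _ UNIV])
    fix xs
    have "emeasure (distr M (count_space UNIV) ?tr) {xs} = emeasure M (?tr -` {xs} \<inter> space M)"
      by (rule emeasure_distr[OF meas]) simp
    also have "?tr -` {xs} \<inter> space M = {\<omega> \<in> space M. ?tr \<omega> = xs}" by auto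
    finally show "emeasure (distr M (count_space UNIV) ?tr) {xs} = emeasure (measure_pmf (walk Q N i)) {xs}"
      by (simp add: emeasure_eq_measure single emeasure_pmf_single)
  qed (use countable_itineraries in auto)
  hence "measure_pmf.prob (walk Q N i) {xs. E xs} = measure (distr M (count_space UNIV) ?tr) {xs. E xs}" by simp
  also have "\<dots> = prob (?tr -` {xs. E xs} \<inter> space M)" by (rule measure_distr[OF meas]) simp
  also have "?tr -` {xs. E xs} \<inter> space M = {\<omega> \<in> space M. E (?tr \<omega>)}" by auto
  finally show "\<P>(\<omega> in M. E (?tr \<omega>)) = measure_pmf.prob (walk Q N i) {xs. E xs}" ..
qed

lemma prob_walk_Suc:
  "measure_pmf.prob (walk Q (Suc N) i) {xs. E xs} =
     (\<integral>y. measure_pmf.prob (walk Q N (fst y)) {xs. E (y # xs)} \<partial>measure_pmf (Q i))"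
proof -
  have "measure_pmf.prob (walk Q (Suc N) i) {xs. E xs} =
     (\<integral>y. measure_pmf.prob (case y of (j, k) \<Rightarrow> map_pmf ((#) (j, k)) (walk Q N j)) {xs. E xs} \<partial>measure_pmf (Q i))"
    unfolding walk.simps measure_pmf_bind
    by (subst measure_pmf.measure_bind[where N = "count_space UNIV"]) (auto intro: measure_pmf_in_subprob_algebra)
  also have "\<dots> = (\<integral>y. measure_pmf.prob (walk Q N (fst y)) {xs. E (y # xs)} \<partial>measure_pmf (Q i))"
    by (intro Bochner_Integration.integral_cong) (auto simp: vimage_def split: prod.splits)
  finally show ?thesis .
qed

section \<open>First-passage and occupation events\<close>

text \<open>
  The two families of events of interest, read off a finite itinerary: \<open>j\<close> is first entered at time
  \<open>n\<close> with no earlier visit to the taboo set \<open>A\<close>; and, started in \<open>s\<close>, the process sits in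
  \<open>j\<close> at time \<open>n\<close> and has not entered \<open>A\<close> until then.
\<close>

fun first_visit :: "'s set \<Rightarrow> 's \<Rightarrow> nat \<Rightarrow> ('s \<times> nat) list \<Rightarrow> bool" where
  "first_visit A j n [] \<longleftrightarrow> False"
| "first_visit A j n (y # xs) \<longleftrightarrow>
     (if fst y = j then snd y = n else fst y \<notin> A \<and> snd y \<le> n \<and> first_visit A j (n - snd y) xs)"

fun occupies :: "'s set \<Rightarrow> 's \<Rightarrow> 's \<Rightarrow> nat \<Rightarrow> ('s \<times> nat) list \<Rightarrow> bool" where
  "occupies A j s n [] \<longleftrightarrow> False"
| "occupies A j s n (y # xs) \<longleftrightarrow>
     (if n < snd y then s = j else fst y \<notin> A \<and> occupies A j (fst y) (n - snd y) xs)"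

lemma sum_atLeast1_Suc: "(\<Sum>m=1..Suc n. d m) = d 1 + (\<Sum>m=1..n. d (Suc m) :: nat)"
proof -
  have "(\<Sum>m=1..Suc n. d m) = d 1 + (\<Sum>m=Suc 1..Suc n. d m)" by (simp add: sum.atLeast_Suc_atMost)
  thus ?thesis by (simp only: sum.shift_bounds_cl_Suc_ivl)
qed

lemma Ex_nat_Suc: "(\<exists>m. P m) \<longleftrightarrow> P 0 \<or> (\<exists>m. P (Suc m))"
  by (metis not0_implies_Suc)

lemma Ex_ge1_Suc: "(\<exists>m\<ge>1. P m) \<longleftrightarrow> P 1 \<or> (\<exists>m\<ge>1. P (Suc m))"
  by (metis One_nat_def Suc_le_mono le0 not0_implies_Suc not_less_eq_eq)

lemma Ball_Icc1_Suc: "(\<forall>m\<in>{1..Suc n}. P m) \<longleftrightarrow> P 1 \<and> (\<forall>m\<in>{1..n}. P (Suc m))"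
proof -
  have "{1..Suc n} = insert 1 (Suc ` {1..n})" by (auto simp: image_Suc_atLeastAtMost)
  thus ?thesis by (simp only: ball_simps image_iff) blast
qed

lemma Ball_Ico1_Suc: "m \<ge> 1 \<Longrightarrow> (\<forall>k\<in>{1..<Suc m}. P k) \<longleftrightarrow> P 1 \<and> (\<forall>k\<in>{1..<m}. P (Suc k))"
proof -
  assume "m \<ge> 1"
  hence "{1..<Suc m} = insert 1 (Suc ` {1..<m})" by (auto simp: image_Suc_atLeastLessThan)
  thus ?thesis by (simp only: ball_simps image_iff) blast
qed

text \<open>
  Every jump takes at least one time unit, so \<open>n\<close> jumps decide everything that happens until time \<open>n\<close>.
\<close>

lemma first_visit_itinerary:
  assumes "\<And>m. d m \<ge> 1" and "j \<notin> A" and "n \<le> N"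
  shows "first_visit A j n (itinerary e d N) \<longleftrightarrow>
    (\<exists>m\<ge>1. e m = j \<and> (\<forall>k\<in>{1..<m}. e k \<noteq> j) \<and> (\<forall>k\<in>{1..m}. e k \<notin> A) \<and> (\<Sum>k=1..m. d k) = n)"
    (is "_ \<longleftrightarrow> (\<exists>m\<ge>1. ?P m)")
  using assms
proof (induction N arbitrary: e d n)
  case 0
  have "(\<Sum>k=1..m. d k) \<ge> 1" if "m \<ge> 1" for m
    using 0(1)[of 1] member_le_sum[of 1 "{1..m}" d] that by auto
  hence "(\<Sum>k=1..m. d k) \<noteq> n" if "m \<ge> 1" for m using that 0(3) by fastforce
  thus ?case by (auto simp: itinerary_def)
next
  case (Suc N)
  let ?e = "\<lambda>m. e (Suc m)" and ?d = "\<lambda>m. d (Suc m)"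
  have d1: "d 1 \<ge> 1" and dS: "\<And>m. ?d m \<ge> 1" using Suc.prems(1) by blast+
  show ?case
  proof (cases "e 1 = j")
    case True
    have "(\<exists>m\<ge>1. e m = j \<and> (\<forall>k\<in>{1..<m}. e k \<noteq> j) \<and> (\<forall>k\<in>{1..m}. e k \<notin> A) \<and> (\<Sum>k=1..m. d k) = n) \<longleftrightarrow> d 1 = n"
    proof
      assume "\<exists>m\<ge>1. e m = j \<and> (\<forall>k\<in>{1..<m}. e k \<noteq> j) \<and> (\<forall>k\<in>{1..m}. e k \<notin> A) \<and> (\<Sum>k=1..m. d k) = n"
      then obtain m where m: "m \<ge> 1" "\<forall>k\<in>{1..<m}. e k \<noteq> j" "(\<Sum>k=1..m. d k) = n" by blast
      have "m = 1" using m(1,2) True by (metis atLeastLessThan_iff le_neq_implies_less le_refl)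
      thus "d 1 = n" using m(3) by simp
    next
      assume "d 1 = n"
      thus "\<exists>m\<ge>1. e m = j \<and> (\<forall>k\<in>{1..<m}. e k \<noteq> j) \<and> (\<forall>k\<in>{1..m}. e k \<notin> A) \<and> (\<Sum>k=1..m. d k) = n"
        using True Suc.prems(2) by (intro exI[of _ 1]) auto
    qed
    thus ?thesis using True by (simp add: itinerary_Suc)
  next
    case False
    have "(\<exists>m\<ge>1. e m = j \<and> (\<forall>k\<in>{1..<m}. e k \<noteq> j) \<and> (\<forall>k\<in>{1..m}. e k \<notin> A) \<and> (\<Sum>k=1..m. d k) = n) \<longleftrightarrow>
      (\<exists>m\<ge>1. ?e m = j \<and> (e 1 \<noteq> j \<and> (\<forall>k\<in>{1..<m}. ?e k \<noteq> j)) \<and> (e 1 \<notin> A \<and> (\<forall>k\<in>{1..m}. ?e k \<notin> A)) \<and> d 1 + (\<Sum>k=1..m. ?d k) = n)"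
      by (subst Ex_ge1_Suc) (use False in \<open>simp only: Ball_Ico1_Suc Ball_Icc1_Suc sum_atLeast1_Suc cong: conj_cong, blast\<close>)
    also have "\<dots> \<longleftrightarrow> e 1 \<notin> A \<and> d 1 \<le> n \<and>
      (\<exists>m\<ge>1. ?e m = j \<and> (\<forall>k\<in>{1..<m}. ?e k \<noteq> j) \<and> (\<forall>k\<in>{1..m}. ?e k \<notin> A) \<and> (\<Sum>k=1..m. ?d k) = n - d 1)"
    proof -
      have "a + b = n \<longleftrightarrow> a \<le> n \<and> b = n - a" for a b :: nat by auto
      thus ?thesis using False by (simp only:) blast
    qed
    also have "\<dots> \<longleftrightarrow> e 1 \<notin> A \<and> d 1 \<le> n \<and> first_visit A j (n - d 1) (itinerary ?e ?d N)"
    proof -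
      have "n - d 1 \<le> N" using d1 Suc.prems(3) by simp
      from Suc.IH[OF dS Suc.prems(2) this, of ?e] show ?thesis by (simp only:)
    qed
    finally show ?thesis using False by (simp add: itinerary_Suc)
  qed
qed

lemma occupies_itinerary:
  assumes "\<And>m. d m \<ge> 1" and "n < N"
  shows "occupies A j (e 0) n (itinerary e d N) \<longleftrightarrow>
    (\<exists>m. e m = j \<and> (\<forall>k\<in>{1..m}. e k \<notin> A) \<and> (\<Sum>k=1..m. d k) \<le> n \<and> n < (\<Sum>k=1..Suc m. d k))"
  using assms
proof (induction N arbitrary: e d n)
  case (Suc N)
  let ?e = "\<lambda>m. e (Suc m)" and ?d = "\<lambda>m. d (Suc m)"
  have d1: "d 1 \<ge> 1" and dS: "\<And>m. ?d m \<ge> 1" using Suc.prems(1) by blast+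
  let ?P = "\<lambda>m. e m = j \<and> (\<forall>k\<in>{1..m}. e k \<notin> A) \<and> (\<Sum>k=1..m. d k) \<le> n \<and> n < (\<Sum>k=1..Suc m. d k)"
  have ex: "(\<exists>m. ?P m) \<longleftrightarrow> ?P 0 \<or> (\<exists>m. ?P (Suc m))" by (rule Ex_nat_Suc)
  have P0: "?P 0 \<longleftrightarrow> e 0 = j \<and> n < d 1" by simp
  have PS: "?P (Suc m) \<longleftrightarrow> d 1 \<le> n \<and> e 1 \<notin> A \<and> ?e m = j \<and> (\<forall>k\<in>{1..m}. ?e k \<notin> A) \<and>
      (\<Sum>k=1..m. ?d k) \<le> n - d 1 \<and> n - d 1 < (\<Sum>k=1..Suc m. ?d k)" for m
    unfolding Ball_Icc1_Suc sum_atLeast1_Suc[of d] by auto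
  show ?case
  proof (cases "n < d 1")
    case True
    thus ?thesis unfolding ex P0 PS by (simp add: itinerary_Suc)
  next
    case False
    have "occupies A j (?e 0) (n - d 1) (itinerary ?e ?d N) \<longleftrightarrow>
      (\<exists>m. ?e m = j \<and> (\<forall>k\<in>{1..m}. ?e k \<notin> A) \<and> (\<Sum>k=1..m. ?d k) \<le> n - d 1 \<and> n - d 1 < (\<Sum>k=1..Suc m. ?d k))"
    proof (rule Suc.IH[OF dS])
      show "n - d 1 < N" using d1 Suc.prems(2) False by linarith
    qed
    thus ?thesis using False unfolding ex P0 PS by (simp add: itinerary_Suc)
  qed
qed simp

context
  fixes S :: "('n::finite, 'a) smp_family" and \<epsilon> :: real and \<omega> :: 'a
  assumes dur: "\<And>m. dur S \<epsilon> m \<omega> \<ge> 1"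
begin

lemma renewal_time_strict_mono: "m < m' \<Longrightarrow> renewal_time S \<epsilon> m \<omega> < renewal_time S \<epsilon> m' \<omega>"
proof (rule strict_monoD[of "\<lambda>m. renewal_time S \<epsilon> m \<omega>"])
  show "strict_mono (\<lambda>m. renewal_time S \<epsilon> m \<omega>)"
    unfolding strict_mono_Suc_iff
  proof
    fix n show "renewal_time S \<epsilon> n \<omega> < renewal_time S \<epsilon> (Suc n) \<omega>"
      using dur[of "Suc n"] by (simp add: renewal_time_def)
  qed
qed

lemma renewal_time_mono: "m \<le> m' \<Longrightarrow> renewal_time S \<epsilon> m \<omega> \<le> renewal_time S \<epsilon> m' \<omega>"
  using renewal_time_strict_mono by (metis le_neq_implies_less less_imp_le order_refl)

lemma hit_step_eq_enat:
  "hit_step S \<epsilon> j \<omega> = enat m \<longleftrightarrow> 1 \<le> m \<and> emb S \<epsilon> m \<omega> = j \<and> (\<forall>k\<in>{1..<m}. emb S \<epsilon> k \<omega> \<noteq> j)"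
proof -
  let ?V = "{n. 1 \<le> n \<and> emb S \<epsilon> n \<omega> = j}"
  show ?thesis
  proof (cases "?V = {}")
    case True
    have "hit_step S \<epsilon> j \<omega> = \<infinity>" unfolding hit_step_def True by (simp add: top_enat_def)
    thus ?thesis using True by auto
  next
    case False
    define l where "l = (LEAST n. n \<in> ?V)"
    have l: "l \<in> ?V" unfolding l_def using False by (metis LeastI ex_in_conv)
    have le: "l \<le> n" if "n \<in> ?V" for n unfolding l_def using that by (rule Least_le)
    have "hit_step S \<epsilon> j \<omega> = enat l"
      unfolding hit_step_def
    proof (rule antisym)
      show "(INF n\<in>?V. enat n) \<le> enat l" by (rule INF_lower[OF l])
      show "enat l \<le> (INF n\<in>?V. enat n)" by (rule INF_greatest) (simp add: le)
    qed
    moreover have "l = m \<longleftrightarrow> m \<in> ?V \<and> (\<forall>k\<in>{1..<m}. k \<notin> ?V)"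
    proof
      assume "l = m"
      thus "m \<in> ?V \<and> (\<forall>k\<in>{1..<m}. k \<notin> ?V)" using l le by (meson atLeastLessThan_iff leD)
    next
      assume m: "m \<in> ?V \<and> (\<forall>k\<in>{1..<m}. k \<notin> ?V)"
      hence "l \<le> m" "\<not> l < m" using l le by auto
      thus "l = m" by simp
    qed
    ultimately show ?thesis by auto
  qed
qed

lemma less_hit_step: "enat m < hit_step S \<epsilon> j \<omega> \<longleftrightarrow> (\<forall>k\<in>{1..m}. emb S \<epsilon> k \<omega> \<noteq> j)"
proof (cases "hit_step S \<epsilon> j \<omega>")
  case (enat l)
  hence l: "1 \<le> l" "emb S \<epsilon> l \<omega> = j" "\<forall>k\<in>{1..<l}. emb S \<epsilon> k \<omega> \<noteq> j" using hit_step_eq_enat by blast+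
  show ?thesis
  proof
    assume "enat m < hit_step S \<epsilon> j \<omega>"
    thus "\<forall>k\<in>{1..m}. emb S \<epsilon> k \<omega> \<noteq> j" using enat l by auto
  next
    assume "\<forall>k\<in>{1..m}. emb S \<epsilon> k \<omega> \<noteq> j"
    hence "\<not> l \<le> m" using l by auto
    thus "enat m < hit_step S \<epsilon> j \<omega>" using enat by simp
  qed
next
  case infinity
  have "emb S \<epsilon> k \<omega> \<noteq> j" if "1 \<le> k" for k
  proof
    assume "emb S \<epsilon> k \<omega> = j"
    hence "hit_step S \<epsilon> j \<omega> \<le> enat k" unfolding hit_step_def using that by (intro INF_lower) auto
    thus False using infinity by simp
  qed
  thus ?thesis using infinity by auto
qed

lemma less_hit_time: "enat n < hit_time S \<epsilon> j \<omega> \<longleftrightarrow> (\<forall>k\<ge>1. renewal_time S \<epsilon> k \<omega> \<le> n \<longrightarrow> emb S \<epsilon> k \<omega> \<noteq> j)"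
proof (cases "hit_step S \<epsilon> j \<omega>")
  case (enat l)
  hence l: "1 \<le> l" "emb S \<epsilon> l \<omega> = j" "\<forall>k\<in>{1..<l}. emb S \<epsilon> k \<omega> \<noteq> j" using hit_step_eq_enat by blast+
  have "(\<forall>k\<ge>1. renewal_time S \<epsilon> k \<omega> \<le> n \<longrightarrow> emb S \<epsilon> k \<omega> \<noteq> j) \<longleftrightarrow> n < renewal_time S \<epsilon> l \<omega>"
  proof
    assume "\<forall>k\<ge>1. renewal_time S \<epsilon> k \<omega> \<le> n \<longrightarrow> emb S \<epsilon> k \<omega> \<noteq> j"
    thus "n < renewal_time S \<epsilon> l \<omega>" using l not_le by blast
  next
    assume a: "n < renewal_time S \<epsilon> l \<omega>"
    show "\<forall>k\<ge>1. renewal_time S \<epsilon> k \<omega> \<le> n \<longrightarrow> emb S \<epsilon> k \<omega> \<noteq> j"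
    proof (intro allI impI)
      fix k assume k: "k \<ge> 1" "renewal_time S \<epsilon> k \<omega> \<le> n"
      have "\<not> l \<le> k" using a k(2) renewal_time_mono[of l k] by linarith
      thus "emb S \<epsilon> k \<omega> \<noteq> j" using l(3) k(1) by auto
    qed
  qed
  thus ?thesis unfolding hit_time_def enat by simp
next
  case infinity
  hence "\<forall>k\<in>{1..m}. emb S \<epsilon> k \<omega> \<noteq> j" for m using less_hit_step[of m j] by simp
  hence "\<forall>k\<ge>1. emb S \<epsilon> k \<omega> \<noteq> j" by (metis atLeastAtMost_iff order_refl)
  thus ?thesis unfolding hit_time_def infinity by simp
qed

text \<open>
  The renewal times are strictly increasing, so the number of renewals is determined by bracketing.
\<close>

lemma renewal_count_eq:
  assumes "renewal_time S \<epsilon> m \<omega> \<le> n" "n < renewal_time S \<epsilon> (Suc m) \<omega>"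
  shows "renewal_count S \<epsilon> n \<omega> = m" and "renewal_time S \<epsilon> k \<omega> \<le> n \<longleftrightarrow> k \<le> m"
proof -
  show *: "renewal_time S \<epsilon> k \<omega> \<le> n \<longleftrightarrow> k \<le> m" for k
    using assms renewal_time_mono[of k m] renewal_time_mono[of "Suc m" k] by (cases "k \<le> m") auto
  have "{k. renewal_time S \<epsilon> k \<omega> \<le> n} = {..m}" using * by auto
  thus "renewal_count S \<epsilon> n \<omega> = m" unfolding renewal_count_def by (simp add: Max_eq_iff)
qed

lemma renewal_count_exists: "\<exists>m. renewal_time S \<epsilon> m \<omega> \<le> n \<and> n < renewal_time S \<epsilon> (Suc m) \<omega>"
proof -
  have "m \<le> renewal_time S \<epsilon> m \<omega>" for m
  proof (induction m)
    case (Suc m)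
    thus ?case using renewal_time_strict_mono[of m "Suc m"] by simp
  qed simp
  hence ex: "n < renewal_time S \<epsilon> (Suc n) \<omega>" by (metis Suc_le_eq)
  define m where "m = (LEAST m. n < renewal_time S \<epsilon> (Suc m) \<omega>)"
  have m: "n < renewal_time S \<epsilon> (Suc m) \<omega>" unfolding m_def by (rule LeastI) (rule ex)
  have "renewal_time S \<epsilon> m \<omega> \<le> n"
  proof (cases m)
    case 0 thus ?thesis by (simp add: renewal_time_def)
  next
    case (Suc k)
    hence "\<not> n < renewal_time S \<epsilon> (Suc k) \<omega>" unfolding m_def by (metis lessI not_less_Least)
    thus ?thesis using Suc by simp
  qed
  thus ?thesis using m by blast
qed

lemma first_passage_event:
  assumes "n \<le> N"
  shows "hit_time S \<epsilon> (Some j) \<omega> = enat n \<and> hit_step S \<epsilon> None \<omega> > hit_step S \<epsilon> (Some j) \<omega> \<longleftrightarrow>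
    first_visit {None} (Some j) n (itinerary (\<lambda>m. emb S \<epsilon> m \<omega>) (\<lambda>m. dur S \<epsilon> m \<omega>) N)"
proof -
  have "hit_time S \<epsilon> (Some j) \<omega> = enat n \<and> hit_step S \<epsilon> None \<omega> > hit_step S \<epsilon> (Some j) \<omega> \<longleftrightarrow>
    (\<exists>m. hit_step S \<epsilon> (Some j) \<omega> = enat m \<and> renewal_time S \<epsilon> m \<omega> = n \<and> enat m < hit_step S \<epsilon> None \<omega>)"
    unfolding hit_time_def by (auto split: enat.splits)
  also have "\<dots> \<longleftrightarrow> first_visit {None} (Some j) n (itinerary (\<lambda>m. emb S \<epsilon> m \<omega>) (\<lambda>m. dur S \<epsilon> m \<omega>) N)"
    unfolding hit_step_eq_enat less_hit_step renewal_time_def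
    by (subst first_visit_itinerary) (use dur assms in auto)
  finally show ?thesis .
qed

lemma occupation_event:
  assumes "n < N"
  shows "semi_markov S \<epsilon> n \<omega> = j \<and> (\<forall>a\<in>A. enat n < hit_time S \<epsilon> a \<omega>) \<longleftrightarrow>
    occupies A j (emb S \<epsilon> 0 \<omega>) n (itinerary (\<lambda>m. emb S \<epsilon> m \<omega>) (\<lambda>m. dur S \<epsilon> m \<omega>) N)"
proof -
  obtain m where m: "renewal_time S \<epsilon> m \<omega> \<le> n" "n < renewal_time S \<epsilon> (Suc m) \<omega>"
    using renewal_count_exists by blast
  have iff: "(renewal_time S \<epsilon> l \<omega> \<le> n \<and> n < renewal_time S \<epsilon> (Suc l) \<omega>) \<longleftrightarrow> l = m" for l
    using renewal_count_eq(2)[OF m, of l] renewal_count_eq(2)[OF m, of "Suc l"] by linarith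
  have "semi_markov S \<epsilon> n \<omega> = j \<and> (\<forall>a\<in>A. enat n < hit_time S \<epsilon> a \<omega>) \<longleftrightarrow>
    emb S \<epsilon> m \<omega> = j \<and> (\<forall>k\<in>{1..m}. emb S \<epsilon> k \<omega> \<notin> A)"
    unfolding semi_markov_def renewal_count_eq(1)[OF m] less_hit_time renewal_count_eq(2)[OF m]
    by (simp only: atLeastAtMost_iff Ball_def) blast
  also have "\<dots> \<longleftrightarrow> (\<exists>l. emb S \<epsilon> l \<omega> = j \<and> (\<forall>k\<in>{1..l}. emb S \<epsilon> k \<omega> \<notin> A) \<and>
      renewal_time S \<epsilon> l \<omega> \<le> n \<and> n < renewal_time S \<epsilon> (Suc l) \<omega>)"
    unfolding iff by auto
  also have "\<dots> \<longleftrightarrow> occupies A j (emb S \<epsilon> 0 \<omega>) n (itinerary (\<lambda>m. emb S \<epsilon> m \<omega>) (\<lambda>m. dur S \<epsilon> m \<omega>) N)"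
    unfolding renewal_time_def by (rule occupies_itinerary[symmetric]) (use dur assms in auto)
  finally show ?thesis .
qed

end

section \<open>First-step equations\<close>

abbreviation kmass :: "('n, 'a) smp_family \<Rightarrow> real \<Rightarrow> 'n \<Rightarrow> 'n \<Rightarrow> nat \<Rightarrow> real" where
  "kmass S \<epsilon> s l n \<equiv> pmf (kern S \<epsilon> (Some s)) (Some l, n)"

definition survival :: "('n, 'a) smp_family \<Rightarrow> real \<Rightarrow> 'n \<Rightarrow> nat \<Rightarrow> real" where
  "survival S \<epsilon> s n = measure_pmf.prob (kern S \<epsilon> (Some s)) {y. n < snd y}"

text \<open>
  A common notation for the two probabilities of the theorem: \<open>B = {}\<close> only forbids the absorbing state,
  and \<open>B = {s}\<close> gives \<open>h_time\<close>. Letting the start vary while the taboo stays fixed closes the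
  first-step equations.
\<close>

definition occupation :: "('n, 'a) smp_family \<Rightarrow> real \<Rightarrow> 'n set \<Rightarrow> 'n \<Rightarrow> 'n \<Rightarrow> nat \<Rightarrow> real" where
  "occupation S \<epsilon> B s j n =
     \<P>(\<omega> in law S \<epsilon> (Some s). semi_markov S \<epsilon> n \<omega> = Some j \<and>
        (\<forall>a\<in>insert None (Some ` B). enat n < hit_time S \<epsilon> a \<omega>))"

lemma sum_option_UNIV:
  fixes f :: "'n::finite option \<Rightarrow> 'b::comm_monoid_add"
  shows "(\<Sum>l\<in>UNIV. f l) = f None + (\<Sum>l\<in>UNIV. f (Some l))"
proof -
  have "(\<Sum>l\<in>UNIV. f l) = (\<Sum>l\<in>insert None (range Some). f l)" by (simp add: UNIV_option_conv)
  also have "\<dots> = f None + (\<Sum>l\<in>range Some. f l)" by (rule sum.insert) auto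
  also have "(\<Sum>l\<in>range Some. f l) = (\<Sum>l\<in>UNIV. f (Some l))" by (subst sum.reindex) auto
  finally show ?thesis .
qed

lemma integral_first_step:
  fixes Q :: "('n::finite option \<times> nat) pmf"
  assumes "\<And>y. snd y > n \<Longrightarrow> F y = 0" "\<And>m. F (None, m) = 0"
  shows "(\<integral>y. F y \<partial>measure_pmf Q) = (\<Sum>l\<in>UNIV. \<Sum>m\<le>n. pmf Q (Some l, m) * F (Some l, m))"
proof -
  have "(\<integral>y. F y \<partial>measure_pmf Q) = (\<Sum>y\<in>UNIV \<times> {..n}. F y * pmf Q y)"
  proof (rule integral_measure_pmf_real)
    fix y assume "F y \<noteq> 0"
    hence "\<not> n < snd y" using assms(1) by blast
    thus "y \<in> UNIV \<times> {..n}" by (cases y) auto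
  qed simp
  also have "\<dots> = (\<Sum>l\<in>UNIV. \<Sum>m\<le>n. F (l, m) * pmf Q (l, m))"
    by (simp add: sum.cartesian_product)
  also have "\<dots> = (\<Sum>l\<in>UNIV. \<Sum>m\<le>n. F (Some l, m) * pmf Q (Some l, m))"
    by (simp add: sum_option_UNIV assms(2))
  finally show ?thesis by (simp add: mult.commute)
qed

lemma survival_eq:
  fixes S :: "('n::finite, 'a) smp_family"
  shows "survival S \<epsilon> s n = 1 - (\<Sum>j\<in>UNIV. \<Sum>m\<le>n. pmf (kern S \<epsilon> (Some s)) (j, m))"
proof -
  let ?Q = "kern S \<epsilon> (Some s)"
  have eq: "{y. n < snd y} = UNIV - ((UNIV :: 'n option set) \<times> {..n})" by auto
  have "survival S \<epsilon> s n = 1 - measure_pmf.prob ?Q (UNIV \<times> {..n})"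
    unfolding survival_def eq using measure_pmf.prob_compl[of "UNIV \<times> {..n}" ?Q] by simp
  also have "measure_pmf.prob ?Q (UNIV \<times> {..n}) = (\<Sum>y\<in>UNIV \<times> {..n}. pmf ?Q y)"
    by (rule measure_measure_pmf_finite) simp
  finally show ?thesis by (simp add: sum.cartesian_product)
qed

text \<open>
  The exponential Markov inequality, with the sum over the target states \<^emph>\<open>including\<close> the absorbing one.
\<close>

lemma survival_le:
  fixes S :: "('n::finite, 'a) smp_family"
  assumes M: "\<And>j n. (\<Sum>m\<le>n. exp (\<beta> * real m) * pmf (kern S \<epsilon> (Some s)) (j, m)) \<le> M" and b: "\<beta> > 0"
  shows "survival S \<epsilon> s n \<le> real CARD('n option) * M * exp (- \<beta> * real n)"
proof -
  let ?Q = "kern S \<epsilon> (Some s)"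
  have "survival S \<epsilon> s n \<le> measure_pmf.prob ?Q (\<Union>j\<in>UNIV. {y. fst y = j \<and> n < snd y})"
    unfolding survival_def by (intro measure_pmf.finite_measure_mono) auto
  also have "\<dots> \<le> (\<Sum>j\<in>UNIV. measure_pmf.prob ?Q {y. fst y = j \<and> n < snd y})"
    by (rule measure_pmf.finite_measure_subadditive_finite) auto
  also have "\<dots> \<le> (\<Sum>j\<in>(UNIV :: 'n option set). M * exp (- \<beta> * real n))"
  proof (rule sum_mono)
    fix j :: "'n option"
    have "(\<lambda>m. measure_pmf.prob ?Q {(j, Suc n + m)}) sums measure_pmf.prob ?Q (\<Union>m. {(j, Suc n + m)})"
      by (rule measure_pmf.finite_measure_UNION) (auto simp: disjoint_family_on_def)
    moreover have "(\<Union>m. {(j, Suc n + m)}) = {y. fst y = j \<and> n < snd y}"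
      by (auto simp: image_iff) (metis add_Suc less_imp_Suc_add)
    ultimately have s: "(\<lambda>m. pmf ?Q (j, Suc n + m)) sums measure_pmf.prob ?Q {y. fst y = j \<and> n < snd y}"
      by (simp add: measure_pmf_single)
    have "(\<Sum>m<K. pmf ?Q (j, Suc n + m)) \<le> M * exp (- \<beta> * real n)" for K
    proof -
      have "(\<Sum>m<K. pmf ?Q (j, Suc n + m)) \<le> (\<Sum>m<K. exp (- \<beta> * real n) * (exp (\<beta> * real (Suc n + m)) * pmf ?Q (j, Suc n + m)))"
      proof (rule sum_mono)
        fix m
        have "1 \<le> exp (- \<beta> * real n) * exp (\<beta> * real (Suc n + m))"
          unfolding exp_add[symmetric] using b by (simp add: algebra_simps)
        thus "pmf ?Q (j, Suc n + m) \<le> exp (- \<beta> * real n) * (exp (\<beta> * real (Suc n + m)) * pmf ?Q (j, Suc n + m))"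
          
          using mult_right_mono[of 1 "exp (- \<beta> * real n) * exp (\<beta> * real (Suc n + m))" "pmf ?Q (j, Suc n + m)"]
          by (simp only: mult.assoc mult_1 pmf_nonneg)
      qed
      also have "\<dots> = exp (- \<beta> * real n) * (\<Sum>m\<in>(\<lambda>m. Suc n + m) ` {..<K}. exp (\<beta> * real m) * pmf ?Q (j, m))"
        by (subst sum.reindex) (auto simp: sum_distrib_left)
      also have "\<dots> \<le> exp (- \<beta> * real n) * (\<Sum>m\<le>n + K. exp (\<beta> * real m) * pmf ?Q (j, m))"
        by (intro mult_left_mono sum_mono2) auto
      also have "\<dots> \<le> exp (- \<beta> * real n) * M" by (intro mult_left_mono M) auto
      finally show ?thesis by (simp add: mult.commute)
    qed
    thus "measure_pmf.prob ?Q {y. fst y = j \<and> n < snd y} \<le> M * exp (- \<beta> * real n)"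
      using s unfolding sums_def by (intro LIMSEQ_le_const2[of _ _ "M * exp (- \<beta> * real n)"]) auto
  qed
  finally show ?thesis by simp
qed

context
  fixes S :: "('n::finite, 'a) smp_family" and \<epsilon> :: real
  assumes S: "semi_markov_family S" and eps: "\<epsilon> \<ge> 0"
begin

lemma law_basics:
  shows "markov_renewal (law S \<epsilon> i) (emb S \<epsilon>) (dur S \<epsilon>) (kern S \<epsilon>)"
    and "AE \<omega> in law S \<epsilon> i. emb S \<epsilon> 0 \<omega> = i"
    and "\<omega> \<in> space (law S \<epsilon> i) \<Longrightarrow> dur S \<epsilon> m \<omega> \<ge> 1"
    and "prob_space (law S \<epsilon> i)"
proof -
  show mr: "markov_renewal (law S \<epsilon> i) (emb S \<epsilon>) (dur S \<epsilon>) (kern S \<epsilon>)"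
    and "AE \<omega> in law S \<epsilon> i. emb S \<epsilon> 0 \<omega> = i"
    using S eps unfolding semi_markov_family_def by blast+
  show "\<omega> \<in> space (law S \<epsilon> i) \<Longrightarrow> dur S \<epsilon> m \<omega> \<ge> 1" by (rule markov_renewal_measurable(3)[OF mr])
  show "prob_space (law S \<epsilon> i)" using mr unfolding markov_renewal_def by blast
qed

lemma kern_0: "pmf (kern S \<epsilon> i) (j, 0) = 0"
  using S eps unfolding semi_markov_family_def by blast

lemma g_time_walk:
  assumes "n \<le> N"
  shows "g_time S \<epsilon> i (Some j) n = measure_pmf.prob (walk (kern S \<epsilon>) N i) {xs. first_visit {None} (Some j) n xs}"
proof -
  have "g_time S \<epsilon> i (Some j) n = \<P>(\<omega> in law S \<epsilon> i.
      first_visit {None} (Some j) n (itinerary (\<lambda>m. emb S \<epsilon> m \<omega>) (\<lambda>m. dur S \<epsilon> m \<omega>) N))"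
    unfolding g_time_def
    by (intro arg_cong[where f = "measure (law S \<epsilon> i)"] Collect_cong conj_cong refl first_passage_event)
       (use law_basics(3) assms in auto)
  thus ?thesis using itinerary_prob[OF law_basics(1,2)] by simp
qed

lemma occupation_walk:
  assumes "n < N"
  shows "occupation S \<epsilon> B s j n =
    measure_pmf.prob (walk (kern S \<epsilon>) N (Some s)) {xs. occupies (insert None (Some ` B)) (Some j) (Some s) n xs}"
proof -
  let ?M = "law S \<epsilon> (Some s)" and ?A = "insert None (Some ` B)"
  let ?it = "\<lambda>\<omega>. itinerary (\<lambda>m. emb S \<epsilon> m \<omega>) (\<lambda>m. dur S \<epsilon> m \<omega>) N"
  interpret prob_space ?M by (rule law_basics)
  note [measurable] = markov_renewal_measurable(1,2)[OF law_basics(1)] itinerary_measurable[OF law_basics(1,2)]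
  have "occupation S \<epsilon> B s j n = \<P>(\<omega> in ?M. occupies ?A (Some j) (emb S \<epsilon> 0 \<omega>) n (?it \<omega>))"
    unfolding occupation_def
    by (intro arg_cong[where f = "measure ?M"] Collect_cong conj_cong refl occupation_event)
       (use law_basics(3) assms in auto)
  also have "\<dots> = \<P>(\<omega> in ?M. occupies ?A (Some j) (Some s) n (?it \<omega>))"
  proof (rule finite_measure_eq_AE)
    show "AE \<omega> in ?M. (\<omega> \<in> {\<omega> \<in> space ?M. occupies ?A (Some j) (emb S \<epsilon> 0 \<omega>) n (?it \<omega>)}) =
        (\<omega> \<in> {\<omega> \<in> space ?M. occupies ?A (Some j) (Some s) n (?it \<omega>)})"
      using law_basics(2)[of "Some s"] by eventually_elim auto
    have m: "?it \<in> ?M \<rightarrow>\<^sub>M count_space UNIV" by (rule itinerary_measurable[OF law_basics(1,2)])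
    have gen: "{\<omega> \<in> space ?M. E (?it \<omega>)} \<in> sets ?M" for E
    proof -
      have "?it -` {xs. E xs} \<inter> space ?M \<in> sets ?M" by (rule measurable_sets[OF m]) simp
      moreover have "?it -` {xs. E xs} \<inter> space ?M = {\<omega> \<in> space ?M. E (?it \<omega>)}" by auto
      ultimately show ?thesis by argo
    qed
    show "{\<omega> \<in> space ?M. occupies ?A (Some j) (Some s) n (?it \<omega>)} \<in> sets ?M" by (rule gen)
    have "{\<omega> \<in> space ?M. occupies ?A (Some j) (emb S \<epsilon> 0 \<omega>) n (?it \<omega>)} =
      (\<Union>i\<in>UNIV. {\<omega> \<in> space ?M. emb S \<epsilon> 0 \<omega> = i} \<inter> {\<omega> \<in> space ?M. occupies ?A (Some j) i n (?it \<omega>)})" by auto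
    also have "\<dots> \<in> sets ?M" by (intro sets.finite_UN sets.Int gen) (auto, measurable)
    finally show "{\<omega> \<in> space ?M. occupies ?A (Some j) (emb S \<epsilon> 0 \<omega>) n (?it \<omega>)} \<in> sets ?M" .
  qed
  also have "\<dots> = measure_pmf.prob (walk (kern S \<epsilon>) N (Some s)) {xs. occupies ?A (Some j) (Some s) n xs}"
    by (rule itinerary_prob[OF law_basics(1,2)])
  finally show ?thesis .
qed

lemma g_time_first_step:
  "g_time S \<epsilon> (Some s) (Some i) n = kmass S \<epsilon> s i n +
     (\<Sum>l\<in>-{i}. \<Sum>m\<le>n. kmass S \<epsilon> s l m * g_time S \<epsilon> (Some l) (Some i) (n - m))"
proof -
  define F where "F y = measure_pmf.prob (walk (kern S \<epsilon>) n (fst y)) {xs. first_visit {None} (Some i) n (y # xs)}" for y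
  have "g_time S \<epsilon> (Some s) (Some i) n = (\<integral>y. F y \<partial>measure_pmf (kern S \<epsilon> (Some s)))"
    unfolding F_def prob_walk_Suc[symmetric] by (rule g_time_walk) simp
  also have "\<dots> = (\<Sum>l\<in>UNIV. \<Sum>m\<le>n. kmass S \<epsilon> s l m * F (Some l, m))"
    by (rule integral_first_step) (auto simp: F_def)
  also have "\<dots> = (\<Sum>m\<le>n. kmass S \<epsilon> s i m * F (Some i, m)) + (\<Sum>l\<in>-{i}. \<Sum>m\<le>n. kmass S \<epsilon> s l m * F (Some l, m))"
    by (subst sum.remove[of _ i]) (auto simp: Compl_eq_Diff_UNIV)
  also have "(\<Sum>m\<le>n. kmass S \<epsilon> s i m * F (Some i, m)) = (\<Sum>m\<le>n. if m = n then kmass S \<epsilon> s i m else 0)"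
    by (intro sum.cong) (auto simp: F_def)
  also have "\<dots> = kmass S \<epsilon> s i n" by simp
  also have "(\<Sum>l\<in>-{i}. \<Sum>m\<le>n. kmass S \<epsilon> s l m * F (Some l, m)) =
      (\<Sum>l\<in>-{i}. \<Sum>m\<le>n. kmass S \<epsilon> s l m * g_time S \<epsilon> (Some l) (Some i) (n - m))"
    by (intro sum.cong refl) (auto simp: F_def g_time_walk[of "n - _" n])
  finally show ?thesis .
qed

lemma occupation_first_step:
  "occupation S \<epsilon> B s j n = (if s = j then survival S \<epsilon> s n else 0) +
     (\<Sum>l\<in>-B. \<Sum>m\<le>n. kmass S \<epsilon> s l m * occupation S \<epsilon> B l j (n - m))"
proof -
  let ?A = "insert None (Some ` B)" and ?Q = "kern S \<epsilon> (Some s)"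
  define F where "F y = (if n < snd y then 0
    else measure_pmf.prob (walk (kern S \<epsilon>) (Suc n) (fst y)) {xs. occupies ?A (Some j) (Some s) n (y # xs)})" for y
  define I :: "'n option \<times> nat \<Rightarrow> real" where "I y = (if s = j then 1 else 0) * indicator {y. n < snd y} y" for y :: "'n option \<times> nat"
  have split: "measure_pmf.prob (walk (kern S \<epsilon>) (Suc n) (fst y)) {xs. occupies ?A (Some j) (Some s) n (y # xs)} = I y + F y" for y
    by (auto simp: F_def I_def indicator_def)
  have "occupation S \<epsilon> B s j n = (\<integral>y. I y + F y \<partial>measure_pmf ?Q)"
    unfolding split[symmetric] by (rule trans[OF occupation_walk prob_walk_Suc]) simp
  also have "\<dots> = (\<integral>y. I y \<partial>measure_pmf ?Q) + (\<integral>y. F y \<partial>measure_pmf ?Q)"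
    by (intro Bochner_Integration.integral_add measure_pmf.integrable_const_bound[where B = 1])
       (auto simp: I_def F_def)
  also have "(\<integral>y. I y \<partial>measure_pmf ?Q) = (if s = j then survival S \<epsilon> s n else 0)"
    by (simp add: I_def survival_def)
  also have "(\<integral>y. F y \<partial>measure_pmf ?Q) = (\<Sum>l\<in>UNIV. \<Sum>m\<le>n. kmass S \<epsilon> s l m * F (Some l, m))"
    by (rule integral_first_step) (auto simp: F_def)
  also have "\<dots> = (\<Sum>l\<in>-B. \<Sum>m\<le>n. kmass S \<epsilon> s l m * F (Some l, m))"
    by (rule sum.mono_neutral_right) (auto simp: F_def intro!: sum.neutral)
  also have "\<dots> = (\<Sum>l\<in>-B. \<Sum>m\<le>n. kmass S \<epsilon> s l m * occupation S \<epsilon> B l j (n - m))"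
    by (intro sum.cong refl) (auto simp: F_def image_iff occupation_walk[of "n - _" "Suc n"] simp del: walk.simps)
  finally show ?thesis .
qed

lemma g_total_sums: "(\<lambda>n. g_time S \<epsilon> i (Some j) n) sums g_total S \<epsilon> i (Some j)"
proof -
  let ?M = "law S \<epsilon> i"
  interpret prob_space ?M by (rule law_basics)
  let ?E = "\<lambda>n. {\<omega> \<in> space ?M. hit_time S \<epsilon> (Some j) \<omega> = enat n \<and> hit_step S \<epsilon> None \<omega> > hit_step S \<epsilon> (Some j) \<omega>}"
  have "?E n \<in> sets ?M" for n
  proof -
    let ?it = "\<lambda>\<omega>. itinerary (\<lambda>m. emb S \<epsilon> m \<omega>) (\<lambda>m. dur S \<epsilon> m \<omega>) n"
    have "?it -` {xs. first_visit {None} (Some j) n xs} \<inter> space ?M \<in> sets ?M"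
      by (rule measurable_sets[OF itinerary_measurable[OF law_basics(1,2)]]) simp
    moreover have "?it -` {xs. first_visit {None} (Some j) n xs} \<inter> space ?M = ?E n"
    proof (intro set_eqI)
      fix \<omega>
      have "\<omega> \<in> space ?M \<Longrightarrow> first_visit {None} (Some j) n (?it \<omega>) \<longleftrightarrow>
        hit_time S \<epsilon> (Some j) \<omega> = enat n \<and> hit_step S \<epsilon> (Some j) \<omega> < hit_step S \<epsilon> None \<omega>"
        by (rule first_passage_event[symmetric, OF law_basics(3)], assumption, rule order_refl)
      thus "\<omega> \<in> ?it -` {xs. first_visit {None} (Some j) n xs} \<inter> space ?M \<longleftrightarrow> \<omega> \<in> ?E n" by blast
    qed
    ultimately show ?thesis by argo
  qed
  hence "(\<lambda>n. prob (?E n)) sums prob (\<Union>n. ?E n)"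
    by (intro finite_measure_UNION) (auto simp: disjoint_family_on_def)
  moreover have "(\<Union>n. ?E n) = {\<omega> \<in> space ?M. hit_step S \<epsilon> None \<omega> > hit_step S \<epsilon> (Some j) \<omega>}"
  proof (intro set_eqI iffI)
    fix \<omega> assume w: "\<omega> \<in> {\<omega> \<in> space ?M. hit_step S \<epsilon> None \<omega> > hit_step S \<epsilon> (Some j) \<omega>}"
    then obtain m where "hit_step S \<epsilon> (Some j) \<omega> = enat m" by (cases "hit_step S \<epsilon> (Some j) \<omega>") auto
    hence "\<omega> \<in> ?E (renewal_time S \<epsilon> m \<omega>)" using w by (simp add: hit_time_def)
    thus "\<omega> \<in> (\<Union>n. ?E n)" by blast
  qed blast
  ultimately show ?thesis unfolding g_time_def g_total_def by simp
qed

lemma h_time_occupation: "h_time S \<epsilon> (Some i) (Some j) n = occupation S \<epsilon> {i} i j n"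
  unfolding h_time_def occupation_def by (simp add: conj_commute)

end

lemma g_time_nonneg: "g_time S \<epsilon> i j n \<ge> 0" unfolding g_time_def by simp

lemma occupation_nonneg: "occupation S \<epsilon> B s j n \<ge> 0" unfolding occupation_def by simp

lemma occupation_empty:
  "occupation S \<epsilon> {} s j n = \<P>(\<omega> in law S \<epsilon> (Some s). semi_markov S \<epsilon> n \<omega> = Some j \<and> hit_time S \<epsilon> None \<omega> > enat n)"
  unfolding occupation_def by simp

section \<open>Supersolutions of first-step equations\<close>

text \<open>
  The operator behind all first-step equations; \<open>J\<close> is the set of states to which the first jump may go
  without ending the excursion.
\<close>

definition markov_convolution ::
  "'n set \<Rightarrow> ('n \<Rightarrow> 'n \<Rightarrow> nat \<Rightarrow> real) \<Rightarrow> ('n \<Rightarrow> nat \<Rightarrow> real) \<Rightarrow> 'n \<Rightarrow> nat \<Rightarrow> real" where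
  "markov_convolution J q f s n = (\<Sum>l\<in>J. \<Sum>m\<le>n. q s l m * f l (n - m))"

definition tilt :: "real \<Rightarrow> (nat \<Rightarrow> real) \<Rightarrow> nat \<Rightarrow> real" where
  "tilt \<rho> a n = exp (\<rho> * real n) * a n"

definition moment_seq :: "nat \<Rightarrow> (nat \<Rightarrow> real) \<Rightarrow> nat \<Rightarrow> real" where
  "moment_seq r a n = real n ^ r * a n"

lemma tilt_nonneg [simp]: "tilt \<rho> a n \<ge> 0 \<longleftrightarrow> a n \<ge> 0" by (simp add: tilt_def zero_le_mult_iff)
lemma tilt_pos [simp]: "tilt \<rho> a n > 0 \<longleftrightarrow> a n > 0" by (simp add: tilt_def zero_less_mult_iff)
lemma tilt_0 [simp]: "tilt \<rho> a 0 = a 0" by (simp add: tilt_def)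
lemma tilt_zero [simp]: "tilt 0 a = a" by (simp add: tilt_def fun_eq_iff)
lemma moment_seq_0 [simp]: "moment_seq 0 a = a" by (simp add: moment_seq_def fun_eq_iff)

text \<open>
  Exponential tilting respects convolutions, so facts about plain sums apply to all
  generating functions at real arguments.
\<close>

lemma tilt_convolution:
  assumes "\<And>s n. f s n = y s n + markov_convolution J q f s n"
  shows "tilt \<rho> (f s) n = tilt \<rho> (y s) n + markov_convolution J (\<lambda>s l. tilt \<rho> (q s l)) (\<lambda>l. tilt \<rho> (f l)) s n"
proof -
  have "tilt \<rho> (q s l) m * tilt \<rho> (f l) (n - m) = exp (\<rho> * real n) * (q s l m * f l (n - m))"
    if "m \<le> n" for l m
    using that by (simp add: tilt_def of_nat_diff algebra_simps flip: exp_add)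
  hence "markov_convolution J (\<lambda>s l. tilt \<rho> (q s l)) (\<lambda>l. tilt \<rho> (f l)) s n = exp (\<rho> * real n) * markov_convolution J q f s n"
    unfolding markov_convolution_def sum_distrib_left by (intro sum.cong) auto
  thus ?thesis by (simp add: tilt_def[of \<rho> "f s"] tilt_def[of \<rho> "y s"] assms[of s n] distrib_left)
qed

lemma sum_convolution:
  fixes a b :: "nat \<Rightarrow> real"
  shows "(\<Sum>n\<le>K. \<Sum>m\<le>n. a m * b (n - m)) = (\<Sum>m\<le>K. a m * (\<Sum>n\<le>K - m. b n))"
proof (induction K)
  case (Suc K)
  have "(\<Sum>m\<le>Suc K. a m * (\<Sum>n\<le>Suc K - m. b n)) =
    (\<Sum>m\<le>K. a m * (\<Sum>n\<le>K - m. b n) + a m * b (Suc K - m)) + a (Suc K) * b 0"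
    by (simp add: Suc_diff_le distrib_left)
  thus ?case using Suc by (simp add: sum.distrib)
qed simp

text \<open>
  Minimality of the solution: by induction on the truncation level \<open>K\<close> the partial sums never leave the
  region below a supersolution. Only mass at \<open>m \<ge> 1\<close> contributes, so the inner partial sums
  have strictly smaller length.
\<close>

lemma supersolution_bound:
  fixes f y :: "'n::finite \<Rightarrow> nat \<Rightarrow> real"
  assumes q: "\<And>s l n. q s l n \<ge> 0" "\<And>s l. q s l 0 = 0" and f: "\<And>s n. f s n \<ge> 0"
    and eq: "\<And>s n. f s n = y s n + markov_convolution J q f s n"
    and P: "\<And>s l K. (\<Sum>n\<le>K. q s l n) \<le> P s l" and Y: "\<And>s K. (\<Sum>n\<le>K. y s n) \<le> Y s"
    and w: "\<And>s. w s \<ge> 0" "\<And>s. Y s + (\<Sum>l\<in>J. P s l * w l) \<le> w s"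
  shows "(\<Sum>n\<le>K. f s n) \<le> w s"
proof (induction K arbitrary: s rule: less_induct)
  case (less K)
  have "(\<Sum>n\<le>K. f s n) = (\<Sum>n\<le>K. y s n) + (\<Sum>l\<in>J. \<Sum>n\<le>K. \<Sum>m\<le>n. q s l m * f l (n - m))"
    by (subst eq) (simp add: sum.distrib markov_convolution_def sum.swap[of _ "{..K}" J])
  also have "\<dots> = (\<Sum>n\<le>K. y s n) + (\<Sum>l\<in>J. \<Sum>m\<le>K. q s l m * (\<Sum>n\<le>K - m. f l n))"
    by (simp add: sum_convolution)
  also have "\<dots> \<le> Y s + (\<Sum>l\<in>J. \<Sum>m\<le>K. q s l m * w l)"
  proof (intro add_mono Y sum_mono)
    fix l m assume "m \<in> {..K}"
    show "q s l m * (\<Sum>n\<le>K - m. f l n) \<le> q s l m * w l"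
    proof (cases "m = 0")
      case False
      thus ?thesis using less.IH[of "K - m" l] q(1) \<open>m \<in> {..K}\<close> by (intro mult_left_mono) auto
    qed (simp add: q)
  qed
  also have "\<dots> \<le> Y s + (\<Sum>l\<in>J. P s l * w l)"
    by (intro add_left_mono sum_mono) (use P w in \<open>simp add: sum_distrib_right[symmetric] mult_right_mono\<close>)
  also have "\<dots> \<le> w s" by (rule w)
  finally show ?case .
qed

lemma summable_of_partial_bound:
  fixes f :: "nat \<Rightarrow> real"
  assumes "\<And>n. f n \<ge> 0" "\<And>K. (\<Sum>n\<le>K. f n) \<le> B"
  shows "summable f" "suminf f \<le> B"
proof -
  show s: "summable f"
  proof (rule bounded_imp_summable[of f B])
    show "f n \<ge> 0" for n by (rule assms)
    show "(\<Sum>k\<le>n. f k) \<le> B" for n by (rule assms)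
  qed
  have "(\<Sum>n<K. f n) \<le> B" for K
  proof -
    have "(\<Sum>n<K. f n) \<le> (\<Sum>n\<le>K. f n)" by (rule sum_mono2) (use assms(1) in auto)
    thus ?thesis using assms(2)[of K] by linarith
  qed
  thus "suminf f \<le> B" using s by (intro suminf_le_const) auto
qed

text \<open>
  Taking \<open>r\<close>-th moments in the convolution equation: expand \<open>n ^ r = (m + (n - m)) ^ r\<close> by the binomial
  theorem and sum the Cauchy products.
\<close>

lemma moment_equation:
  fixes f y :: "'n::finite \<Rightarrow> nat \<Rightarrow> real"
  assumes q: "\<And>l n. q s l n \<ge> 0" and f: "\<And>l n. f l n \<ge> 0"
    and eq: "\<And>n. f s n = y s n + markov_convolution J q f s n"
    and sq: "\<And>k l. k \<le> r \<Longrightarrow> moment_seq k (q s l) sums P k l"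
    and sf: "\<And>k l. k \<le> r \<Longrightarrow> moment_seq k (f l) sums F k l"
    and sy: "moment_seq r (y s) sums Y"
  shows "F r s = Y + (\<Sum>k\<le>r. real (r choose k) * (\<Sum>l\<in>J. P k l * F (r - k) l))"
proof -
  have binom: "real n ^ r * (q s l m * f l (n - m)) =
      (\<Sum>k\<le>r. real (r choose k) * (moment_seq k (q s l) m * moment_seq (r - k) (f l) (n - m)))"
    if "m \<le> n" for l m n
  proof -
    have "real n ^ r = (real m + real (n - m)) ^ r" using that by (simp add: of_nat_diff)
    also have "\<dots> = (\<Sum>k\<le>r. real (r choose k) * real m ^ k * real (n - m) ^ (r - k))"
      by (rule binomial_ring)
    finally show ?thesis by (simp add: moment_seq_def sum_distrib_left sum_distrib_right mult_ac)
  qed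
  have expand: "moment_seq r (f s) n = moment_seq r (y s) n +
      (\<Sum>k\<le>r. real (r choose k) * (\<Sum>l\<in>J. \<Sum>m\<le>n. moment_seq k (q s l) m * moment_seq (r - k) (f l) (n - m)))" for n
  proof -
    have "real n ^ r * markov_convolution J q f s n = (\<Sum>l\<in>J. \<Sum>m\<le>n. \<Sum>k\<le>r.
        real (r choose k) * (moment_seq k (q s l) m * moment_seq (r - k) (f l) (n - m)))"
      unfolding markov_convolution_def sum_distrib_left by (intro sum.cong refl binom) auto
    also have "\<dots> = (\<Sum>k\<le>r. \<Sum>l\<in>J. \<Sum>m\<le>n.
        real (r choose k) * (moment_seq k (q s l) m * moment_seq (r - k) (f l) (n - m)))"
      by (simp only: sum.swap[of _ "{..n}" "{..r}"] sum.swap[of _ J "{..r}"])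
    finally show ?thesis unfolding moment_seq_def[of r] by (subst eq) (simp add: distrib_left sum_distrib_left)
  qed
  have "(\<lambda>n. \<Sum>m\<le>n. moment_seq k (q s l) m * moment_seq (r - k) (f l) (n - m)) sums (P k l * F (r - k) l)"
    if "k \<le> r" for k l
  proof -
    have "norm (moment_seq k (q s l) n) = moment_seq k (q s l) n"
      "norm (moment_seq (r - k) (f l) n) = moment_seq (r - k) (f l) n" for n
      using q f by (simp_all add: moment_seq_def abs_mult)
    hence "summable (\<lambda>n. norm (moment_seq k (q s l) n))" "summable (\<lambda>n. norm (moment_seq (r - k) (f l) n))"
      using sums_summable[OF sq[OF that]] sums_summable[OF sf[of "r - k"]] by simp_all
    from Cauchy_product_sums[OF this] show ?thesis
      using sums_unique[OF sq[OF that]] sums_unique[OF sf[of "r - k" l]] by simp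
  qed
  hence "(\<lambda>n. moment_seq r (y s) n +
      (\<Sum>k\<le>r. real (r choose k) * (\<Sum>l\<in>J. \<Sum>m\<le>n. moment_seq k (q s l) m * moment_seq (r - k) (f l) (n - m))))
      sums (Y + (\<Sum>k\<le>r. real (r choose k) * (\<Sum>l\<in>J. P k l * F (r - k) l)))"
    by (intro sums_add sy sums_sum sums_mult) auto
  hence "moment_seq r (f s) sums (Y + (\<Sum>k\<le>r. real (r choose k) * (\<Sum>l\<in>J. P k l * F (r - k) l)))"
    unfolding expand[symmetric] by simp
  thus ?thesis using sf[of r s] sums_unique2 by blast
qed

lemma first_moment_equation:
  fixes f y :: "'n::finite \<Rightarrow> nat \<Rightarrow> real"
  assumes "\<And>l n. q s l n \<ge> 0" and "\<And>l n. f l n \<ge> 0"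
    and "\<And>n. f s n = y s n + markov_convolution J q f s n"
    and "\<And>l. q s l sums P l" and "\<And>l. f l sums F l" and "y s sums Y"
  shows "F s = Y + (\<Sum>l\<in>J. P l * F l)"
  using moment_equation[of q s f y J 0 "\<lambda>_. P" "\<lambda>_. F" Y] assms by simp

text \<open>
  Evaluate at a state where \<open>\<bar>R s\<bar> / w s\<close> is maximal.
\<close>

lemma contraction_bound:
  fixes R :: "'n::finite \<Rightarrow> real"
  assumes P: "\<And>s l. P s l \<ge> 0" and w: "\<And>s. w s > 0" "\<And>s. (\<Sum>l\<in>J. P s l * w l) \<le> \<theta> * w s"
    and th: "\<theta> < 1" and Y: "Y \<ge> 0"
    and R: "\<And>s. \<bar>R s\<bar> \<le> Y * w s + (\<Sum>l\<in>J. P s l * \<bar>R l\<bar>)"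
  shows "\<bar>R s\<bar> \<le> Y / (1 - \<theta>) * w s"
proof -
  define M where "M = Max (range (\<lambda>s. \<bar>R s\<bar> / w s))"
  have le: "\<bar>R l\<bar> \<le> M * w l" for l
  proof -
    have "\<bar>R l\<bar> / w l \<le> M" unfolding M_def by (rule Max_ge) auto
    thus ?thesis using w(1)[of l] by (simp add: field_simps)
  qed
  have "M \<in> range (\<lambda>s. \<bar>R s\<bar> / w s)" unfolding M_def by (rule Max_in) auto
  then obtain t where t: "M = \<bar>R t\<bar> / w t" by blast
  hence M0: "M \<ge> 0" using w(1)[of t] by simp
  have "M * w t = \<bar>R t\<bar>" using t w(1)[of t] by (simp add: field_simps)
  also have "\<dots> \<le> Y * w t + (\<Sum>l\<in>J. P t l * (M * w l))"
    using R[of t] sum_mono[of J "\<lambda>l. P t l * \<bar>R l\<bar>" "\<lambda>l. P t l * (M * w l)"] le P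
    by (meson add_left_mono mult_left_mono order_trans)
  also have "(\<Sum>l\<in>J. P t l * (M * w l)) = M * (\<Sum>l\<in>J. P t l * w l)"
    by (simp add: sum_distrib_left mult_ac)
  also have "\<dots> \<le> M * (\<theta> * w t)" by (rule mult_left_mono[OF w(2) M0])
  finally have "M * w t \<le> (Y + M * \<theta>) * w t" by (simp add: algebra_simps)
  hence "M \<le> Y + M * \<theta>" using w(1)[of t] by (metis mult_right_le_imp_le)
  hence "M \<le> Y / (1 - \<theta>)" using th by (simp add: field_simps)
  thus ?thesis using le[of s] w(1)[of s] by (meson less_imp_le mult_right_mono order_trans)
qed

text \<open>
  Finiteness of the solution is an open condition, and this is the witness. Write \<open>A\<close> for the matrix \<open>P\<close>
  restricted to \<open>J\<close> and \<open>F\<close> for the vector of sums. Iterating \<open>F = Y + A F\<close> gives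
  \<open>F = T k + A\<^sup>k F\<close> with \<open>T k = Y + A Y + \<dots> + A\<^sup>k\<^sup>-\<^sup>1 Y\<close>, and \<open>T k\<close> dominates the first \<open>k\<close>
  terms of the series, so it is positive everywhere once \<open>k\<close> is large. Then
  \<open>w = F + A F + \<dots> + A\<^sup>k\<^sup>-\<^sup>1 F\<close> satisfies \<open>A w = w - T k < w\<close>.
\<close>

lemma strict_supersolution_exists:
  fixes g y :: "'n::finite \<Rightarrow> nat \<Rightarrow> real"
  assumes q: "\<And>s l n. q s l n \<ge> 0" "\<And>s l. q s l 0 = 0" and g: "\<And>s n. g s n \<ge> 0" "\<And>s. \<exists>n. g s n > 0"
    and eq: "\<And>s n. g s n = y s n + markov_convolution J q g s n"
    and P: "\<And>s l. q s l sums P s l" and y: "\<And>s n. y s n \<ge> 0" "\<And>s. y s sums Y s" and F: "\<And>s. g s sums F s"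
  obtains w \<theta> where "\<And>s. w s > 0" "0 \<le> \<theta>" "\<theta> < 1" "\<And>s. (\<Sum>l\<in>J. P s l * w l) \<le> \<theta> * w s"
proof -
  have P0: "P s l \<ge> 0" for s l using sums_le[OF _ sums_zero P] q(1) by blast
  have Pp: "(\<Sum>n\<le>K. q s l n) \<le> P s l" for s l K
    using sum_le_suminf[OF sums_summable[OF P], of "{..K}"] q(1) sums_unique[OF P] by simp
  have Yp: "(\<Sum>n\<le>K. y s n) \<le> Y s" for s K
    using sum_le_suminf[OF sums_summable[OF y(2)], of "{..K}"] y(1) sums_unique[OF y(2)] by simp
  have Feq: "F s = Y s + (\<Sum>l\<in>J. P s l * F l)" for s
    by (rule first_moment_equation[of q s g y J "P s" F]) (use q g eq P F y in auto)
  define A where "A v s = (\<Sum>l\<in>J. P s l * v l)" for v :: "'n \<Rightarrow> real" and s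
  \<comment> \<open>\<open>T k\<close> and \<open>R k\<close> are the partial sum and the remainder of the Neumann series.\<close>
  define T where "T = rec_nat (\<lambda>_. 0) (\<lambda>_ v s. Y s + A v s)"
  define R where "R = rec_nat F (\<lambda>_. A)"
  have T: "T 0 = (\<lambda>_. 0)" "T (Suc k) = (\<lambda>s. Y s + A (T k) s)" for k by (simp_all add: T_def)
  have R: "R 0 = F" "R (Suc k) = A (R k)" for k by (simp_all add: R_def)
  have FTR: "F s = T k s + R k s" for k s
  proof (induction k arbitrary: s)
    case (Suc k)
    have "F s = Y s + (\<Sum>l\<in>J. P s l * (T k l + R k l))" using Feq[of s] Suc by simp
    thus ?case by (simp add: T R A_def distrib_left sum.distrib)
  qed (simp add: T R)
  have gT: "(\<Sum>n<k. g s n) \<le> T k s" for k s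
  proof (induction k arbitrary: s)
    case (Suc k)
    have Tn: "T k l \<ge> 0" for l using Suc[of l] g(1) by (meson order_trans sum_nonneg)
    have "(\<Sum>n<Suc k. g s n) = (\<Sum>n\<le>k. y s n) + (\<Sum>l\<in>J. \<Sum>n\<le>k. \<Sum>m\<le>n. q s l m * g l (n - m))"
      unfolding lessThan_Suc_atMost
      by (subst eq) (simp add: sum.distrib markov_convolution_def sum.swap[of _ "{..k}" J])
    also have "\<dots> = (\<Sum>n\<le>k. y s n) + (\<Sum>l\<in>J. \<Sum>m\<le>k. q s l m * (\<Sum>n\<le>k - m. g l n))"
      by (simp add: sum_convolution)
    also have "\<dots> \<le> Y s + (\<Sum>l\<in>J. \<Sum>m\<le>k. q s l m * T k l)"
    proof (intro add_mono Yp sum_mono)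
      fix l m assume m: "m \<in> {..k}"
      show "q s l m * (\<Sum>n\<le>k - m. g l n) \<le> q s l m * T k l"
      proof (cases "m = 0")
        case False
        have "(\<Sum>n\<le>k - m. g l n) \<le> (\<Sum>n<k. g l n)" using False m g(1) by (intro sum_mono2) auto
        thus ?thesis using Suc[of l] q(1) by (intro mult_left_mono) auto
      qed (simp add: q)
    qed
    also have "\<dots> \<le> Y s + (\<Sum>l\<in>J. P s l * T k l)"
      by (intro add_left_mono sum_mono) (use Pp Tn in \<open>simp add: sum_distrib_right[symmetric] mult_right_mono\<close>)
    finally show ?case by (simp add: T A_def)
  qed (simp add: T)
  obtain N where N: "\<And>s. g s (N s) > 0" using g(2) by metis
  define k where "k = Suc (Max (range N))"
  have Nk: "N s < k" for s unfolding k_def by (simp add: less_Suc_eq_le)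
  have Tpos: "T k s > 0" for s
  proof -
    have "g s (N s) \<le> (\<Sum>n<k. g s n)" using Nk g(1) by (intro member_le_sum) auto
    thus ?thesis using N[of s] gT[of s k] by linarith
  qed
  have Fpos: "F s > 0" for s
  proof -
    have "(\<Sum>n\<in>{N s}. g s n) \<le> suminf (g s)"
      by (rule sum_le_suminf[OF sums_summable[OF F]]) (use g in auto)
    thus ?thesis using N[of s] sums_unique[OF F[of s]] by simp
  qed
  have Rnn: "R j s \<ge> 0" for j s
  proof (induction j arbitrary: s)
    case (Suc j) thus ?case by (simp add: R A_def sum_nonneg P0)
  qed (simp add: R less_imp_le[OF Fpos])
  define w where "w s = (\<Sum>j<k. R j s)" for s
  have wpos: "w s > 0" for s
  proof -
    have "R 0 s \<le> w s" unfolding w_def by (rule member_le_sum) (auto simp: k_def Rnn)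
    thus ?thesis using Fpos[of s] by (simp add: R)
  qed
  have Aw: "(\<Sum>l\<in>J. P s l * w l) = w s - T k s" for s
  proof -
    have "(\<Sum>l\<in>J. P s l * w l) = (\<Sum>j<k. R (Suc j) s)"
      unfolding w_def R A_def sum_distrib_left by (rule sum.swap)
    also have "\<dots> = (\<Sum>j<Suc k. R j s) - R 0 s"
      by (simp add: sum.lessThan_Suc_shift del: sum.lessThan_Suc)
    also have "\<dots> = w s - (F s - R k s)" by (simp add: w_def R)
    also have "F s - R k s = T k s" using FTR[of s k] by simp
    finally show ?thesis .
  qed
  define \<theta> where "\<theta> = Max (range (\<lambda>s. (w s - T k s) / w s))"
  have ub: "(w s - T k s) / w s \<le> \<theta>" for s unfolding \<theta>_def by (rule Max_ge) auto
  have "\<theta> \<in> range (\<lambda>s. (w s - T k s) / w s)" unfolding \<theta>_def by (rule Max_in) auto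
  then obtain t where t: "\<theta> = (w t - T k t) / w t" by blast
  have "\<theta> < 1" using wpos[of t] Tpos[of t] by (simp add: t)
  moreover have "\<theta> \<ge> 0"
  proof -
    have "w t - T k t \<ge> 0" unfolding Aw[symmetric] by (intro sum_nonneg mult_nonneg_nonneg P0 less_imp_le wpos)
    thus ?thesis using t wpos[of t] by simp
  qed
  moreover have "(\<Sum>l\<in>J. P s l * w l) \<le> \<theta> * w s" for s
    using ub[of s] wpos[of s] unfolding Aw by (simp add: field_simps)
  ultimately show thesis using that[of w \<theta>] wpos by blast
qed

section \<open>First-passage times and solidarity\<close>

text \<open>
  The possible total lengths of paths from one state to another.
\<close>

inductive steps :: "('n \<Rightarrow> 'n \<Rightarrow> nat \<Rightarrow> real) \<Rightarrow> 'n \<Rightarrow> 'n \<Rightarrow> nat \<Rightarrow> bool" for q where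
  steps_refl: "steps q s s 0"
| steps_step: "q s l m > 0 \<Longrightarrow> steps q l t n \<Longrightarrow> steps q s t (m + n)"

lemma steps_trans: "steps q s t m \<Longrightarrow> steps q t u n \<Longrightarrow> steps q s u (m + n)"
proof (induction rule: steps.induct)
  case (steps_step s l m t k)
  thus ?case using steps.steps_step[of q s l m u "k + n"] by (simp add: add.assoc)
qed simp

locale first_passage =
  fixes q :: "'n::finite \<Rightarrow> 'n \<Rightarrow> nat \<Rightarrow> real" and g :: "'n \<Rightarrow> 'n \<Rightarrow> nat \<Rightarrow> real"
  assumes q_nonneg: "q s l n \<ge> 0" and q_0: "q s l 0 = 0" and g_nonneg: "g s i n \<ge> 0"
    and g_eq: "g s i n = q s i n + markov_convolution (-{i}) q (\<lambda>l. g l i) s n"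
begin

lemma g_ge_q: "q s i n \<le> g s i n"
  unfolding g_eq[of s i n] markov_convolution_def by (simp add: sum_nonneg q_nonneg g_nonneg)

lemma g_ge_step:
  assumes "l \<noteq> i" shows "q s l m * g l i n \<le> g s i (m + n)"
proof -
  have "q s l m * g l i n = (\<Sum>k\<in>{m}. q s l k * g l i (m + n - k))" by simp
  also have "\<dots> \<le> (\<Sum>k\<le>m + n. q s l k * g l i (m + n - k))"
    by (rule sum_mono2) (auto simp: q_nonneg g_nonneg)
  also have "\<dots> \<le> (\<Sum>l\<in>-{i}. \<Sum>k\<le>m + n. q s l k * g l i (m + n - k))"
    by (rule member_le_sum) (use assms in \<open>auto simp: q_nonneg g_nonneg intro!: sum_nonneg\<close>)
  also have "\<dots> \<le> g s i (m + n)"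
    unfolding g_eq[of s i "m + n"] markov_convolution_def by (simp add: q_nonneg)
  finally show ?thesis .
qed

lemma g_pos_imp_steps: "g s i n > 0 \<Longrightarrow> steps q s i n"
proof (induction n arbitrary: s rule: less_induct)
  case (less n)
  show ?case
  proof (cases "q s i n > 0")
    case True thus ?thesis using steps_step[of q s i n i 0] steps_refl[of q i] by simp
  next
    case False
    hence "markov_convolution (-{i}) q (\<lambda>l. g l i) s n \<noteq> 0"
      using less.prems g_eq[of s i n] q_nonneg[of s i n] by auto
    then obtain l m where lm: "l \<noteq> i" "m \<le> n" "q s l m * g l i (n - m) \<noteq> 0"
      unfolding markov_convolution_def
      by (metis (mono_tags, lifting) ComplD atMost_iff singletonI sum.neutral)
    hence pos: "q s l m > 0" "g l i (n - m) > 0"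
      using q_nonneg[of s l m] g_nonneg[of l i "n - m"] by (auto simp: less_le)
    have "m \<noteq> 0" using pos q_0 by (metis less_irrefl)
    hence "steps q l i (n - m)" using less.IH[of "n - m" l] lm(2) pos by simp
    from steps_step[where q = q, OF pos(1) this] show ?thesis using lm(2) by simp
  qed
qed

text \<open>
  Cutting a path at its first arrival in \<open>i\<close>.
\<close>

lemma steps_decompose:
  "steps q s i n \<Longrightarrow> (n = 0 \<and> s = i) \<or> (\<exists>a b. g s i a > 0 \<and> n = a + b \<and> steps q i i b)"
proof (induction rule: steps.induct)
  case (steps_step s l m t n)
  show ?case
  proof (cases "l = t")
    case True
    hence "g s t m > 0" using steps_step.hyps(1) g_ge_q[of s t m] by simp
    moreover have "steps q t t n" using steps_step.hyps(2) True by simp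
    ultimately show ?thesis by blast
  next
    case False
    then obtain a b where ab: "g l t a > 0" "n = a + b" "steps q t t b" using steps_step.IH by blast
    have "0 < q s l m * g l t a" using steps_step.hyps ab by simp
    hence "g s t (m + a) > 0" using g_ge_step[OF False] by (meson less_le_trans)
    thus ?thesis using ab by (metis add.assoc)
  qed
qed simp

lemma g_0: "g s i 0 = 0"
  by (subst g_eq) (simp add: markov_convolution_def q_0)

lemma return_times_divide:
  assumes "\<And>n. g i i n > 0 \<Longrightarrow> d dvd n" and "steps q i i n"
  shows "d dvd n"
  using assms(2)
proof (induction n rule: less_induct)
  case (less n)
  show ?case
  proof (cases "n = 0")
    case False
    then obtain a b where ab: "g i i a > 0" "n = a + b" "steps q i i b"
      using steps_decompose[OF less.prems] by blast
    have "a \<noteq> 0" using ab(1) g_0 by (metis less_irrefl)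
    thus ?thesis using ab less.IH[of b] assms(1)[of a] by simp
  qed simp
qed

text \<open>
  If \<open>d\<close> divides all return times to \<open>i\<close>, then it divides the lengths of the closed paths
  \<open>i \<rightarrow> j \<rightarrow> i\<close> and \<open>i \<rightarrow> j \<rightarrow> j \<rightarrow> i\<close>, and hence their difference, a return time to \<open>j\<close>.
\<close>

lemma aperiodic_solidarity:
  assumes irr: "\<And>s t. \<exists>n. g s t n > 0" and ap: "Gcd {n. g j j n > 0} = 1"
  shows "Gcd {n. g i i n > 0} = 1"
proof -
  let ?d = "Gcd {n. g i i n > 0}"
  have d: "?d dvd n" if "steps q i i n" for n
    by (rule return_times_divide[OF _ that]) auto
  obtain a b where ab: "steps q i j a" "steps q j i b" using irr g_pos_imp_steps by meson
  have "?d dvd n" if "g j j n > 0" for n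
  proof -
    have "steps q i i (a + (n + b))" using steps_trans[OF ab(1) steps_trans[OF g_pos_imp_steps[OF that] ab(2)]] .
    moreover have "steps q i i (a + b)" by (rule steps_trans[OF ab])
    ultimately have "?d dvd (a + (n + b)) - (a + b)" using d by (intro dvd_diff_nat) auto
    thus ?thesis by simp
  qed
  hence "?d dvd Gcd {n. g j j n > 0}" by (intro Gcd_greatest) auto
  thus ?thesis using ap by simp
qed

text \<open>
  Finiteness propagates from a state to its successors other than the target, because the passage through
  a successor is part of the passage from the state.
\<close>

lemma summable_first_passage:
  assumes i: "summable (g i i)" and irr: "\<And>s t. \<exists>n. g s t n > 0"
  shows "summable (g s i)"
proof -
  have "steps q t s n \<Longrightarrow> summable (g t i) \<Longrightarrow> summable (g s i)" for t n
  proof (induction rule: steps.induct)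
    case (steps_step s l m t n)
    have "summable (g l i)"
    proof (cases "l = i")
      case False
      have "summable (\<lambda>n. g s i (n + m))" using steps_step.prems by (rule summable_ignore_initial_segment)
      hence "summable (\<lambda>n. q s l m * g l i n)"
        by (rule summable_comparison_test'[of _ 0])
           (use g_ge_step[OF False, of s m] q_nonneg g_nonneg in \<open>auto simp: add.commute\<close>)
      thus ?thesis using steps_step.hyps(1) by (simp add: summable_cmult_iff)
    qed (use i in simp)
    thus ?case by (rule steps_step.IH)
  qed simp
  thus ?thesis using i irr g_pos_imp_steps by meson
qed

text \<open>
  If returns to \<open>i\<close> have total mass one, the first-passage masses \<open>v\<close> to \<open>i\<close> form a positive
  eigenvector of \<open>P\<close> for the eigenvalue one. Scaled to \<open>w j = 1\<close> it solves the equation of the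
  first-passage masses to \<open>j\<close>, hence dominates the minimal solution \<open>u\<close>; the difference is fixed by a
  contraction and so vanishes, which gives \<open>u j = 1\<close>.
\<close>

lemma return_solidarity:
  assumes irr: "\<And>s t. \<exists>n. g s t n > 0" and P: "\<And>s l. q s l sums P s l" and i: "g i i sums 1"
  shows "g j j sums 1"
proof -
  define v where "v s = (\<Sum>n. g s i n)" for s
  have v: "g s i sums v s" for s
    unfolding v_def by (rule summable_sums[OF summable_first_passage[OF sums_summable[OF i] irr]])
  have vpos: "v s > 0" for s
  proof -
    obtain n where "g s i n > 0" using irr by blast
    thus ?thesis unfolding v_def using g_nonneg sums_summable[OF v] by (intro suminf_pos2) auto
  qed
  have vi: "v i = 1" using sums_unique[OF i] by (simp add: v_def)
  have P0: "P s l \<ge> 0" for s l using sums_le[OF _ sums_zero P] q_nonneg by blast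
  have Pp: "(\<Sum>n\<le>K. q s l n) \<le> P s l" for s l K
    using sum_le_suminf[OF sums_summable[OF P], of "{..K}"] q_nonneg sums_unique[OF P] by simp
  have veq: "v s = (\<Sum>l\<in>UNIV. P s l * v l)" for s
  proof -
    have "v s = P s i + (\<Sum>l\<in>-{i}. P s l * v l)"
      by (rule first_moment_equation[of q s "\<lambda>s. g s i" "\<lambda>s. q s i" _ "P s" v])
         (use q_nonneg g_nonneg g_eq P v in auto)
    thus ?thesis by (subst sum.remove[of _ i]) (auto simp: vi Compl_eq_Diff_UNIV)
  qed
  define w where "w s = v s / v j" for s
  have wj: "w j = 1" using vpos[of j] by (simp add: w_def)
  have wpos: "w s > 0" for s using vpos by (simp add: w_def)
  have weq: "w s = P s j + (\<Sum>l\<in>-{j}. P s l * w l)" for s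
  proof -
    have "w s = (\<Sum>l\<in>UNIV. P s l * w l)"
      unfolding w_def by (subst veq) (simp add: sum_divide_distrib)
    thus ?thesis by (subst (asm) sum.remove[of _ j]) (auto simp: wj Compl_eq_Diff_UNIV)
  qed
  have bd: "(\<Sum>n\<le>K. g s j n) \<le> w s" for s K
    by (rule supersolution_bound[where f = "\<lambda>s. g s j" and y = "\<lambda>s. q s j" and Y = "\<lambda>s. P s j",
          OF q_nonneg q_0 g_nonneg g_eq Pp Pp less_imp_le[OF wpos] eq_refl[OF weq[symmetric]]])
  define u where "u s = (\<Sum>n. g s j n)" for s
  have u: "g s j sums u s" for s
    unfolding u_def by (intro summable_sums summable_of_partial_bound(1)[OF g_nonneg bd])
  have ueq: "u s = P s j + (\<Sum>l\<in>-{j}. P s l * u l)" for s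
    by (rule first_moment_equation[where f = "\<lambda>s. g s j" and y = "\<lambda>s. q s j",
          OF q_nonneg g_nonneg g_eq P u P])
  obtain w' \<theta> where w': "\<And>s. w' s > 0" "0 \<le> \<theta>" "\<theta> < 1" "\<And>s. (\<Sum>l\<in>-{j}. P s l * w' l) \<le> \<theta> * w' s"
    by (rule strict_supersolution_exists[where g = "\<lambda>s. g s j" and y = "\<lambda>s. q s j",
          OF q_nonneg q_0 g_nonneg irr g_eq P q_nonneg P u]) blast
  have d: "w s - u s = (\<Sum>l\<in>-{j}. P s l * (w l - u l))" for s
    using weq[of s] ueq[of s] by (simp add: right_diff_distrib sum_subtractf)
  have "\<bar>w j - u j\<bar> \<le> 0 / (1 - \<theta>) * w' j"
  proof (rule contraction_bound[where R = "\<lambda>s. w s - u s" and P = P and J = "-{j}"])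
    show "\<bar>w s - u s\<bar> \<le> 0 * w' s + (\<Sum>l\<in>-{j}. P s l * \<bar>w l - u l\<bar>)" for s
      by (subst d) (use P0 in \<open>auto intro!: order_trans[OF sum_abs] sum_mono simp: abs_mult\<close>)
  qed (use P0 w' in auto)
  hence "u j = 1" using wj by simp
  thus ?thesis using u[of j] by simp
qed

end

section \<open>Generating functions of exponentially bounded sequences\<close>

definition exp_moment :: "nat \<Rightarrow> real \<Rightarrow> (nat \<Rightarrow> real) \<Rightarrow> real" where
  "exp_moment r \<rho> a = (\<Sum>n. moment_seq r (tilt \<rho> a) n)"

lemma power_over_fact_le_exp:
  fixes x :: real assumes "x \<ge> 0" shows "x ^ r / fact r \<le> exp x"
proof -
  have e: "(\<lambda>n. x ^ n / fact n) sums exp x"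
    using exp_converges[of x] by (simp add: divide_real_def mult.commute)
  have "(\<Sum>n\<in>{r}. x ^ n / fact n) \<le> (\<Sum>n. x ^ n / fact n)"
    by (rule sum_le_suminf[OF sums_summable[OF e]]) (use assms in auto)
  thus ?thesis using sums_unique[OF e] by simp
qed

lemma summable_poly_exp:
  assumes "\<delta> > 0" shows "summable (\<lambda>n. real n ^ r * exp (- \<delta> * real n))"
proof (rule summable_comparison_test')
  have "summable (\<lambda>n. exp (- \<delta> / 2) ^ n)" using assms by (intro summable_geometric) simp
  thus "summable (\<lambda>n. fact r / (\<delta> / 2) ^ r * exp (- \<delta> / 2) ^ n)" by (rule summable_mult)
next
  fix n :: nat
  have "(\<delta> / 2 * real n) ^ r / fact r \<le> exp (\<delta> / 2 * real n)"
    by (rule power_over_fact_le_exp) (use assms in simp)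
  hence "real n ^ r \<le> fact r / (\<delta> / 2) ^ r * exp (\<delta> / 2 * real n)"
    using assms by (simp add: field_simps power_mult_distrib)
  hence "real n ^ r * exp (- \<delta> * real n) \<le> fact r / (\<delta> / 2) ^ r * exp (\<delta> / 2 * real n) * exp (- \<delta> * real n)"
    by (intro mult_right_mono) auto
  also have "\<dots> = fact r / (\<delta> / 2) ^ r * exp (- \<delta> / 2) ^ n"
    by (simp add: exp_of_nat_mult[symmetric] mult.assoc flip: exp_add)
  finally show "norm (real n ^ r * exp (- \<delta> * real n)) \<le> fact r / (\<delta> / 2) ^ r * exp (- \<delta> / 2) ^ n"
    by simp
qed

lemma moment_tilt_bound:
  assumes "\<bar>a n\<bar> \<le> C * exp (- \<rho>1 * real n)" "\<sigma> \<le> \<sigma>1"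
  shows "\<bar>moment_seq r (tilt \<sigma> a) n\<bar> \<le> C * (real n ^ r * exp (- (\<rho>1 - \<sigma>1) * real n))"
proof -
  have "\<bar>moment_seq r (tilt \<sigma> a) n\<bar> = real n ^ r * (exp (\<sigma> * real n) * \<bar>a n\<bar>)"
    by (simp add: moment_seq_def tilt_def abs_mult)
  also have "\<dots> \<le> real n ^ r * (exp (\<sigma>1 * real n) * (C * exp (- \<rho>1 * real n)))"
    by (intro mult_left_mono mult_mono assms) (auto simp: assms mult_right_mono)
  also have "\<dots> = C * (real n ^ r * (exp (\<sigma>1 * real n) * exp (- \<rho>1 * real n)))" by (simp add: mult_ac)
  also have "exp (\<sigma>1 * real n) * exp (- \<rho>1 * real n) = exp (- (\<rho>1 - \<sigma>1) * real n)"
    by (simp add: algebra_simps flip: exp_add)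
  finally show ?thesis .
qed

lemma exp_moment_sums:
  assumes "\<And>n. \<bar>a n\<bar> \<le> C * exp (- \<rho>1 * real n)" "\<sigma> < \<rho>1"
  shows "moment_seq r (tilt \<sigma> a) sums exp_moment r \<sigma> a"
  unfolding exp_moment_def
proof (rule summable_sums, rule summable_comparison_test')
  show "summable (\<lambda>n. C * (real n ^ r * exp (- (\<rho>1 - \<sigma>) * real n)))"
    using assms by (intro summable_mult summable_poly_exp) simp
  show "norm (moment_seq r (tilt \<sigma> a) n) \<le> C * (real n ^ r * exp (- (\<rho>1 - \<sigma>) * real n))" for n
    unfolding real_norm_def by (rule moment_tilt_bound[OF assms(1) order_refl])
qed

text \<open>
  Joint continuity of generating functions and their derivatives in the argument and in the sequence: the
  argument eventually stays below a point strictly left of \<open>\<rho>1\<close>, which provides the dominating series.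
\<close>

lemma exp_moment_tendsto:
  assumes bd: "eventually (\<lambda>e. \<forall>n. \<bar>a e n\<bar> \<le> C * exp (- \<rho>1 * real n)) F"
    and lim: "\<And>n. ((\<lambda>e. a e n) \<longlongrightarrow> a0 n) F" and s: "(\<sigma> \<longlongrightarrow> \<sigma>0) F" "\<sigma>0 < \<rho>1"
  shows "((\<lambda>e. exp_moment r (\<sigma> e) (a e)) \<longlongrightarrow> exp_moment r \<sigma>0 a0) F"
  unfolding exp_moment_def
proof (rule tannery)
  define \<sigma>1 where "\<sigma>1 = (\<sigma>0 + \<rho>1) / 2"
  have s1: "\<sigma>0 < \<sigma>1" "\<sigma>1 < \<rho>1" using s(2) by (simp_all add: \<sigma>1_def)
  show "((\<lambda>e. moment_seq r (tilt (\<sigma> e) (a e)) n) \<longlongrightarrow> moment_seq r (tilt \<sigma>0 a0) n) F" for n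
    unfolding moment_seq_def tilt_def by (intro tendsto_intros s lim)
  have "eventually (\<lambda>e. \<sigma> e \<le> \<sigma>1) F"
    using order_tendstoD(2)[OF s(1) s1(1)] by eventually_elim simp
  thus "eventually (\<lambda>e. \<forall>n. \<bar>moment_seq r (tilt (\<sigma> e) (a e)) n\<bar> \<le> C * (real n ^ r * exp (- (\<rho>1 - \<sigma>1) * real n))) F"
    using bd by eventually_elim (blast intro: moment_tilt_bound)
  show "summable (\<lambda>n. C * (real n ^ r * exp (- (\<rho>1 - \<sigma>1) * real n)))"
    using s1 by (intro summable_mult summable_poly_exp) simp
qed

text \<open>
  The Taylor formula at \<open>\<sigma>\<close> with a remainder constant that depends on the sequence only through its
  exponential bound, so it can be used for all small \<open>\<epsilon>\<close> at once.
\<close>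

lemma exp_moment_taylor:
  assumes a: "\<And>n. \<bar>a n\<bar> \<le> C * exp (- \<rho>1 * real n)" and x: "\<bar>x\<bar> \<le> \<delta>" and d: "\<sigma> + \<delta> < \<rho>1"
  shows "\<bar>exp_moment 0 (\<sigma> + x) a - (\<Sum>r\<le>k. exp_moment r \<sigma> a * (x ^ r / fact r))\<bar>
    \<le> C / fact k * (\<Sum>n. real n ^ Suc k * exp (- (\<rho>1 - (\<sigma> + \<delta>)) * real n)) * \<bar>x\<bar> ^ Suc k"
proof -
  let ?B = "\<lambda>n. C / fact k * (real n ^ Suc k * exp (- (\<rho>1 - (\<sigma> + \<delta>)) * real n)) * \<bar>x\<bar> ^ Suc k"
  let ?R = "\<lambda>n. moment_seq 0 (tilt (\<sigma> + x) a) n - (\<Sum>r\<le>k. moment_seq r (tilt \<sigma> a) n * (x ^ r / fact r))"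
  have sR: "?R sums (exp_moment 0 (\<sigma> + x) a - (\<Sum>r\<le>k. exp_moment r \<sigma> a * (x ^ r / fact r)))"
    by (intro sums_diff sums_sum sums_mult2 exp_moment_sums[OF a]) (use x d in auto)
  have sB: "summable ?B"
    by (intro summable_mult summable_mult2 summable_poly_exp) (use d in simp)
  have le: "\<bar>?R n\<bar> \<le> ?B n" for n
  proof -
    have "?R n = tilt \<sigma> a n * (exp (x * real n) - (\<Sum>r\<le>k. (x * real n) ^ r / fact r))"
      unfolding moment_seq_def tilt_def
      by (simp add: ring_distribs exp_add sum_distrib_left power_mult_distrib mult_ac)
    hence "\<bar>?R n\<bar> = \<bar>tilt \<sigma> a n\<bar> * \<bar>exp (x * real n) - (\<Sum>r\<le>k. (x * real n) ^ r / fact r)\<bar>"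
      by (simp add: abs_mult)
    also have "\<dots> \<le> \<bar>tilt \<sigma> a n\<bar> * (exp (\<delta> * real n) * (\<bar>x\<bar> * real n) ^ Suc k / fact k)"
    proof (rule mult_left_mono)
      have "norm (exp (x * real n) - (\<Sum>r\<le>k. (x * real n) ^ r / fact r))
          \<le> exp (norm (x * real n)) * (norm (x * real n) ^ Suc k) / fact k" by (rule Taylor_exp_field)
      also have "\<dots> \<le> exp (\<delta> * real n) * (\<bar>x\<bar> * real n) ^ Suc k / fact k"
        using x by (intro divide_right_mono mult_mono) (auto simp: abs_mult mult_right_mono)
      finally show "\<bar>exp (x * real n) - (\<Sum>r\<le>k. (x * real n) ^ r / fact r)\<bar>
        \<le> exp (\<delta> * real n) * (\<bar>x\<bar> * real n) ^ Suc k / fact k" by simp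
    qed simp
    also have "\<dots> = \<bar>moment_seq (Suc k) (tilt (\<sigma> + \<delta>) a) n\<bar> * (\<bar>x\<bar> ^ Suc k / fact k)"
      unfolding moment_seq_def tilt_def
      by (simp add: abs_mult ring_distribs exp_add power_mult_distrib mult_ac)
    also have "\<dots> \<le> C * (real n ^ Suc k * exp (- (\<rho>1 - (\<sigma> + \<delta>)) * real n)) * (\<bar>x\<bar> ^ Suc k / fact k)"
      by (intro mult_right_mono moment_tilt_bound a) auto
    finally show ?thesis by (simp add: mult_ac)
  qed
  have "\<bar>exp_moment 0 (\<sigma> + x) a - (\<Sum>r\<le>k. exp_moment r \<sigma> a * (x ^ r / fact r))\<bar> = norm (\<Sum>n. ?R n)"
    using sums_unique[OF sR] by simp
  also have "\<dots> \<le> (\<Sum>n. ?B n)" by (rule norm_suminf_le[OF _ sB]) (use le in simp)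
  also have "\<dots> = C / fact k * (\<Sum>n. real n ^ Suc k * exp (- (\<rho>1 - (\<sigma> + \<delta>)) * real n)) * \<bar>x\<bar> ^ Suc k"
    using summable_poly_exp[of "\<rho>1 - (\<sigma> + \<delta>)" "Suc k"] d
    by (simp only: suminf_mult2[symmetric] suminf_mult summable_mult)
  finally show ?thesis .
qed

text \<open>
  A quantitative form of strict monotonicity: a single positive term already bounds the slope below.
\<close>

lemma exp_moment_increase:
  assumes a: "\<And>n. \<bar>a n\<bar> \<le> C * exp (- \<rho>1 * real n)" and nn: "\<And>n. a n \<ge> 0" and xy: "y \<le> x" "x < \<rho>1"
  shows "(x - y) * (real n * exp (y * real n) * a n) \<le> exp_moment 0 x a - exp_moment 0 y a"
proof -
  have s: "(\<lambda>n. tilt x a n - tilt y a n) sums (exp_moment 0 x a - exp_moment 0 y a)"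
    using sums_diff[OF exp_moment_sums[OF a, of x 0] exp_moment_sums[OF a, of y 0]] xy by simp
  have ineq: "(x - y) * (real n * exp (y * real n) * a n) \<le> tilt x a n - tilt y a n" for n
  proof -
    have "1 + (x - y) * real n \<le> exp ((x - y) * real n)" by (rule exp_ge_add_one_self)
    hence "exp (y * real n) * ((x - y) * real n) \<le> exp (y * real n) * (exp ((x - y) * real n) - 1)"
      by (intro mult_left_mono) (linarith, simp)
    also have "\<dots> = exp (x * real n) - exp (y * real n)"
      by (simp add: right_diff_distrib algebra_simps flip: exp_add)
    finally have "exp (y * real n) * ((x - y) * real n) * a n \<le> (exp (x * real n) - exp (y * real n)) * a n"
      using nn by (intro mult_right_mono)
    thus ?thesis by (simp add: tilt_def algebra_simps)
  qed
  have nn': "0 \<le> tilt x a n - tilt y a n" for n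
    using xy nn by (simp add: tilt_def mult_right_mono)
  have "(\<Sum>n\<in>{n}. tilt x a n - tilt y a n) \<le> (\<Sum>n. tilt x a n - tilt y a n)"
    by (rule sum_le_suminf[OF sums_summable[OF s]]) (use nn' in auto)
  thus ?thesis using ineq[of n] sums_unique[OF s] by simp
qed

lemma suminf_ennreal_eq_1_iff:
  fixes a :: "nat \<Rightarrow> real" assumes "\<And>n. a n \<ge> 0"
  shows "(\<Sum>n. ennreal (a n)) = 1 \<longleftrightarrow> a sums 1"
proof
  assume "(\<Sum>n. ennreal (a n)) = 1"
  hence "(\<lambda>n. ennreal (a n)) sums ennreal 1" using summable_sums[OF summableI, of "\<lambda>n. ennreal (a n)"] by simp
  thus "a sums 1" using assms by (subst (asm) sums_ennreal) auto
next
  assume "a sums 1"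
  hence "(\<lambda>n. ennreal (a n)) sums ennreal 1" using assms by (subst sums_ennreal) auto
  thus "(\<Sum>n. ennreal (a n)) = 1" by (simp add: sums_iff)
qed

lemma enn2real_suminf:
  fixes a :: "nat \<Rightarrow> real" assumes "\<And>n. a n \<ge> 0" and "a sums s"
  shows "enn2real (\<Sum>n. ennreal (a n)) = s"
proof -
  have "s \<ge> 0" using sums_le[OF _ sums_zero assms(2)] assms(1) by blast
  hence "(\<lambda>n. ennreal (a n)) sums ennreal s" using assms by (subst sums_ennreal) auto
  thus ?thesis using \<open>s \<ge> 0\<close> by (simp add: sums_iff)
qed

lemma phi_eq_1_iff: "phi S \<epsilon> i j \<rho> 0 = 1 \<longleftrightarrow> tilt \<rho> (g_time S \<epsilon> i j) sums 1"
proof -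
  have "(\<lambda>n. ennreal (real n ^ 0 * exp (\<rho> * real n) * g_time S \<epsilon> i j n)) = (\<lambda>n. ennreal (tilt \<rho> (g_time S \<epsilon> i j) n))"
    by (simp add: tilt_def fun_eq_iff)
  moreover have "tilt \<rho> (g_time S \<epsilon> i j) n \<ge> 0" for n by (simp add: g_time_nonneg)
  ultimately show ?thesis unfolding phi_def by (metis suminf_ennreal_eq_1_iff)
qed

lemma enn2real_phi:
  assumes "moment_seq r (tilt \<rho> (g_time S \<epsilon> i j)) sums s"
  shows "enn2real (phi S \<epsilon> i j \<rho> r) = s"
proof -
  have "(\<lambda>n. ennreal (real n ^ r * exp (\<rho> * real n) * g_time S \<epsilon> i j n)) =
      (\<lambda>n. ennreal (moment_seq r (tilt \<rho> (g_time S \<epsilon> i j)) n))"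
    by (simp add: moment_seq_def tilt_def fun_eq_iff mult.assoc)
  moreover have "moment_seq r (tilt \<rho> (g_time S \<epsilon> i j)) n \<ge> 0" for n
    by (simp add: moment_seq_def g_time_nonneg)
  ultimately show ?thesis unfolding phi_def using enn2real_suminf[OF _ assms] by metis
qed

lemma enn2real_p_gen:
  assumes "moment_seq r (tilt \<rho> (\<lambda>n. pmf (kern S \<epsilon> i) (j, n))) sums s"
  shows "enn2real (p_gen S \<epsilon> i j \<rho> r) = s"
proof -
  have "(\<lambda>n. ennreal (real n ^ r * exp (\<rho> * real n) * pmf (kern S \<epsilon> i) (j, n))) =
      (\<lambda>n. ennreal (moment_seq r (tilt \<rho> (\<lambda>n. pmf (kern S \<epsilon> i) (j, n))) n))"
    by (simp add: moment_seq_def tilt_def fun_eq_iff mult.assoc)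
  moreover have "moment_seq r (tilt \<rho> (\<lambda>n. pmf (kern S \<epsilon> i) (j, n))) n \<ge> 0" for n
    by (simp add: moment_seq_def)
  ultimately show ?thesis unfolding p_gen_def using enn2real_suminf[OF _ assms] by metis
qed

section \<open>Uniform bounds under perturbation\<close>

text \<open>
  The value at zero is included, in contrast to \<open>at_right 0\<close>, so that whatever holds eventually also holds
  for the unperturbed process.
\<close>

definition small_eps :: "real filter" where
  "small_eps = inf (nhds 0) (principal {0..})"

lemma eventually_small_eps: "eventually P small_eps \<longleftrightarrow> eventually P (at_right 0) \<and> P 0"
proof -
  have "eventually P small_eps \<longleftrightarrow> eventually (\<lambda>x. x \<ge> 0 \<longrightarrow> P x) (nhds 0)"
    unfolding small_eps_def eventually_inf_principal by simp
  also have "\<dots> \<longleftrightarrow> eventually (\<lambda>x. x \<noteq> 0 \<longrightarrow> x > 0 \<longrightarrow> P x) (nhds 0) \<and> P 0"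
  proof
    assume ev: "eventually (\<lambda>x. x \<ge> 0 \<longrightarrow> P x) (nhds 0)"
    have "eventually (\<lambda>x. x \<noteq> 0 \<longrightarrow> x > 0 \<longrightarrow> P x) (nhds 0)" using ev by eventually_elim simp
    thus "eventually (\<lambda>x. x \<noteq> 0 \<longrightarrow> x > 0 \<longrightarrow> P x) (nhds 0) \<and> P 0"
      using eventually_nhds_x_imp_x[OF ev] by simp
  next
    assume a: "eventually (\<lambda>x. x \<noteq> 0 \<longrightarrow> x > 0 \<longrightarrow> P x) (nhds 0) \<and> P 0"
    from a[THEN conjunct1] show "eventually (\<lambda>x. x \<ge> 0 \<longrightarrow> P x) (nhds 0)"
      by eventually_elim (metis a le_less)
  qed
  finally show ?thesis by (simp add: eventually_at_filter)
qed

lemma at_right_le_small_eps: "at_right 0 \<le> small_eps"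
  by (rule filter_leI) (simp add: eventually_small_eps)

lemma small_eps_neq_bot: "small_eps \<noteq> bot"
  using at_right_le_small_eps trivial_limit_at_right_real[of 0] by (metis bot.extremum_uniqueI)

lemma small_eps_nonneg: "eventually (\<lambda>\<epsilon>. \<epsilon> \<ge> 0) small_eps"
  unfolding eventually_small_eps by (auto simp: eventually_at_filter)

lemma tendsto_small_eps: "(f \<longlongrightarrow> f 0) (at_right 0) \<Longrightarrow> (f \<longlongrightarrow> f 0) small_eps"
  unfolding tendsto_def eventually_small_eps by blast

text \<open>
  Associativity of the product of formal power series.
\<close>

lemma convolution_assoc:
  fixes a b c :: "nat \<Rightarrow> real"
  shows "(\<Sum>m\<le>n. (\<Sum>k\<le>m. a k * b (m - k)) * c (n - m)) = (\<Sum>k\<le>n. a k * (\<Sum>m\<le>n - k. b m * c (n - k - m)))"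
proof -
  have "fps_nth ((Abs_fps a * Abs_fps b) * Abs_fps c) n = fps_nth (Abs_fps a * (Abs_fps b * Abs_fps c)) n"
    by (simp only: mult.assoc)
  thus ?thesis by (simp add: fps_mult_nth atLeast0AtMost)
qed

lemma markov_convolution_vanish_0:
  assumes "\<And>l. q s l 0 = 0"
  shows "markov_convolution J q f s n = (\<Sum>l\<in>J. \<Sum>m=1..n. q s l m * f l (n - m))"
proof -
  have "(\<Sum>m\<le>n. q s l m * f l (n - m)) = (\<Sum>m=1..n. q s l m * f l (n - m))" for l
    by (rule sum.mono_neutral_right) (auto simp: assms not_less_eq_eq)
  thus ?thesis unfolding markov_convolution_def by simp
qed

text \<open>
  The solution at time \<open>n\<close> depends on the kernel and on earlier values only, so pointwise limits pass
  through by induction on \<open>n\<close>.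
\<close>

lemma convolution_solution_tendsto:
  fixes f :: "'e \<Rightarrow> 'n::finite \<Rightarrow> nat \<Rightarrow> real"
  assumes eq: "eventually (\<lambda>e. \<forall>s n. f e s n = y e s n + markov_convolution J (q e) (f e) s n) F"
    and q0: "eventually (\<lambda>e. \<forall>s l. q e s l 0 = 0) F"
    and eq': "\<And>s n. f' s n = y' s n + markov_convolution J q' f' s n" and q0': "\<And>s l. q' s l 0 = 0"
    and q: "\<And>s l n. ((\<lambda>e. q e s l n) \<longlongrightarrow> q' s l n) F" and y: "\<And>s n. ((\<lambda>e. y e s n) \<longlongrightarrow> y' s n) F"
  shows "((\<lambda>e. f e s n) \<longlongrightarrow> f' s n) F"
proof (induction n arbitrary: s rule: less_induct)
  case (less n)
  have lim: "((\<lambda>e. y e s n + (\<Sum>l\<in>J. \<Sum>m=1..n. q e s l m * f e l (n - m))) \<longlongrightarrow>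
      y' s n + (\<Sum>l\<in>J. \<Sum>m=1..n. q' s l m * f' l (n - m))) F"
    by (intro tendsto_add y tendsto_sum tendsto_mult q less.IH) auto
  have val: "y' s n + (\<Sum>l\<in>J. \<Sum>m=1..n. q' s l m * f' l (n - m)) = f' s n"
    by (subst eq') (simp add: markov_convolution_vanish_0[where q = q', OF q0'])
  have ev: "eventually (\<lambda>e. y e s n + (\<Sum>l\<in>J. \<Sum>m=1..n. q e s l m * f e l (n - m)) = f e s n) F"
    using eq q0
  proof eventually_elim
    case (elim e)
    have "f e s n = y e s n + markov_convolution J (q e) (f e) s n" using elim(1) by blast
    thus ?case using elim(2) by (simp add: markov_convolution_vanish_0)
  qed
  show ?case by (rule Lim_transform_eventually[OF lim[unfolded val] ev])
qed

text \<open>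
  Decomposition at the first visit to \<open>i\<close>. Rather than arguing with a stopping time, one checks that the
  right-hand side satisfies the first-step equation of \<open>X\<close>, which determines its solution.
\<close>

lemma (in first_passage) renewal_decomposition:
  assumes X: "\<And>s n. X s n = y s n + markov_convolution UNIV q X s n"
    and H: "\<And>s n. H s n = y s n + markov_convolution (-{i}) q H s n"
  shows "X s n = H s n + (\<Sum>m\<le>n. g s i m * X i (n - m))"
proof (induction n arbitrary: s rule: less_induct)
  case (less n)
  define D where "D s n = H s n + (\<Sum>m\<le>n. g s i m * X i (n - m))" for s n
  have gX: "(\<Sum>m\<le>n. g s i m * X i (n - m)) =
      (\<Sum>m\<le>n. q s i m * X i (n - m)) + (\<Sum>l\<in>-{i}. \<Sum>k\<le>n. q s l k * (\<Sum>m\<le>n - k. g l i m * X i (n - k - m)))"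
  proof -
    have "(\<Sum>m\<le>n. g s i m * X i (n - m)) = (\<Sum>m\<le>n. (q s i m + markov_convolution (-{i}) q (\<lambda>l. g l i) s m) * X i (n - m))"
      by (simp only: g_eq[of s i, symmetric])
    also have "\<dots> = (\<Sum>m\<le>n. q s i m * X i (n - m)) + (\<Sum>l\<in>-{i}. \<Sum>m\<le>n. (\<Sum>k\<le>m. q s l k * g l i (m - k)) * X i (n - m))"
      by (simp add: distrib_right sum.distrib markov_convolution_def sum_distrib_right sum.swap[of _ "{..n}" "-{i}"])
    finally show ?thesis by (simp only: convolution_assoc)
  qed
  have "D s n = y s n + (\<Sum>m\<le>n. q s i m * X i (n - m)) + (\<Sum>l\<in>-{i}. \<Sum>k\<le>n. q s l k * D l (n - k))"
    unfolding D_def gX by (subst H) (simp add: markov_convolution_def distrib_left sum.distrib)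
  also have "(\<Sum>l\<in>-{i}. \<Sum>k\<le>n. q s l k * D l (n - k)) = (\<Sum>l\<in>-{i}. \<Sum>k\<le>n. q s l k * X l (n - k))"
  proof (intro sum.cong refl)
    fix l k assume "k \<in> {..n}"
    show "q s l k * D l (n - k) = q s l k * X l (n - k)"
    proof (cases "k = 0")
      case False
      thus ?thesis using less.IH[of "n - k" l] \<open>k \<in> {..n}\<close> by (simp add: D_def)
    qed (simp add: q_0)
  qed
  also have "y s n + (\<Sum>m\<le>n. q s i m * X i (n - m)) + \<dots> = y s n + markov_convolution UNIV q X s n"
    unfolding markov_convolution_def by (subst (2) sum.remove[of _ i]) (auto simp: Compl_eq_Diff_UNIV)
  also have "\<dots> = X s n" by (rule X[symmetric])
  finally show ?case by (simp add: D_def)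
qed

lemma (in first_passage) first_passage_tilt:
  "first_passage (\<lambda>s l. tilt \<rho> (q s l)) (\<lambda>s i. tilt \<rho> (g s i))"
proof
  show "tilt \<rho> (g s i) n = tilt \<rho> (q s i) n + markov_convolution (- {i}) (\<lambda>s l. tilt \<rho> (q s l)) (\<lambda>l. tilt \<rho> (g l i)) s n" for s i n
    by (rule tilt_convolution[where f = "\<lambda>s. g s i" and y = "\<lambda>s. q s i"]) (rule g_eq)
qed (simp_all add: q_nonneg g_nonneg q_0)

abbreviation fpass :: "('n, 'a) smp_family \<Rightarrow> real \<Rightarrow> 'n \<Rightarrow> 'n \<Rightarrow> nat \<Rightarrow> real" where
  "fpass S \<epsilon> s i \<equiv> g_time S \<epsilon> (Some s) (Some i)"

text \<open>
  The standing conditions with the constants of the moment condition made explicit. The bound is put on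
  the kernel itself, since the transition probabilities are at most one.
\<close>

locale perturbed_smp =
  fixes S :: "('n::finite, 'a) smp_family" and \<beta> M :: real
  assumes S: "semi_markov_family S" and A: "cond_A S" and B: "cond_B S"
    and \<beta>: "\<beta> > 0"
    and kernel_bound: "eventually (\<lambda>\<epsilon>. \<forall>s j K. (\<Sum>n\<le>K. exp (\<beta> * real n) * pmf (kern S \<epsilon> (Some s)) (j, n)) \<le> M) small_eps"
    and exceeds: "\<exists>i \<beta>'. \<beta>' \<le> \<beta> \<and> phi S 0 (Some i) (Some i) \<beta>' 0 > 1"

lemma trans_prob_bounds: "0 \<le> trans_prob S \<epsilon> i j" "trans_prob S \<epsilon> i j \<le> 1"
proof -
  have "(\<Sum>k\<le>K. pmf (kern S \<epsilon> i) (j, k)) \<le> 1" for K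
  proof -
    have "(\<Sum>k\<le>K. pmf (kern S \<epsilon> i) (j, k)) = (\<Sum>y\<in>Pair j ` {..K}. pmf (kern S \<epsilon> i) y)"
      by (subst sum.reindex) (auto simp: inj_on_def)
    also have "\<dots> = measure_pmf.prob (kern S \<epsilon> i) (Pair j ` {..K})"
      by (rule measure_measure_pmf_finite[symmetric]) simp
    finally show ?thesis by simp
  qed
  note s = summable_of_partial_bound[of "\<lambda>k. pmf (kern S \<epsilon> i) (j, k)", OF pmf_nonneg this]
  show "trans_prob S \<epsilon> i j \<le> 1" "0 \<le> trans_prob S \<epsilon> i j"
    unfolding trans_prob_def by (rule s(2), rule suminf_nonneg[OF s(1)]) simp
qed

lemma ennreal_partial_sum_le:
  fixes a :: "nat \<Rightarrow> real"
  assumes "\<And>n. a n \<ge> 0" and "(\<Sum>n. ennreal (a n)) \<le> ennreal M" and "M \<ge> 0"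
  shows "(\<Sum>n\<le>K. a n) \<le> M"
proof -
  have "ennreal (\<Sum>n\<le>K. a n) = (\<Sum>n\<le>K. ennreal (a n))" by (rule sum_ennreal[symmetric]) (rule assms)
  also have "\<dots> \<le> (\<Sum>n. ennreal (a n))" by (rule sum_le_suminf) auto
  also have "\<dots> \<le> ennreal M" by (rule assms)
  finally show ?thesis using assms(3) by (simp add: ennreal_le_iff)
qed

lemma perturbed_smp_exists:
  fixes S :: "('n::finite, 'a) smp_family"
  assumes S: "semi_markov_family S" and "cond_A S" "cond_B S" and C: "cond_C S"
  obtains \<beta> M where "perturbed_smp S \<beta> M"
proof -
  obtain \<beta> where \<beta>: "\<beta> > 0" and lim: "\<And>i j. Limsup small_eps (\<lambda>\<epsilon>. psi S \<epsilon> (Some i) j \<beta>) < \<infinity>"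
    and ex: "\<exists>i \<beta>'. \<beta>' \<le> \<beta> \<and> phi S 0 (Some i) (Some i) \<beta>' 0 > 1"
    using C unfolding cond_C_def small_eps_def by blast
  have "\<exists>m\<ge>0. eventually (\<lambda>\<epsilon>. psi S \<epsilon> (Some i) j \<beta> \<le> ennreal m) small_eps" for i j
  proof -
    obtain c where c: "Limsup small_eps (\<lambda>\<epsilon>. psi S \<epsilon> (Some i) j \<beta>) < c" "c < \<infinity>"
      using dense[OF lim] by blast
    then obtain m where m: "c = ennreal m" "m \<ge> 0" by (cases c) auto
    have "eventually (\<lambda>\<epsilon>. psi S \<epsilon> (Some i) j \<beta> < c) small_eps" by (rule Limsup_lessD[OF c(1)])
    hence "eventually (\<lambda>\<epsilon>. psi S \<epsilon> (Some i) j \<beta> \<le> ennreal m) small_eps"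
      unfolding m by eventually_elim simp
    thus ?thesis using m(2) by blast
  qed
  then obtain m where m: "\<And>i j. m i j \<ge> 0" "\<And>i j. eventually (\<lambda>\<epsilon>. psi S \<epsilon> (Some i) j \<beta> \<le> ennreal (m i j)) small_eps"
    by metis
  define M where "M = Max (range (\<lambda>(i, j). m i j))"
  have mM: "m i j \<le> M" for i j
  proof -
    have "(case (i, j) of (i, j) \<Rightarrow> m i j) \<le> M" unfolding M_def by (intro Max_ge) auto
    thus ?thesis by simp
  qed
  have "eventually (\<lambda>\<epsilon>. \<forall>i. \<forall>j. psi S \<epsilon> (Some i) j \<beta> \<le> ennreal (m i j)) small_eps"
    by (intro eventually_all_finite m)
  hence "eventually (\<lambda>\<epsilon>. \<forall>s j K. (\<Sum>n\<le>K. exp (\<beta> * real n) * pmf (kern S \<epsilon> (Some s)) (j, n)) \<le> M) small_eps"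
    using small_eps_nonneg
  proof eventually_elim
    case (elim \<epsilon>)
    show ?case
    proof (intro allI)
      fix s j K
      have k: "pmf (kern S \<epsilon> (Some s)) (j, n) \<le> pmf (dist_time S \<epsilon> (Some s) j) n" for n
      proof -
        have "pmf (kern S \<epsilon> (Some s)) (j, n) = trans_prob S \<epsilon> (Some s) j * pmf (dist_time S \<epsilon> (Some s) j) n"
          using S elim(2) unfolding semi_markov_family_def by blast
        also have "\<dots> \<le> 1 * pmf (dist_time S \<epsilon> (Some s) j) n"
          by (intro mult_right_mono trans_prob_bounds) simp
        finally show ?thesis by simp
      qed
      have "(\<Sum>n\<le>K. exp (\<beta> * real n) * pmf (kern S \<epsilon> (Some s)) (j, n))
        \<le> (\<Sum>n\<le>K. exp (\<beta> * real n) * pmf (dist_time S \<epsilon> (Some s) j) n)"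
        by (intro sum_mono mult_left_mono k) simp
      also have "\<dots> \<le> m s j"
        by (rule ennreal_partial_sum_le) (use elim(1) m(1) in \<open>auto simp: psi_def\<close>)
      also have "\<dots> \<le> M" by (rule mM)
      finally show "(\<Sum>n\<le>K. exp (\<beta> * real n) * pmf (kern S \<epsilon> (Some s)) (j, n)) \<le> M" .
    qed
  qed
  thus thesis using that[of \<beta> M] assms \<beta> ex by (simp add: perturbed_smp_def)
qed

context perturbed_smp
begin

abbreviation "kernel_decay \<epsilon> \<equiv> \<forall>s l n. \<bar>kmass S \<epsilon> s l n\<bar> \<le> M * exp (- \<beta> * real n)"

abbreviation "passage_decay C \<rho>1 i \<epsilon> \<equiv> \<forall>s n. \<bar>fpass S \<epsilon> s i n\<bar> \<le> C * exp (- \<rho>1 * real n)"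

abbreviation "sojourn_decay C \<rho>1 i \<epsilon> \<equiv> \<forall>s j n. \<bar>occupation S \<epsilon> {i} s j n\<bar> \<le> C * exp (- \<rho>1 * real n)"

text \<open>
  A strict supersolution \<open>w\<close>: the taboo matrix \<open>\<^sub>iP\<^sup>(\<^sup>\<epsilon>\<^sup>)(\<rho>1)\<close> is a contraction in the norm weighted by
  \<open>w\<close>. This replaces every statement about its spectral radius.
\<close>

abbreviation "contracting i \<rho>1 w \<theta> \<epsilon> \<equiv>
  \<forall>s. (\<Sum>l\<in>-{i}. exp_moment 0 \<rho>1 (kmass S \<epsilon> s l) * w l) \<le> \<theta> * w s"

lemma kernel_tendsto: "((\<lambda>\<epsilon>. pmf (kern S \<epsilon> (Some s)) (j, n)) \<longlongrightarrow> pmf (kern S 0 (Some s)) (j, n)) small_eps"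
proof -
  have eq: "pmf (kern S \<epsilon> (Some s)) (j, n) = trans_prob S \<epsilon> (Some s) j * pmf (dist_time S \<epsilon> (Some s) j) n"
    and z: "pmf (kern S \<epsilon> (Some s)) (j, 0) = 0" if "\<epsilon> \<ge> 0" for \<epsilon>
    using S that unfolding semi_markov_family_def by blast+
  show ?thesis
  proof (cases "n \<ge> 1")
    case True
    have "((\<lambda>\<epsilon>. trans_prob S \<epsilon> (Some s) j * pmf (dist_time S \<epsilon> (Some s) j) n) \<longlongrightarrow>
        trans_prob S 0 (Some s) j * pmf (dist_time S 0 (Some s) j) n) small_eps"
      by (intro tendsto_mult; rule tendsto_small_eps) (use A True in \<open>auto simp: cond_A_def\<close>)
    moreover have "eventually (\<lambda>\<epsilon>. trans_prob S \<epsilon> (Some s) j * pmf (dist_time S \<epsilon> (Some s) j) n =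
        pmf (kern S \<epsilon> (Some s)) (j, n)) small_eps"
      using small_eps_nonneg by eventually_elim (simp add: eq)
    ultimately show ?thesis using eq[of 0] by (simp add: Lim_transform_eventually)
  next
    case False
    hence "n = 0" by simp
    show ?thesis
      by (rule tendsto_eventually) (use small_eps_nonneg in eventually_elim, simp add: z \<open>n = 0\<close>)
  qed
qed

lemma kernel_term_bound:
  "eventually (\<lambda>\<epsilon>. kernel_decay \<epsilon>) small_eps"
  using kernel_bound
proof eventually_elim
  case (elim \<epsilon>)
  show ?case
  proof (intro allI)
    fix s l n
    have "exp (\<beta> * real n) * kmass S \<epsilon> s l n \<le> (\<Sum>n\<le>n. exp (\<beta> * real n) * kmass S \<epsilon> s l n)"
      by (rule member_le_sum) auto
    also have "\<dots> \<le> M" using elim by blast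
    finally show "\<bar>kmass S \<epsilon> s l n\<bar> \<le> M * exp (- \<beta> * real n)"
      by (simp add: exp_minus field_simps)
  qed
qed

lemma M_nonneg: "M \<ge> 0"
proof -
  have "eventually (\<lambda>\<epsilon>. M \<ge> 0) small_eps" using kernel_bound
  proof eventually_elim
    case (elim \<epsilon>)
    have "0 \<le> (\<Sum>n\<le>0. exp (\<beta> * real n) * pmf (kern S \<epsilon> (Some undefined)) (None, n))" by simp
    also have "\<dots> \<le> M" using elim by blast
    finally show ?case .
  qed
  thus ?thesis using small_eps_neq_bot by simp
qed

lemma survival_tendsto: "((\<lambda>\<epsilon>. survival S \<epsilon> s n) \<longlongrightarrow> survival S 0 s n) small_eps"
  unfolding survival_eq by (intro tendsto_diff tendsto_const tendsto_sum kernel_tendsto)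

lemma first_passage_axioms: "\<epsilon> \<ge> 0 \<Longrightarrow> first_passage (\<lambda>s l. kmass S \<epsilon> s l) (\<lambda>s i. fpass S \<epsilon> s i)"
proof
  show "\<epsilon> \<ge> 0 \<Longrightarrow> fpass S \<epsilon> s i n = kmass S \<epsilon> s i n + markov_convolution (- {i}) (kmass S \<epsilon>) (\<lambda>l. fpass S \<epsilon> l i) s n" for s i n
    unfolding markov_convolution_def by (rule g_time_first_step[OF S])
qed (simp_all add: g_time_nonneg kern_0[OF S])

lemma occupation_eq:
  "\<epsilon> \<ge> 0 \<Longrightarrow> occupation S \<epsilon> B s j n = (if s = j then survival S \<epsilon> s n else 0) +
     markov_convolution (-B) (kmass S \<epsilon>) (\<lambda>l. occupation S \<epsilon> B l j) s n"
  unfolding markov_convolution_def by (rule occupation_first_step[OF S])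

lemma fpass_tendsto: "((\<lambda>\<epsilon>. fpass S \<epsilon> s i n) \<longlongrightarrow> fpass S 0 s i n) small_eps"
proof (rule convolution_solution_tendsto[where f = "\<lambda>\<epsilon> s. fpass S \<epsilon> s i" and f' = "\<lambda>s. fpass S 0 s i"
      and y = "\<lambda>\<epsilon> s. kmass S \<epsilon> s i" and y' = "\<lambda>s. kmass S 0 s i" and q = "\<lambda>\<epsilon>. kmass S \<epsilon>" and q' = "kmass S 0" and J = "-{i}"])
  show "eventually (\<lambda>\<epsilon>. \<forall>s n. fpass S \<epsilon> s i n = kmass S \<epsilon> s i n + markov_convolution (- {i}) (kmass S \<epsilon>) (\<lambda>s. fpass S \<epsilon> s i) s n) small_eps"
    using small_eps_nonneg by eventually_elim (use first_passage.g_eq[OF first_passage_axioms] in blast)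
  show "eventually (\<lambda>\<epsilon>. \<forall>s l. kmass S \<epsilon> s l 0 = 0) small_eps"
    using small_eps_nonneg by eventually_elim (simp add: kern_0[OF S])
  show "fpass S 0 s i n = kmass S 0 s i n + markov_convolution (- {i}) (kmass S 0) (\<lambda>s. fpass S 0 s i) s n" for s n
    by (rule first_passage.g_eq[OF first_passage_axioms]) simp
qed (simp_all add: kern_0[OF S] kernel_tendsto)

lemma occupation_tendsto: "((\<lambda>\<epsilon>. occupation S \<epsilon> B s j n) \<longlongrightarrow> occupation S 0 B s j n) small_eps"
proof (rule convolution_solution_tendsto[where f = "\<lambda>\<epsilon> s. occupation S \<epsilon> B s j" and f' = "\<lambda>s. occupation S 0 B s j"
      and y = "\<lambda>\<epsilon> s n. if s = j then survival S \<epsilon> s n else 0" and y' = "\<lambda>s n. if s = j then survival S 0 s n else 0"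
      and q = "\<lambda>\<epsilon>. kmass S \<epsilon>" and q' = "kmass S 0" and J = "-B"])
  show "eventually (\<lambda>\<epsilon>. \<forall>s n. occupation S \<epsilon> B s j n = (if s = j then survival S \<epsilon> s n else 0) +
      markov_convolution (-B) (kmass S \<epsilon>) (\<lambda>s. occupation S \<epsilon> B s j) s n) small_eps"
    using small_eps_nonneg by eventually_elim (use occupation_eq in blast)
  show "eventually (\<lambda>\<epsilon>. \<forall>s l. kmass S \<epsilon> s l 0 = 0) small_eps"
    using small_eps_nonneg by eventually_elim (simp add: kern_0[OF S])
  show "occupation S 0 B s j n = (if s = j then survival S 0 s n else 0) +
      markov_convolution (-B) (kmass S 0) (\<lambda>s. occupation S 0 B s j) s n" for s n
    by (rule occupation_eq) simp
  show "((\<lambda>\<epsilon>. if s = j then survival S \<epsilon> s n else 0) \<longlongrightarrow> (if s = j then survival S 0 s n else 0)) small_eps" for s n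
    by (simp add: survival_tendsto)
qed (simp_all add: kern_0[OF S] kernel_tendsto)

lemma irreducible_0: "\<exists>n. fpass S 0 s i n > 0"
proof (rule ccontr)
  assume "\<nexists>n. fpass S 0 s i n > 0"
  hence "fpass S 0 s i n = 0" for n using g_time_nonneg[of S 0 "Some s" "Some i" n]
    by (simp add: not_less order_antisym)
  hence "g_total S 0 (Some s) (Some i) = 0" using g_total_sums[OF S, of 0 "Some s" i] sums_unique2[OF _ sums_zero] by auto
  thus False using B unfolding cond_B_def by (metis less_irrefl)
qed

text \<open>
  For each pair of states one positive first-passage probability is enough, and it persists by continuity.
\<close>

lemma irreducible: "eventually (\<lambda>\<epsilon>. \<forall>s i. \<exists>n. fpass S \<epsilon> s i n > 0) small_eps"
proof (intro eventually_all_finite)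
  fix s i
  obtain n where "fpass S 0 s i n > 0" using irreducible_0 by blast
  from order_tendstoD(1)[OF fpass_tendsto this]
  show "eventually (\<lambda>\<epsilon>. \<exists>n. fpass S \<epsilon> s i n > 0) small_eps" by eventually_elim blast
qed

lemma transition_gf_sums:
  assumes "kernel_decay \<epsilon>" "\<rho> < \<beta>"
  shows "moment_seq r (tilt \<rho> (kmass S \<epsilon> s l)) sums exp_moment r \<rho> (kmass S \<epsilon> s l)"
  by (rule exp_moment_sums[of _ M \<beta>]) (use assms in auto)

text \<open>
  A strict supersolution at \<open>\<epsilon> = 0\<close> and \<open>\<rho>\<close> leaves room: the same \<open>w\<close> works for a slightly larger
  argument \<open>\<rho>1\<close> and then for all small \<open>\<epsilon>\<close>, by continuity of the finitely many matrix entries.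
\<close>

lemma uniform_supersolution:
  assumes rho: "\<rho> < \<beta>" and fin: "summable (tilt \<rho> (fpass S 0 i i))"
  obtains \<rho>1 w \<theta> where "\<rho> < \<rho>1" "\<rho>1 < \<beta>" "\<And>s. w s > 0" "0 \<le> \<theta>" "\<theta> < 1"
    "eventually (\<lambda>\<epsilon>. contracting i \<rho>1 w \<theta> \<epsilon>) small_eps"
proof -
  interpret fp: first_passage "\<lambda>s l. kmass S 0 s l" "\<lambda>s i. fpass S 0 s i" by (rule first_passage_axioms) simp
  interpret ft: first_passage "\<lambda>s l. tilt \<rho> (kmass S 0 s l)" "\<lambda>s i. tilt \<rho> (fpass S 0 s i)" by (rule fp.first_passage_tilt)
  have kb: "kernel_decay 0"
    using kernel_term_bound unfolding eventually_small_eps by blast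
  have irr: "\<exists>n. tilt \<rho> (fpass S 0 s i) n > 0" for s i using irreducible_0[of s i] by simp
  have P: "tilt \<rho> (kmass S 0 s l) sums exp_moment 0 \<rho> (kmass S 0 s l)" for s l
    using transition_gf_sums[OF kb rho, of 0] by simp
  have F: "tilt \<rho> (fpass S 0 s i) sums (\<Sum>n. tilt \<rho> (fpass S 0 s i) n)" for s
    by (rule summable_sums[OF ft.summable_first_passage[OF fin irr]])
  obtain w \<theta>0 where w: "\<And>s. w s > 0" and th: "0 \<le> \<theta>0" "\<theta>0 < 1"
    and sup: "\<And>s. (\<Sum>l\<in>-{i}. exp_moment 0 \<rho> (kmass S 0 s l) * w l) \<le> \<theta>0 * w s"
    by (rule strict_supersolution_exists[where g = "\<lambda>s. tilt \<rho> (fpass S 0 s i)" and y = "\<lambda>s. tilt \<rho> (kmass S 0 s i)",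
          OF ft.q_nonneg ft.q_0 ft.g_nonneg irr ft.g_eq P ft.q_nonneg P F]) blast
  \<comment> \<open>Any value strictly between \<open>\<theta>0\<close> and \<open>1\<close> makes room for continuity.\<close>
  define \<theta> where "\<theta> = (1 + \<theta>0) / 2"
  have th': "0 \<le> \<theta>" "\<theta> < 1" "\<theta>0 < \<theta>" using th by (simp_all add: \<theta>_def)
  have strict: "(\<Sum>l\<in>-{i}. exp_moment 0 \<rho> (kmass S 0 s l) * w l) < \<theta> * w s" for s
    using sup[of s] w[of s] th'(3) by (meson le_less_trans mult_strict_right_mono)
  have "eventually (\<lambda>\<rho>1. (\<forall>s. (\<Sum>l\<in>-{i}. exp_moment 0 \<rho>1 (kmass S 0 s l) * w l) < \<theta> * w s) \<and> \<rho>1 < \<beta> \<and> \<rho> < \<rho>1) (at_right \<rho>)"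
  proof (intro eventually_conj eventually_all_finite)
    fix s
    have "((\<lambda>\<rho>1. exp_moment 0 \<rho>1 (kmass S 0 s l)) \<longlongrightarrow> exp_moment 0 \<rho> (kmass S 0 s l)) (at_right \<rho>)" for l
      by (rule exp_moment_tendsto[of _ M \<beta>]) (use kb rho in auto)
    hence "((\<lambda>\<rho>1. \<Sum>l\<in>-{i}. exp_moment 0 \<rho>1 (kmass S 0 s l) * w l) \<longlongrightarrow>
        (\<Sum>l\<in>-{i}. exp_moment 0 \<rho> (kmass S 0 s l) * w l)) (at_right \<rho>)"
      by (intro tendsto_intros)
    from order_tendstoD(2)[OF this strict]
    show "eventually (\<lambda>\<rho>1. (\<Sum>l\<in>-{i}. exp_moment 0 \<rho>1 (kmass S 0 s l) * w l) < \<theta> * w s) (at_right \<rho>)" .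
    show "eventually (\<lambda>\<rho>1. \<rho>1 < \<beta>) (at_right \<rho>)" 
      using rho by (auto simp: eventually_at_right_field)
    show "eventually (\<lambda>\<rho>1. \<rho> < \<rho>1) (at_right \<rho>)" by (rule eventually_at_right_less)
  qed
  then obtain \<rho>1 where r1: "\<And>s. (\<Sum>l\<in>-{i}. exp_moment 0 \<rho>1 (kmass S 0 s l) * w l) < \<theta> * w s" "\<rho>1 < \<beta>" "\<rho> < \<rho>1"
    using eventually_happens[of _ "at_right \<rho>"] trivial_limit_at_right_real[of \<rho>] by blast
  have "eventually (\<lambda>\<epsilon>. contracting i \<rho>1 w \<theta> \<epsilon>) small_eps"
  proof (intro eventually_all_finite)
    fix s
    have kb': "eventually (\<lambda>\<epsilon>. \<forall>n. \<bar>kmass S \<epsilon> s l n\<bar> \<le> M * exp (- \<beta> * real n)) small_eps" for l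
      using kernel_term_bound by eventually_elim blast
    have "((\<lambda>\<epsilon>. exp_moment 0 \<rho>1 (kmass S \<epsilon> s l)) \<longlongrightarrow> exp_moment 0 \<rho>1 (kmass S 0 s l)) small_eps" for l
      by (rule exp_moment_tendsto[OF kb' kernel_tendsto tendsto_const r1(2)])
    hence "((\<lambda>\<epsilon>. \<Sum>l\<in>-{i}. exp_moment 0 \<rho>1 (kmass S \<epsilon> s l) * w l) \<longlongrightarrow>
        (\<Sum>l\<in>-{i}. exp_moment 0 \<rho>1 (kmass S 0 s l) * w l)) small_eps"
      by (intro tendsto_intros)
    from order_tendstoD(2)[OF this r1(1)]
    show "eventually (\<lambda>\<epsilon>. (\<Sum>l\<in>-{i}. exp_moment 0 \<rho>1 (kmass S \<epsilon> s l) * w l) \<le> \<theta> * w s) small_eps"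
      by eventually_elim simp
  qed
  thus thesis using that[of \<rho>1 w \<theta>] r1 w th' by blast
qed

text \<open>
  A large multiple of \<open>w\<close> is a supersolution of the inhomogeneous first-step equations, both for the
  first-passage times and for the occupation probabilities; a bound on a generating function at \<open>\<rho>1\<close> bounds
  each coefficient.
\<close>

lemma uniform_exponential_bound:
  assumes rho: "\<rho>1 < \<beta>" and w: "\<And>s. w s > 0" and th: "0 \<le> \<theta>" "\<theta> < 1"
    and sup: "eventually (\<lambda>\<epsilon>. contracting i \<rho>1 w \<theta> \<epsilon>) small_eps"
  obtains C where "C \<ge> 0"
    "eventually (\<lambda>\<epsilon>. passage_decay C \<rho>1 i \<epsilon>) small_eps"
    "eventually (\<lambda>\<epsilon>. sojourn_decay C \<rho>1 i \<epsilon>) small_eps"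
proof -
  define \<delta> where "\<delta> = \<beta> - \<rho>1"
  have d: "\<delta> > 0" using rho by (simp add: \<delta>_def)
  define MS where "MS = real CARD('n option) * M * (\<Sum>n. real n ^ 0 * exp (- \<delta> * real n))"
  define Y where "Y = max M MS"
  have Y0: "Y \<ge> 0" using M_nonneg by (simp add: Y_def)
  define wmin where "wmin = Min (range w)"
  have wmin: "wmin > 0" "wmin \<le> w s" for s unfolding wmin_def using w by (auto intro: Min_le)
  \<comment> \<open>The multiple for which the gain \<open>(1 - \<theta>) * c * w\<close> pays for the inhomogeneity \<open>Y\<close>.\<close>
  define c where "c = Y / ((1 - \<theta>) * wmin)"
  have c: "c \<ge> 0" "Y + c * (\<theta> * w s) \<le> c * w s" for s
  proof -
    show c0: "c \<ge> 0" using Y0 wmin(1) th by (simp add: c_def)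
    have "Y = c * ((1 - \<theta>) * wmin)" using wmin(1) th by (simp add: c_def)
    also have "\<dots> \<le> c * ((1 - \<theta>) * w s)" using c0 th wmin(2) by (intro mult_left_mono) auto
    finally show "Y + c * (\<theta> * w s) \<le> c * w s" by (simp add: algebra_simps)
  qed
  define C where "C = c * Max (range w)"
  have wmax: "c * w s \<le> C" for s unfolding C_def by (intro mult_left_mono c Max_ge) auto
  have C0: "C \<ge> 0" using wmax[of undefined] c w[of undefined] by (meson less_imp_le mult_nonneg_nonneg order_trans)
  have main: "\<bar>f s n\<bar> \<le> C * exp (- \<rho>1 * real n)"
    if e: "\<epsilon> \<ge> 0" and kb: "kernel_decay \<epsilon>"
      and sup: "contracting i \<rho>1 w \<theta> \<epsilon>"
      and f: "\<And>s n. f s n \<ge> 0" "\<And>s n. f s n = y s n + markov_convolution (-{i}) (kmass S \<epsilon>) f s n"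
      and y: "\<And>s K. (\<Sum>n\<le>K. tilt \<rho>1 (y s) n) \<le> Y"
    for \<epsilon> f y s n
  proof -
    have P: "tilt \<rho>1 (kmass S \<epsilon> s l) sums exp_moment 0 \<rho>1 (kmass S \<epsilon> s l)" for s l
      using transition_gf_sums[OF kb rho, of 0] by simp
    have Pp: "(\<Sum>n\<le>K. tilt \<rho>1 (kmass S \<epsilon> s l) n) \<le> exp_moment 0 \<rho>1 (kmass S \<epsilon> s l)" for s l K
      using sum_le_suminf[OF sums_summable[OF P], of "{..K}"] sums_unique[OF P] by simp
    have "(\<Sum>n\<le>n. tilt \<rho>1 (f s) n) \<le> c * w s"
    proof (rule supersolution_bound[where f = "\<lambda>s. tilt \<rho>1 (f s)" and y = "\<lambda>s. tilt \<rho>1 (y s)" and Y = "\<lambda>_. Y"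
          and w = "\<lambda>s. c * w s", OF _ _ _ tilt_convolution[of f y, OF f(2)] Pp y])
      show "Y + (\<Sum>l\<in>-{i}. exp_moment 0 \<rho>1 (kmass S \<epsilon> s l) * (c * w l)) \<le> c * w s" for s
      proof -
        have "(\<Sum>l\<in>-{i}. exp_moment 0 \<rho>1 (kmass S \<epsilon> s l) * (c * w l)) = c * (\<Sum>l\<in>-{i}. exp_moment 0 \<rho>1 (kmass S \<epsilon> s l) * w l)"
          by (simp add: sum_distrib_left mult_ac)
        also have "\<dots> \<le> c * (\<theta> * w s)" using sup c(1) by (intro mult_left_mono) auto
        finally show ?thesis using c(2)[of s] by linarith
      qed
      show "0 \<le> c * w s" for s using c(1) w[of s] by simp
    qed (use e f(1) kern_0[OF S e] in auto)
    moreover have "tilt \<rho>1 (f s) n \<le> (\<Sum>n\<le>n. tilt \<rho>1 (f s) n)" by (rule member_le_sum) (use f in auto)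
    ultimately have "exp (\<rho>1 * real n) * f s n \<le> C" using wmax[of s] by (simp add: tilt_def)
    thus ?thesis using f(1)[of s n] by (simp add: exp_minus field_simps)
  qed
  have ev1: "eventually (\<lambda>\<epsilon>. passage_decay C \<rho>1 i \<epsilon>) small_eps"
    using small_eps_nonneg kernel_term_bound sup kernel_bound
  proof eventually_elim
    case (elim \<epsilon>)
    have y: "(\<Sum>n\<le>K. tilt \<rho>1 (kmass S \<epsilon> s i) n) \<le> Y" for s K
    proof -
      have "(\<Sum>n\<le>K. tilt \<rho>1 (kmass S \<epsilon> s i) n) \<le> (\<Sum>n\<le>K. exp (\<beta> * real n) * kmass S \<epsilon> s i n)"
        using rho by (intro sum_mono) (auto simp: tilt_def intro!: mult_right_mono)
      also have "\<dots> \<le> M" using elim(4) by blast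
      finally show ?thesis by (simp add: Y_def)
    qed
    show ?case
      using main[OF elim(1,2,3) g_time_nonneg first_passage.g_eq[OF first_passage_axioms[OF elim(1)]] y] by blast
  qed
  have ev2: "eventually (\<lambda>\<epsilon>. sojourn_decay C \<rho>1 i \<epsilon>) small_eps"
    using small_eps_nonneg kernel_term_bound sup kernel_bound
  proof eventually_elim
    case (elim \<epsilon>)
    have surv: "survival S \<epsilon> s n \<le> real CARD('n option) * M * exp (- \<beta> * real n)" for s n
      by (rule survival_le) (use elim(4) \<beta> in auto)
    have y: "(\<Sum>n\<le>K. tilt \<rho>1 (\<lambda>n. if s = j then survival S \<epsilon> s n else 0) n) \<le> Y" for s j K
    proof -
      have "(\<Sum>n\<le>K. tilt \<rho>1 (\<lambda>n. if s = j then survival S \<epsilon> s n else 0) n) \<le>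
          (\<Sum>n\<le>K. real CARD('n option) * M * (real n ^ 0 * exp (- \<delta> * real n)))"
      proof (rule sum_mono)
        fix n
        have "(if s = j then survival S \<epsilon> s n else 0) \<le> real CARD('n option) * M * exp (- \<beta> * real n)"
        proof (cases "s = j")
          case False
          have "0 \<le> real CARD('n option) * M * exp (- \<beta> * real n)"
            by (intro mult_nonneg_nonneg M_nonneg) auto
          thus ?thesis using False by (simp only: if_False)
        qed (use surv[of s n] in \<open>simp only: if_True refl\<close>)
        hence "tilt \<rho>1 (\<lambda>n. if s = j then survival S \<epsilon> s n else 0) n \<le>
            exp (\<rho>1 * real n) * (real CARD('n option) * M * exp (- \<beta> * real n))"
          unfolding tilt_def by (intro mult_left_mono) auto
        also have "\<dots> = real CARD('n option) * M * (exp (\<rho>1 * real n) * exp (- \<beta> * real n))" by (simp add: mult_ac)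
        also have "exp (\<rho>1 * real n) * exp (- \<beta> * real n) = exp (- \<delta> * real n)"
          by (simp add: \<delta>_def algebra_simps flip: exp_add)
        finally show "tilt \<rho>1 (\<lambda>n. if s = j then survival S \<epsilon> s n else 0) n \<le>
          real CARD('n option) * M * (real n ^ 0 * exp (- \<delta> * real n))" by simp
      qed
      also have "\<dots> = real CARD('n option) * M * (\<Sum>n\<le>K. real n ^ 0 * exp (- \<delta> * real n))"
        by (rule sum_distrib_left[symmetric])
      also have "\<dots> \<le> MS" unfolding MS_def
        by (intro mult_left_mono sum_le_suminf summable_poly_exp d) (use M_nonneg in auto)
      finally show ?thesis by (simp add: Y_def)
    qed
    show ?case
      using main[OF elim(1,2,3) occupation_nonneg occupation_eq[OF elim(1)] y] by blast
  qed
  show thesis by (rule that[OF C0 ev1 ev2])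
qed

end

section \<open>The characteristic root\<close>

lemma tilt_root_unique:
  assumes a: "\<And>n. a n \<ge> 0" "a 0 = 0" "a m > 0" and x: "tilt x a sums 1" and y: "tilt y a sums 1"
  shows "x = y"
proof -
  have gen: False if "x < y" "tilt x a sums 1" "tilt y a sums 1" for x y
  proof -
    have d: "(\<lambda>n. tilt y a n - tilt x a n) sums 0" using sums_diff[OF that(3,2)] by simp
    have nn: "0 \<le> tilt y a n - tilt x a n" for n
      using that(1) a(1) by (simp add: tilt_def mult_right_mono)
    have "tilt y a m - tilt x a m = 0"
      using nn iffD1[OF suminf_eq_zero_iff[OF sums_summable[OF d]] sums_unique[OF d, symmetric]] by blast
    moreover have "m \<noteq> 0" using a(2,3) by (metis less_irrefl)
    ultimately show False using that(1) a(3) by (simp add: tilt_def)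
  qed
  show ?thesis using gen[of x y] gen[of y x] x y by (meson linorder_neqE)
qed

context perturbed_smp
begin

lemma return_root_solidarity:
  assumes e: "\<epsilon> \<ge> 0" and kb: "kernel_decay \<epsilon>"
    and irr: "\<forall>s i. \<exists>n. fpass S \<epsilon> s i n > 0" and rho: "\<rho> < \<beta>" and i: "tilt \<rho> (fpass S \<epsilon> i i) sums 1"
  shows "tilt \<rho> (fpass S \<epsilon> j j) sums 1"
proof -
  interpret fp: first_passage "\<lambda>s l. kmass S \<epsilon> s l" "\<lambda>s i. fpass S \<epsilon> s i" by (rule first_passage_axioms[OF e])
  interpret ft: first_passage "\<lambda>s l. tilt \<rho> (kmass S \<epsilon> s l)" "\<lambda>s i. tilt \<rho> (fpass S \<epsilon> s i)" by (rule fp.first_passage_tilt)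
  show ?thesis
    by (rule ft.return_solidarity[OF _ _ i]) (use irr transition_gf_sums[OF kb rho, of 0] in auto)
qed

text \<open>
  Strict monotonicity leaves room for one root only; the definite description in \<open>char_root\<close> therefore
  picks it as soon as one value is a root for all states.
\<close>

lemma char_root_eqI:
  assumes e: "\<epsilon> \<ge> 0" and irr: "\<forall>s i. \<exists>n. fpass S \<epsilon> s i n > 0" and r: "\<And>i. tilt \<rho> (fpass S \<epsilon> i i) sums 1"
  shows "char_root S \<epsilon> = \<rho>" and "\<exists>!\<rho>. phi S \<epsilon> (Some i) (Some i) \<rho> 0 = 1"
proof -
  interpret fp: first_passage "\<lambda>s l. kmass S \<epsilon> s l" "\<lambda>s i. fpass S \<epsilon> s i" by (rule first_passage_axioms[OF e])
  have uniq: "\<sigma> = \<rho>" if s: "tilt \<sigma> (fpass S \<epsilon> i i) sums 1" for \<sigma> i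
  proof -
    obtain m where "fpass S \<epsilon> i i m > 0" using irr by blast
    from tilt_root_unique[OF g_time_nonneg fp.g_0 this s r] show ?thesis .
  qed
  show "\<exists>!\<rho>. phi S \<epsilon> (Some i) (Some i) \<rho> 0 = 1"
    unfolding phi_eq_1_iff using r uniq by blast
  show "char_root S \<epsilon> = \<rho>"
    unfolding char_root_def phi_eq_1_iff by (rule the_equality) (use r uniq in blast)+
qed

lemma fpass_partial_sum_le_1: "(\<Sum>n\<le>K. fpass S 0 s i n) \<le> 1"
proof -
  have s: "fpass S 0 s i sums g_total S 0 (Some s) (Some i)" by (rule g_total_sums[OF S]) simp
  have "(\<Sum>n\<le>K. fpass S 0 s i n) \<le> g_total S 0 (Some s) (Some i)"
    unfolding sums_unique[OF s] by (rule sum_le_suminf[OF sums_summable[OF s]]) (auto simp: g_time_nonneg)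
  also have "\<dots> \<le> 1"
    unfolding g_total_def by (rule prob_space.prob_le_1[OF law_basics(4)[OF S]]) simp
  finally show ?thesis .
qed

text \<open>
  Let \<open>\<rho>\<close> be the supremum of the arguments at which all partial sums of the generating function are at
  most one. The condition is closed, so the value at \<open>\<rho>\<close> is at most one and in particular finite. Were
  it less than one, then the generating function would be finite and continuous slightly beyond
  \<open>\<rho>\<close>, which contradicts the choice of \<open>\<rho>\<close>. The generating function thus cannot jump to infinity
  before it reaches one.
\<close>

lemma root_exists_0: "\<exists>i \<rho>. \<rho> < \<beta> \<and> tilt \<rho> (fpass S 0 i i) sums 1"
proof -
  obtain i \<beta>' where b: "\<beta>' \<le> \<beta>" and gt: "phi S 0 (Some i) (Some i) \<beta>' 0 > 1" using exceeds by blast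
  define a where "a = fpass S 0 i i"
  have a0: "a n \<ge> 0" for n by (simp add: a_def g_time_nonneg)
  have mono: "tilt x a n \<le> tilt y a n" if "x \<le> y" for x y n
    using that a0 by (simp add: tilt_def mult_right_mono)
  define D where "D = {\<rho>. \<rho> \<le> \<beta>' \<and> (\<forall>K. (\<Sum>n\<le>K. tilt \<rho> a n) \<le> 1)}"
  have gt': "\<not> (\<forall>K. (\<Sum>n\<le>K. tilt \<beta>' a n) \<le> 1)"
  proof
    assume bd: "\<forall>K. (\<Sum>n\<le>K. tilt \<beta>' a n) \<le> 1"
    have s: "summable (tilt \<beta>' a)" "suminf (tilt \<beta>' a) \<le> 1"
      using summable_of_partial_bound[of "tilt \<beta>' a" 1] a0 bd by auto
    have "phi S 0 (Some i) (Some i) \<beta>' 0 = (\<Sum>n. ennreal (tilt \<beta>' a n))"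
      unfolding phi_def a_def tilt_def by simp
    also have "\<dots> = ennreal (suminf (tilt \<beta>' a))" by (rule suminf_ennreal2[OF _ s(1)]) (simp add: a0)
    also have "\<dots> \<le> 1" using s(2) by simp
    finally show False using gt by simp
  qed
  \<comment> \<open>At non-positive arguments the generating function is at most the total return probability.\<close>
  have "min 0 \<beta>' \<in> D"
  proof -
    have "(\<Sum>n\<le>K. tilt (min 0 \<beta>') a n) \<le> 1" for K
    proof -
      have "(\<Sum>n\<le>K. tilt (min 0 \<beta>') a n) \<le> (\<Sum>n\<le>K. tilt 0 a n)" by (intro sum_mono mono) simp
      thus ?thesis using fpass_partial_sum_le_1[of i i K] by (simp add: a_def)
    qed
    thus ?thesis by (simp add: D_def)
  qed
  hence ne: "D \<noteq> {}" by blast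
  have bdd: "bdd_above D" by (rule bdd_aboveI[of _ \<beta>']) (simp add: D_def)
  have "D = {..\<beta>'} \<inter> (\<Inter>K. {\<rho>. (\<Sum>n\<le>K. tilt \<rho> a n) \<le> 1})" by (auto simp: D_def)
  moreover have "closed {\<rho>. (\<Sum>n\<le>K. tilt \<rho> a n) \<le> 1}" for K
    unfolding tilt_def by (intro closed_Collect_le continuous_intros)
  ultimately have "closed D" by auto
  hence rD: "Sup D \<in> D" by (rule closed_contains_Sup[OF ne bdd])
  define \<rho> where "\<rho> = Sup D"
  have r: "\<rho> < \<beta>'" "\<And>K. (\<Sum>n\<le>K. tilt \<rho> a n) \<le> 1"
    using rD gt' unfolding \<rho>_def D_def by (auto simp: less_le)
  have s: "summable (tilt \<rho> a)" "suminf (tilt \<rho> a) \<le> 1"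
    using summable_of_partial_bound[of "tilt \<rho> a" 1] a0 r(2) by auto
  have "suminf (tilt \<rho> a) = 1"
  proof (rule ccontr)
    assume "suminf (tilt \<rho> a) \<noteq> 1"
    hence lt: "exp_moment 0 \<rho> a < 1" using s(2) by (simp add: exp_moment_def)
    have "\<rho> < \<beta>" using r(1) b by simp
    from this s(1) obtain \<rho>1 w \<theta> where w: "\<rho> < \<rho>1" "\<rho>1 < \<beta>" "\<And>s. w s > 0" "0 \<le> \<theta>" "\<theta> < 1"
      "eventually (\<lambda>\<epsilon>. contracting i \<rho>1 w \<theta> \<epsilon>) small_eps"
      unfolding a_def by (rule uniform_supersolution) blast
    obtain C where "eventually (\<lambda>\<epsilon>. passage_decay C \<rho>1 i \<epsilon>) small_eps"
      by (rule uniform_exponential_bound[OF w(2-6)])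
    hence ab: "\<bar>a n\<bar> \<le> C * exp (- \<rho>1 * real n)" for n
      unfolding eventually_small_eps a_def by blast
    have "((\<lambda>\<sigma>. exp_moment 0 \<sigma> a) \<longlongrightarrow> exp_moment 0 \<rho> a) (at_right \<rho>)"
      by (rule exp_moment_tendsto[of _ C \<rho>1]) (use ab w in auto)
    from order_tendstoD(2)[OF this lt]
    have ev: "eventually (\<lambda>\<sigma>. exp_moment 0 \<sigma> a < 1) (at_right \<rho>)" .
    have near: "eventually (\<lambda>\<sigma>. \<sigma> < c) (at_right \<rho>)" if "\<rho> < c" for c
      using that by (auto simp: eventually_at_right_field)
    have "eventually (\<lambda>\<sigma>. exp_moment 0 \<sigma> a < 1 \<and> \<sigma> < \<rho>1 \<and> \<sigma> < \<beta>' \<and> \<rho> < \<sigma>) (at_right \<rho>)"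
      by (intro eventually_conj ev near w(1) r(1) eventually_at_right_less)
    then obtain \<sigma> where \<sigma>: "exp_moment 0 \<sigma> a < 1" "\<sigma> < \<rho>1" "\<sigma> < \<beta>'" "\<rho> < \<sigma>"
      using eventually_happens[of _ "at_right \<rho>"] trivial_limit_at_right_real[of \<rho>] by blast
    have sm: "tilt \<sigma> a sums exp_moment 0 \<sigma> a" using exp_moment_sums[OF ab \<sigma>(2), of 0] by simp
    have "(\<Sum>n\<le>K. tilt \<sigma> a n) \<le> 1" for K
      using sum_le_suminf[OF sums_summable[OF sm], of "{..K}"] a0 sums_unique[OF sm] \<sigma>(1) by simp
    hence "\<sigma> \<in> D" using \<sigma>(3) by (simp add: D_def)
    hence "\<sigma> \<le> \<rho>" unfolding \<rho>_def using bdd by (rule cSup_upper)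
    thus False using \<sigma>(4) by simp
  qed
  hence "tilt \<rho> a sums 1" using summable_sums[OF s(1)] by simp
  thus ?thesis using r(1) b unfolding a_def by (intro exI[of _ i] exI[of _ \<rho>]) auto
qed

lemma kernel_term_bound_0: "kernel_decay 0"
  using kernel_term_bound unfolding eventually_small_eps by blast

lemma char_root_0: "char_root S 0 < \<beta>" "tilt (char_root S 0) (fpass S 0 i i) sums 1"
proof -
  obtain i0 \<rho> where r: "\<rho> < \<beta>" "tilt \<rho> (fpass S 0 i0 i0) sums 1" using root_exists_0 by blast
  have all: "tilt \<rho> (fpass S 0 i i) sums 1" for i
    by (rule return_root_solidarity[OF _ kernel_term_bound_0 _ r]) (use irreducible_0 in auto)
  have "char_root S 0 = \<rho>" by (rule char_root_eqI[OF _ _ all]) (use irreducible_0 in auto)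
  thus "char_root S 0 < \<beta>" "tilt (char_root S 0) (fpass S 0 i i) sums 1" using r(1) all by auto
qed

text \<open>
  Exponential bounds at a rate \<open>\<rho>1\<close> strictly beyond the unperturbed root; all further limits are
  dominated by them.
\<close>

lemma uniform_control:
  obtains \<rho>1 w \<theta> C where "char_root S 0 < \<rho>1" "\<rho>1 < \<beta>" "\<And>s. w s > 0" "0 \<le> \<theta>" "\<theta> < 1" "C \<ge> 0"
    "eventually (\<lambda>\<epsilon>. contracting i \<rho>1 w \<theta> \<epsilon>) small_eps"
    "eventually (\<lambda>\<epsilon>. passage_decay C \<rho>1 i \<epsilon>) small_eps"
    "eventually (\<lambda>\<epsilon>. sojourn_decay C \<rho>1 i \<epsilon>) small_eps"
proof -
  obtain \<rho>1 w \<theta> where w: "char_root S 0 < \<rho>1" "\<rho>1 < \<beta>" "\<And>s. w s > 0" "0 \<le> \<theta>" "\<theta> < 1"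
    "eventually (\<lambda>\<epsilon>. contracting i \<rho>1 w \<theta> \<epsilon>) small_eps"
    by (rule uniform_supersolution[OF char_root_0(1) sums_summable[OF char_root_0(2)]]) blast
  obtain C where "C \<ge> 0"
    "eventually (\<lambda>\<epsilon>. passage_decay C \<rho>1 i \<epsilon>) small_eps"
    "eventually (\<lambda>\<epsilon>. sojourn_decay C \<rho>1 i \<epsilon>) small_eps"
    by (rule uniform_exponential_bound[OF w(2-6)])
  with w show thesis using that by blast
qed

text \<open>
  The unperturbed generating function is strictly increasing, so it lies below one to the left of its root
  and above one to the right. Both inequalities persist for small \<open>\<epsilon>\<close>; the intermediate value theorem gives
  a root for one state and solidarity gives it for all.
\<close>

lemma root_near:
  assumes eta: "\<eta> > 0"
  shows "eventually (\<lambda>\<epsilon>. \<exists>\<rho>. \<bar>\<rho> - char_root S 0\<bar> < \<eta> \<and> (\<forall>i. tilt \<rho> (fpass S \<epsilon> i i) sums 1)) small_eps"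
proof -
  define i :: 'n where "i = undefined"
  define \<rho>0 where "\<rho>0 = char_root S 0"
  obtain \<rho>1 w \<theta> C where u: "\<rho>0 < \<rho>1" "\<rho>1 < \<beta>"
    "eventually (\<lambda>\<epsilon>. passage_decay C \<rho>1 i \<epsilon>) small_eps"
    unfolding \<rho>0_def by (rule uniform_control[of i]) blast
  \<comment> \<open>Small enough to stay within \<open>\<eta>\<close> and to the left of \<open>\<rho>1\<close>.\<close>
  define \<gamma> where "\<gamma> = min \<eta> (\<rho>1 - \<rho>0) / 2"
  have g: "\<gamma> > 0" "\<gamma> < \<eta>" "\<rho>0 + \<gamma> < \<rho>1" using eta u(1) by (auto simp: \<gamma>_def min_def field_simps)
  have b0: "\<bar>fpass S 0 i i n\<bar> \<le> C * exp (- \<rho>1 * real n)" for n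
    using u(3) unfolding eventually_small_eps by blast
  have bd: "eventually (\<lambda>\<epsilon>. \<forall>n. \<bar>fpass S \<epsilon> i i n\<bar> \<le> C * exp (- \<rho>1 * real n)) small_eps"
    using u(3) by eventually_elim blast
  interpret fp: first_passage "\<lambda>s l. kmass S 0 s l" "\<lambda>s i. fpass S 0 s i" by (rule first_passage_axioms) simp
  obtain m where m: "fpass S 0 i i m > 0" using irreducible_0 by blast
  have "m \<noteq> 0" using m fp.g_0[of i i] by (metis less_irrefl)
  hence inc: "exp_moment 0 x (fpass S 0 i i) < exp_moment 0 y (fpass S 0 i i)" if "x < y" "y < \<rho>1" for x y
  proof -
    have "0 < (y - x) * (real m * exp (x * real m) * fpass S 0 i i m)"
      using that m \<open>m \<noteq> 0\<close> by simp
    also have "\<dots> \<le> exp_moment 0 y (fpass S 0 i i) - exp_moment 0 x (fpass S 0 i i)"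
      by (rule exp_moment_increase[OF b0 g_time_nonneg]) (use that in auto)
    finally show ?thesis by simp
  qed
  have one: "exp_moment 0 \<rho>0 (fpass S 0 i i) = 1"
    using sums_unique[OF char_root_0(2)[of i]] by (simp add: exp_moment_def \<rho>0_def)
  have lim: "((\<lambda>\<epsilon>. exp_moment 0 \<rho> (fpass S \<epsilon> i i)) \<longlongrightarrow> exp_moment 0 \<rho> (fpass S 0 i i)) small_eps" if "\<rho> < \<rho>1" for \<rho>
    by (rule exp_moment_tendsto[OF bd fpass_tendsto tendsto_const that])
  have e1: "eventually (\<lambda>\<epsilon>. exp_moment 0 (\<rho>0 - \<gamma>) (fpass S \<epsilon> i i) < 1) small_eps"
    by (rule order_tendstoD(2)[OF lim]) (use inc[of "\<rho>0 - \<gamma>" \<rho>0] one g in auto)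
  have e2: "eventually (\<lambda>\<epsilon>. 1 < exp_moment 0 (\<rho>0 + \<gamma>) (fpass S \<epsilon> i i)) small_eps"
    by (rule order_tendstoD(1)[OF lim]) (use inc[of \<rho>0 "\<rho>0 + \<gamma>"] one g in auto)
  show ?thesis
    using e1 e2 bd small_eps_nonneg kernel_term_bound irreducible
  proof eventually_elim
    case (elim \<epsilon>)
    have cont: "continuous_on {\<rho>0 - \<gamma>..\<rho>0 + \<gamma>} (\<lambda>\<rho>. exp_moment 0 \<rho> (fpass S \<epsilon> i i))"
    proof (rule continuous_at_imp_continuous_on, rule ballI)
      fix x assume "x \<in> {\<rho>0 - \<gamma>..\<rho>0 + \<gamma>}"
      hence "x < \<rho>1" using g(3) by simp
      thus "isCont (\<lambda>\<rho>. exp_moment 0 \<rho> (fpass S \<epsilon> i i)) x"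
        unfolding isCont_def by (intro exp_moment_tendsto[of _ C \<rho>1]) (use elim(3) in auto)
    qed
    obtain \<rho> where r: "\<rho>0 - \<gamma> \<le> \<rho>" "\<rho> \<le> \<rho>0 + \<gamma>" "exp_moment 0 \<rho> (fpass S \<epsilon> i i) = 1"
      using IVT'[OF _ _ _ cont, of 1] elim(1,2) g(1) by auto
    have "tilt \<rho> (fpass S \<epsilon> i i) sums 1"
      using exp_moment_sums[of "fpass S \<epsilon> i i" C \<rho>1 \<rho> 0] elim(3) r g(3) by simp
    hence "tilt \<rho> (fpass S \<epsilon> j j) sums 1" for j
      by (rule return_root_solidarity[OF elim(4,5,6), rotated]) (use r g u in auto)
    moreover have "\<bar>\<rho> - \<rho>0\<bar> < \<eta>" using r g by (simp add: abs_if)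
    ultimately show ?case unfolding \<rho>0_def by blast
  qed
qed

lemma char_root_small_eps:
  "eventually (\<lambda>\<epsilon>. (\<forall>i. tilt (char_root S \<epsilon>) (fpass S \<epsilon> i i) sums 1) \<and>
     (\<forall>i. \<exists>!\<rho>. phi S \<epsilon> (Some i) (Some i) \<rho> 0 = 1)) small_eps"
  using root_near[OF zero_less_one] small_eps_nonneg irreducible
proof eventually_elim
  case (elim \<epsilon>)
  then obtain \<rho> where r: "\<forall>i. tilt \<rho> (fpass S \<epsilon> i i) sums 1" by blast
  show ?case using char_root_eqI[OF elim(2,3), of \<rho>] r by auto
qed

lemma char_root_tendsto: "(char_root S \<longlongrightarrow> char_root S 0) small_eps"
  unfolding tendsto_iff
proof (intro allI impI)
  fix \<eta> :: real assume eta: "\<eta> > 0"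
  show "eventually (\<lambda>\<epsilon>. dist (char_root S \<epsilon>) (char_root S 0) < \<eta>) small_eps"
    using root_near[OF eta] small_eps_nonneg irreducible
  proof eventually_elim
    case (elim \<epsilon>)
    then obtain \<rho> where r: "\<forall>i. tilt \<rho> (fpass S \<epsilon> i i) sums 1" "\<bar>\<rho> - char_root S 0\<bar> < \<eta>" by blast
    have "char_root S \<epsilon> = \<rho>" using char_root_eqI(1)[OF elim(2,3)] r(1) by blast
    thus ?case using r(2) by (simp add: dist_real_def)
  qed
qed

lemma roots_on_interval:
  "\<exists>\<delta>>0. \<forall>\<epsilon>\<in>{0..\<delta>}. \<forall>i. (\<exists>!\<rho>. phi S \<epsilon> (Some i) (Some i) \<rho> 0 = 1) \<and>
     phi S \<epsilon> (Some i) (Some i) (char_root S \<epsilon>) 0 = 1"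
proof -
  have "eventually (\<lambda>\<epsilon>. \<forall>i. (\<exists>!\<rho>. phi S \<epsilon> (Some i) (Some i) \<rho> 0 = 1) \<and>
     phi S \<epsilon> (Some i) (Some i) (char_root S \<epsilon>) 0 = 1) small_eps" (is "eventually ?P _")
    using char_root_small_eps by eventually_elim (simp add: phi_eq_1_iff)
  then obtain b where b: "b > 0" "\<And>\<epsilon>. 0 < \<epsilon> \<Longrightarrow> \<epsilon> < b \<Longrightarrow> ?P \<epsilon>" and P0: "?P 0"
    unfolding eventually_small_eps eventually_at_right_field by blast
  have "\<forall>\<epsilon>\<in>{0..b / 2}. ?P \<epsilon>"
  proof
    fix \<epsilon> assume e: "\<epsilon> \<in> {0..b / 2}"
    show "?P \<epsilon>" using P0 b(2)[of \<epsilon>] b(1) e by (cases "\<epsilon> = 0") auto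
  qed
  thus ?thesis using b(1) by (intro exI[of _ "b / 2"]) auto
qed

section \<open>The limit of the tilted occupation probabilities\<close>

text \<open>
  Tilting by the root \<open>\<rho>\<^sup>(\<^sup>\<epsilon>\<^sup>)\<close> turns the defective law of the return time into a probability
  distribution, and the decomposition at the first return into a proper renewal equation.
\<close>

lemma tilted_occupation_limit:
  assumes T: "filterlim T at_top (at_right 0)" and E: "cond_E S"
  shows "((\<lambda>\<epsilon>. exp (char_root S \<epsilon> * real (T \<epsilon>)) * occupation S \<epsilon> {} i j (T \<epsilon>)) \<longlongrightarrow>
    pi_tilde S (Some i) (Some j)) (at_right 0)"
proof -
  note [intro] = filter_leD[OF at_right_le_small_eps]
  define \<rho>0 where "\<rho>0 = char_root S 0"
  obtain \<rho>1 w \<theta> C where u: "\<rho>0 < \<rho>1" "\<rho>1 < \<beta>" "C \<ge> 0"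
    "eventually (\<lambda>\<epsilon>. passage_decay C \<rho>1 i \<epsilon>) small_eps"
    "eventually (\<lambda>\<epsilon>. sojourn_decay C \<rho>1 i \<epsilon>) small_eps"
    unfolding \<rho>0_def by (rule uniform_control[of i]) blast
  \<comment> \<open>The perturbed roots eventually stay below \<open>\<sigma>\<close>, which leaves the geometric rate \<open>t\<close>.\<close>
  define \<sigma> where "\<sigma> = (\<rho>0 + \<rho>1) / 2"
  have sg: "\<rho>0 < \<sigma>" "\<sigma> < \<rho>1" using u(1) by (simp_all add: \<sigma>_def)
  define t where "t = exp (- (\<rho>1 - \<sigma>))"
  have t: "0 \<le> t" "t < 1" using sg by (simp_all add: t_def)
  have root_le: "eventually (\<lambda>\<epsilon>. char_root S \<epsilon> \<le> \<sigma>) small_eps"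
    using order_tendstoD(2)[OF char_root_tendsto, of \<sigma>] sg(1) unfolding \<rho>0_def by (auto elim: eventually_mono)
  have tb: "\<bar>tilt \<rho> a n\<bar> \<le> C * t ^ n" if "\<bar>a n\<bar> \<le> C * exp (- \<rho>1 * real n)" "\<rho> \<le> \<sigma>" for \<rho> a n
    using moment_tilt_bound[of a n, OF that, of 0] by (simp add: t_def exp_of_nat_mult[symmetric] mult.commute)
  have lim: "(char_root S \<longlongrightarrow> \<rho>0) (at_right 0)"
    using tendsto_mono[OF at_right_le_small_eps char_root_tendsto] by (simp add: \<rho>0_def)
  have "((\<lambda>\<epsilon>. tilt (char_root S \<epsilon>) (occupation S \<epsilon> {} i j) (T \<epsilon>)) \<longlongrightarrow>
      (\<Sum>n. tilt \<rho>0 (occupation S 0 {i} i j) n) / (\<Sum>n. real n * tilt \<rho>0 (fpass S 0 i i) n)) (at_right 0)"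
  proof (rule perturbed_renewal_theorem[where f = "\<lambda>\<epsilon>. tilt (char_root S \<epsilon>) (fpass S \<epsilon> i i)"
        and y = "\<lambda>\<epsilon>. tilt (char_root S \<epsilon>) (occupation S \<epsilon> {i} i j)" and C = C and t = t
        and x = "\<lambda>\<epsilon>. tilt (char_root S \<epsilon>) (occupation S \<epsilon> {} i j)"])
    have "eventually (\<lambda>\<epsilon>. (\<forall>n. 0 \<le> tilt (char_root S \<epsilon>) (fpass S \<epsilon> i i) n \<and> tilt (char_root S \<epsilon>) (fpass S \<epsilon> i i) n \<le> C * t ^ n) \<and>
        tilt (char_root S \<epsilon>) (fpass S \<epsilon> i i) sums 1 \<and> tilt (char_root S \<epsilon>) (fpass S \<epsilon> i i) 0 = 0) small_eps"
      using u(4) root_le char_root_small_eps small_eps_nonneg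
    proof eventually_elim
      case (elim \<epsilon>)
      have "tilt (char_root S \<epsilon>) (fpass S \<epsilon> i i) n \<le> C * t ^ n" for n
        using tb[of "fpass S \<epsilon> i i" n, OF _ elim(2)] elim(1) by (meson abs_le_D1)
      thus ?case using elim(3) first_passage.g_0[OF first_passage_axioms[OF elim(4)]] by (simp add: g_time_nonneg)
    qed
    thus "eventually (\<lambda>\<epsilon>. (\<forall>n. 0 \<le> tilt (char_root S \<epsilon>) (fpass S \<epsilon> i i) n \<and> tilt (char_root S \<epsilon>) (fpass S \<epsilon> i i) n \<le> C * t ^ n) \<and>
        tilt (char_root S \<epsilon>) (fpass S \<epsilon> i i) sums 1 \<and> tilt (char_root S \<epsilon>) (fpass S \<epsilon> i i) 0 = 0) (at_right 0)" ..
    have "eventually (\<lambda>\<epsilon>. \<forall>n. \<bar>tilt (char_root S \<epsilon>) (occupation S \<epsilon> {i} i j) n\<bar> \<le> C * t ^ n) small_eps"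
      using u(5) root_le
    proof eventually_elim
      case (elim \<epsilon>)
      show ?case using tb[of "occupation S \<epsilon> {i} i j", OF _ elim(2)] elim(1) by blast
    qed
    thus "eventually (\<lambda>\<epsilon>. \<forall>n. \<bar>tilt (char_root S \<epsilon>) (occupation S \<epsilon> {i} i j) n\<bar> \<le> C * t ^ n) (at_right 0)" ..
    have "eventually (\<lambda>\<epsilon>. \<forall>n. tilt (char_root S \<epsilon>) (occupation S \<epsilon> {} i j) n = tilt (char_root S \<epsilon>) (occupation S \<epsilon> {i} i j) n +
        (\<Sum>m\<le>n. tilt (char_root S \<epsilon>) (fpass S \<epsilon> i i) m * tilt (char_root S \<epsilon>) (occupation S \<epsilon> {} i j) (n - m))) small_eps"
      using small_eps_nonneg
    proof eventually_elim
      case (elim \<epsilon>)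
      show ?case
      proof
        fix n
        let ?r = "char_root S \<epsilon>"
        have "occupation S \<epsilon> {} i j n = occupation S \<epsilon> {i} i j n + (\<Sum>m\<le>n. fpass S \<epsilon> i i m * occupation S \<epsilon> {} i j (n - m))"
          by (rule first_passage.renewal_decomposition[OF first_passage_axioms[OF elim], where
                X = "\<lambda>s. occupation S \<epsilon> {} s j" and H = "\<lambda>s. occupation S \<epsilon> {i} s j"
                and y = "\<lambda>s n. if s = j then survival S \<epsilon> s n else 0"])
             (use occupation_eq[OF elim, of "{}"] occupation_eq[OF elim, of "{i}"] in \<open>simp_all only: Compl_empty_eq\<close>)
        hence "tilt ?r (occupation S \<epsilon> {} i j) n = tilt ?r (occupation S \<epsilon> {i} i j) n +
          (\<Sum>m\<le>n. exp (?r * real n) * (fpass S \<epsilon> i i m * occupation S \<epsilon> {} i j (n - m)))"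
          by (simp add: tilt_def distrib_left sum_distrib_left)
        also have "(\<Sum>m\<le>n. exp (?r * real n) * (fpass S \<epsilon> i i m * occupation S \<epsilon> {} i j (n - m))) =
          (\<Sum>m\<le>n. tilt ?r (fpass S \<epsilon> i i) m * tilt ?r (occupation S \<epsilon> {} i j) (n - m))"
        proof (intro sum.cong refl)
          fix m assume "m \<in> {..n}"
          hence "exp (?r * real n) = exp (?r * real m) * exp (?r * real (n - m))"
            by (simp add: of_nat_diff algebra_simps flip: exp_add)
          thus "exp (?r * real n) * (fpass S \<epsilon> i i m * occupation S \<epsilon> {} i j (n - m)) =
            tilt ?r (fpass S \<epsilon> i i) m * tilt ?r (occupation S \<epsilon> {} i j) (n - m)" by (simp add: tilt_def)
        qed
        finally show "tilt ?r (occupation S \<epsilon> {} i j) n = tilt ?r (occupation S \<epsilon> {i} i j) n +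
          (\<Sum>m\<le>n. tilt ?r (fpass S \<epsilon> i i) m * tilt ?r (occupation S \<epsilon> {} i j) (n - m))" .
      qed
    qed
    thus "eventually (\<lambda>\<epsilon>. \<forall>n. tilt (char_root S \<epsilon>) (occupation S \<epsilon> {} i j) n = tilt (char_root S \<epsilon>) (occupation S \<epsilon> {i} i j) n +
        (\<Sum>m\<le>n. tilt (char_root S \<epsilon>) (fpass S \<epsilon> i i) m * tilt (char_root S \<epsilon>) (occupation S \<epsilon> {} i j) (n - m))) (at_right 0)" ..
    show "((\<lambda>\<epsilon>. tilt (char_root S \<epsilon>) (fpass S \<epsilon> i i) n) \<longlongrightarrow> tilt \<rho>0 (fpass S 0 i i) n) (at_right 0)" for n
      unfolding tilt_def by (intro tendsto_intros lim tendsto_mono[OF at_right_le_small_eps fpass_tendsto])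
    show "((\<lambda>\<epsilon>. tilt (char_root S \<epsilon>) (occupation S \<epsilon> {i} i j) n) \<longlongrightarrow> tilt \<rho>0 (occupation S 0 {i} i j) n) (at_right 0)" for n
      unfolding tilt_def by (intro tendsto_intros lim tendsto_mono[OF at_right_le_small_eps occupation_tendsto])
    interpret fp: first_passage "\<lambda>s l. kmass S 0 s l" "\<lambda>s i. fpass S 0 s i" by (rule first_passage_axioms) simp
    obtain j0 where j0: "Gcd {n. 1 \<le> n \<and> fpass S 0 j0 j0 n > 0} = 1" using E unfolding cond_E_def by blast
    have "{n. 1 \<le> n \<and> fpass S 0 j0 j0 n > 0} = {n. fpass S 0 j0 j0 n > 0}"
      using fp.g_0[of j0 j0] by (auto simp: Suc_le_eq intro!: Nat.gr0I)
    hence "Gcd {n. fpass S 0 i i n > 0} = 1"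
      using fp.aperiodic_solidarity[OF irreducible_0, of j0 i] j0 by simp
    thus "Gcd {n. tilt \<rho>0 (fpass S 0 i i) n > 0} = 1" by simp
  qed (use t T in auto)
  moreover have "(\<Sum>n. tilt \<rho>0 (occupation S 0 {i} i j) n) / (\<Sum>n. real n * tilt \<rho>0 (fpass S 0 i i) n) = pi_tilde S (Some i) (Some j)"
    unfolding pi_tilde_def tilt_def \<rho>0_def by (simp add: h_time_occupation[OF S] mult.assoc)
  ultimately show ?thesis by (simp add: tilt_def)
qed

end

section \<open>Asymptotic expansions\<close>

text \<open>
  The coefficients form a total sequence, so that the coefficients of sums and products of expansions are
  given by formulas without case distinctions.
\<close>

definition expands :: "nat \<Rightarrow> (real \<Rightarrow> real) \<Rightarrow> (nat \<Rightarrow> real) \<Rightarrow> bool" where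
  "expands K f a \<longleftrightarrow> (\<lambda>\<epsilon>. f \<epsilon> - (\<Sum>n\<le>K. a n * \<epsilon> ^ n)) \<in> o[at_right 0](\<lambda>\<epsilon>. \<epsilon> ^ K)"

lemma power_smallo:
  assumes "K < m" shows "(\<lambda>\<epsilon>::real. \<epsilon> ^ m) \<in> o[at_right 0](\<lambda>\<epsilon>. \<epsilon> ^ K)"
proof (rule smalloI_tendsto)
  have "((\<lambda>\<epsilon>::real. \<epsilon> ^ (m - K)) \<longlongrightarrow> 0 ^ (m - K)) (at_right 0)" by (intro tendsto_intros)
  hence lim: "((\<lambda>\<epsilon>::real. \<epsilon> ^ (m - K)) \<longlongrightarrow> 0) (at_right 0)" using assms by simp
  have "eventually (\<lambda>\<epsilon>::real. \<epsilon> ^ (m - K) = \<epsilon> ^ m / \<epsilon> ^ K) (at_right 0)"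
    using eventually_at_right_less by eventually_elim (use assms in \<open>simp add: power_diff\<close>)
  from Lim_transform_eventually[OF lim this] show "((\<lambda>\<epsilon>::real. \<epsilon> ^ m / \<epsilon> ^ K) \<longlongrightarrow> 0) (at_right 0)" .
  show "eventually (\<lambda>\<epsilon>::real. \<epsilon> ^ K \<noteq> 0) (at_right 0)"
    using eventually_at_right_less by eventually_elim simp
qed

lemma scaled_power_smallo:
  assumes "K < m" shows "(\<lambda>\<epsilon>::real. c * \<epsilon> ^ m) \<in> o[at_right 0](\<lambda>\<epsilon>. \<epsilon> ^ K)"
  using landau_o.big_small_mult[OF _ power_smallo[OF assms], of "\<lambda>_. c" "\<lambda>_. 1"] by simp

lemma power_bigo: "K \<le> m \<Longrightarrow> (\<lambda>\<epsilon>::real. \<epsilon> ^ m) \<in> O[at_right 0](\<lambda>\<epsilon>. \<epsilon> ^ K)"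
  using power_smallo[of K m] by (cases "K = m") (auto intro: landau_o.small_imp_big)

lemma smallo_sum:
  assumes "\<And>i. i \<in> I \<Longrightarrow> f i \<in> o[F](g)"
  shows "(\<lambda>x. \<Sum>i\<in>I. f i x) \<in> o[F](g :: _ \<Rightarrow> real)"
  using assms by (induction I rule: infinite_finite_induct) (auto intro: sum_in_smallo)

lemma polynomial_bigo_1: "(\<lambda>\<epsilon>::real. \<Sum>n\<le>K. a n * \<epsilon> ^ n) \<in> O[at_right 0](\<lambda>_. 1)"
proof (rule bigoI_tendsto)
  have "((\<lambda>\<epsilon>. \<Sum>n\<le>K. a n * \<epsilon> ^ n) \<longlongrightarrow> (\<Sum>n\<le>K. a n * 0 ^ n)) (at_right 0)"
    by (intro tendsto_intros)
  thus "((\<lambda>\<epsilon>. (\<Sum>n\<le>K. a n * \<epsilon> ^ n) / 1) \<longlongrightarrow> (\<Sum>n\<le>K. a n * 0 ^ n)) (at_right 0)" by simp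
qed simp

lemma expands_cong:
  assumes "expands K f a" "eventually (\<lambda>\<epsilon>. f \<epsilon> = g \<epsilon>) (at_right 0)" "\<And>n. n \<le> K \<Longrightarrow> a n = b n"
  shows "expands K g b"
proof -
  have "eventually (\<lambda>\<epsilon>. f \<epsilon> - (\<Sum>n\<le>K. a n * \<epsilon> ^ n) = g \<epsilon> - (\<Sum>n\<le>K. b n * \<epsilon> ^ n)) (at_right 0)"
    using assms(2) by eventually_elim (simp add: assms(3))
  from landau_o.small.in_cong[OF this] show ?thesis using assms(1) unfolding expands_def by simp
qed

lemma expands_add: "expands K f a \<Longrightarrow> expands K g b \<Longrightarrow> expands K (\<lambda>\<epsilon>. f \<epsilon> + g \<epsilon>) (\<lambda>n. a n + b n)"
  unfolding expands_def by (drule (1) sum_in_smallo(1)) (simp add: algebra_simps sum.distrib)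

lemma expands_cmult:
  assumes "expands K f a" shows "expands K (\<lambda>\<epsilon>. c * f \<epsilon>) (\<lambda>n. c * a n)"
proof -
  have "(\<lambda>\<epsilon>. c * (f \<epsilon> - (\<Sum>n\<le>K. a n * \<epsilon> ^ n))) \<in> o[at_right 0](\<lambda>\<epsilon>. 1 * \<epsilon> ^ K)"
    by (rule landau_o.big_small_mult[OF _ assms[unfolded expands_def]]) simp
  thus ?thesis unfolding expands_def by (simp add: right_diff_distrib sum_distrib_left mult.assoc)
qed

lemma expands_polynomial:
  assumes "K \<le> N" shows "expands K (\<lambda>\<epsilon>. \<Sum>n\<le>N. a n * \<epsilon> ^ n) a"
proof -
  have "{..N} = {..K} \<union> {K<..N}" "{..K} \<inter> {K<..N} = {}" using assms by auto
  hence "(\<Sum>n\<le>N. a n * \<epsilon> ^ n) - (\<Sum>n\<le>K. a n * \<epsilon> ^ n) = (\<Sum>n\<in>{K<..N}. a n * \<epsilon> ^ n)" for \<epsilon> :: real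
    by (simp add: sum.union_disjoint)
  thus ?thesis unfolding expands_def by (auto intro!: smallo_sum scaled_power_smallo)
qed

lemma expands_zero: "expands K (\<lambda>_. 0) (\<lambda>_. 0)" unfolding expands_def by simp

lemma expands_sum:
  assumes "\<And>i. i \<in> I \<Longrightarrow> expands K (f i) (a i)"
  shows "expands K (\<lambda>\<epsilon>. \<Sum>i\<in>I. f i \<epsilon>) (\<lambda>n. \<Sum>i\<in>I. a i n)"
  using assms by (induction I rule: infinite_finite_induct) (auto intro: expands_add expands_zero)

lemma expands_mono:
  assumes "expands K f a" "L \<le> K" shows "expands L f a"
proof -
  have 1: "(\<lambda>\<epsilon>. f \<epsilon> - (\<Sum>n\<le>K. a n * \<epsilon> ^ n)) \<in> o[at_right 0](\<lambda>\<epsilon>. \<epsilon> ^ L)"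
    using assms(1) power_bigo[OF assms(2)] unfolding expands_def by (rule landau_o.small_big_trans)
  have 2: "(\<lambda>\<epsilon>. (\<Sum>n\<le>K. a n * \<epsilon> ^ n) - (\<Sum>n\<le>L. a n * \<epsilon> ^ n)) \<in> o[at_right 0](\<lambda>\<epsilon>. \<epsilon> ^ L)"
    using expands_polynomial[OF assms(2)] unfolding expands_def .
  from sum_in_smallo(1)[OF 1 2] show ?thesis unfolding expands_def by simp
qed

lemma expands_bigo_1:
  assumes "expands K f a" shows "f \<in> O[at_right 0](\<lambda>_. 1)"
proof -
  have "(\<lambda>\<epsilon>. f \<epsilon> - (\<Sum>n\<le>0. a n * \<epsilon> ^ n)) \<in> O[at_right 0](\<lambda>_. 1)"
    using landau_o.small_imp_big[OF expands_mono[OF assms, of 0, unfolded expands_def]] by simp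
  from sum_in_bigo(1)[OF this polynomial_bigo_1[of a 0]] show ?thesis by simp
qed

lemma expands_mult:
  assumes f: "expands K f a" and g: "expands K g b"
  shows "expands K (\<lambda>\<epsilon>. f \<epsilon> * g \<epsilon>) (\<lambda>n. \<Sum>q\<le>n. a q * b (n - q))"
proof -
  let ?A = "\<lambda>\<epsilon>. \<Sum>n\<le>K. a n * \<epsilon> ^ n" and ?B = "\<lambda>\<epsilon>. \<Sum>n\<le>K. b n * \<epsilon> ^ n"
  let ?R = "\<lambda>\<epsilon>. \<Sum>i\<le>K. \<Sum>j\<in>{K - i<..K}. (a i * b j) * \<epsilon> ^ (i + j)"
  have trunc: "(\<Sum>n\<le>K. (\<Sum>q\<le>n. a q * b (n - q)) * \<epsilon> ^ n) = ?A \<epsilon> * ?B \<epsilon> - ?R \<epsilon>" for \<epsilon> :: real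
  proof -
    have "(\<Sum>n\<le>K. (\<Sum>q\<le>n. a q * b (n - q)) * \<epsilon> ^ n) = (\<Sum>n\<le>K. \<Sum>q\<le>n. (a q * \<epsilon> ^ q) * (b (n - q) * \<epsilon> ^ (n - q)))"
      unfolding sum_distrib_right
    proof (intro sum.cong refl)
      fix n q :: nat assume "q \<in> {..n}"
      hence "\<epsilon> ^ n = \<epsilon> ^ q * \<epsilon> ^ (n - q)" by (simp add: power_add[symmetric])
      thus "a q * b (n - q) * \<epsilon> ^ n = a q * \<epsilon> ^ q * (b (n - q) * \<epsilon> ^ (n - q))" by simp
    qed
    also have "\<dots> = (\<Sum>q\<le>K. (a q * \<epsilon> ^ q) * (\<Sum>n\<le>K - q. b n * \<epsilon> ^ n))" by (rule sum_convolution)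
    also have "\<dots> = (\<Sum>q\<le>K. (a q * \<epsilon> ^ q) * (?B \<epsilon> - (\<Sum>j\<in>{K - q<..K}. b j * \<epsilon> ^ j)))"
    proof (intro sum.cong refl arg_cong2[where f = "(*)"])
      fix q assume "q \<in> {..K}"
      have "{..K} = {..K - q} \<union> {K - q<..K}" "{..K - q} \<inter> {K - q<..K} = {}" by auto
      thus "(\<Sum>n\<le>K - q. b n * \<epsilon> ^ n) = ?B \<epsilon> - (\<Sum>j\<in>{K - q<..K}. b j * \<epsilon> ^ j)"
        by (simp add: sum.union_disjoint)
    qed
    also have "\<dots> = ?A \<epsilon> * ?B \<epsilon> - (\<Sum>q\<le>K. (a q * \<epsilon> ^ q) * (\<Sum>j\<in>{K - q<..K}. b j * \<epsilon> ^ j))"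
      by (simp only: right_diff_distrib sum_subtractf sum_distrib_right)
    also have "(\<Sum>q\<le>K. (a q * \<epsilon> ^ q) * (\<Sum>j\<in>{K - q<..K}. b j * \<epsilon> ^ j)) = ?R \<epsilon>"
      by (simp add: sum_distrib_left power_add mult_ac)
    finally show ?thesis .
  qed
  have R: "?R \<in> o[at_right 0](\<lambda>\<epsilon>. \<epsilon> ^ K)"
    by (intro smallo_sum scaled_power_smallo) auto
  have "(\<lambda>\<epsilon>. (f \<epsilon> - ?A \<epsilon>) * g \<epsilon>) \<in> o[at_right 0](\<lambda>\<epsilon>. \<epsilon> ^ K * 1)"
    using f expands_bigo_1[OF g] unfolding expands_def by (rule landau_o.small_big_mult)
  moreover have "(\<lambda>\<epsilon>. ?A \<epsilon> * (g \<epsilon> - ?B \<epsilon>)) \<in> o[at_right 0](\<lambda>\<epsilon>. 1 * \<epsilon> ^ K)"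
    using polynomial_bigo_1 g unfolding expands_def by (rule landau_o.big_small_mult)
  ultimately have "(\<lambda>\<epsilon>. ((f \<epsilon> - ?A \<epsilon>) * g \<epsilon> + ?A \<epsilon> * (g \<epsilon> - ?B \<epsilon>)) + ?R \<epsilon>) \<in> o[at_right 0](\<lambda>\<epsilon>. \<epsilon> ^ K)"
    by (intro sum_in_smallo R) simp_all
  thus ?thesis unfolding expands_def trunc by (simp add: algebra_simps)
qed

text \<open>
  A factor \<open>\<epsilon> ^ r\<close> raises the order: what is known of \<open>f\<close> to order \<open>k - r\<close> is enough to know
  \<open>\<epsilon> ^ r * f\<close> to order \<open>k\<close>.
\<close>

lemma expands_shift:
  assumes "expands K f a"
  shows "expands (K + r) (\<lambda>\<epsilon>. \<epsilon> ^ r * f \<epsilon>) (\<lambda>n. if n < r then 0 else a (n - r))"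
proof -
  have eq: "(\<Sum>n\<le>K + r. (if n < r then 0 else a (n - r)) * \<epsilon> ^ n) = \<epsilon> ^ r * (\<Sum>n\<le>K. a n * \<epsilon> ^ n)" for \<epsilon> :: real
  proof -
    have "(\<Sum>n\<le>K + r. (if n < r then 0 else a (n - r)) * \<epsilon> ^ n) = (\<Sum>n\<in>(\<lambda>n. n + r) ` {..K}. (if n < r then 0 else a (n - r)) * \<epsilon> ^ n)"
    proof (rule sum.mono_neutral_right)
      show "\<forall>n\<in>{..K + r} - (\<lambda>n. n + r) ` {..K}. (if n < r then 0 else a (n - r)) * \<epsilon> ^ n = 0"
      proof
        fix n assume n: "n \<in> {..K + r} - (\<lambda>n. n + r) ` {..K}"
        have "n < r"
        proof (rule ccontr)
          assume "\<not> n < r"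
          hence "n = (n - r) + r" "n - r \<le> K" using n by auto
          thus False using n by blast
        qed
        thus "(if n < r then 0 else a (n - r)) * \<epsilon> ^ n = 0" by simp
      qed
    qed auto
    also have "\<dots> = \<epsilon> ^ r * (\<Sum>n\<le>K. a n * \<epsilon> ^ n)"
      by (subst sum.reindex) (auto simp: sum_distrib_left power_add mult_ac)
    finally show ?thesis .
  qed
  have "(\<lambda>\<epsilon>. \<epsilon> ^ r * (f \<epsilon> - (\<Sum>n\<le>K. a n * \<epsilon> ^ n))) \<in> o[at_right 0](\<lambda>\<epsilon>. \<epsilon> ^ r * \<epsilon> ^ K)"
    by (rule landau_o.big_small_mult[OF landau_o.big_refl assms[unfolded expands_def]])
  thus ?thesis unfolding expands_def eq by (simp add: right_diff_distrib power_add mult.commute)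
qed

lemma expands_unique:
  assumes "expands K f a" "expands K f b" "n \<le> K"
  shows "a n = b n"
  using assms(3)
proof (induction n rule: less_induct)
  case (less n)
  have ab: "expands n f a" "expands n f b" using assms less.prems expands_mono by blast+
  have "(\<lambda>\<epsilon>. (f \<epsilon> - (\<Sum>m\<le>n. b m * \<epsilon> ^ m)) - (f \<epsilon> - (\<Sum>m\<le>n. a m * \<epsilon> ^ m))) \<in> o[at_right 0](\<lambda>\<epsilon>. \<epsilon> ^ n)"
    by (rule sum_in_smallo(2)[OF ab(2)[unfolded expands_def] ab(1)[unfolded expands_def]])
  moreover have "(f \<epsilon> - (\<Sum>m\<le>n. b m * \<epsilon> ^ m)) - (f \<epsilon> - (\<Sum>m\<le>n. a m * \<epsilon> ^ m)) = (a n - b n) * \<epsilon> ^ n" for \<epsilon>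
  proof -
    have "(\<Sum>m<n. b m * \<epsilon> ^ m) = (\<Sum>m<n. a m * \<epsilon> ^ m)" using less by (intro sum.cong) auto
    thus ?thesis by (simp add: lessThan_Suc_atMost[symmetric] algebra_simps)
  qed
  ultimately have "(\<lambda>\<epsilon>. (a n - b n) * \<epsilon> ^ n) \<in> o[at_right 0](\<lambda>\<epsilon>. \<epsilon> ^ n)" by simp
  from smalloD_tendsto[OF this] have lim: "((\<lambda>\<epsilon>. (a n - b n) * \<epsilon> ^ n / \<epsilon> ^ n) \<longlongrightarrow> 0) (at_right 0)" .
  have "eventually (\<lambda>\<epsilon>::real. (a n - b n) * \<epsilon> ^ n / \<epsilon> ^ n = a n - b n) (at_right 0)"
    using eventually_at_right_less by eventually_elim simp
  from Lim_transform_eventually[OF lim this] have "((\<lambda>_::real. a n - b n) \<longlongrightarrow> 0) (at_right 0)" .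
  hence "a n - b n = 0" by (simp add: tendsto_const_iff)
  thus ?case by simp
qed

section \<open>Expansion of the first-passage moments\<close>

lemma matrix_inv_right:
  fixes A :: "real^'n^'n"
  assumes "\<And>x. A *v x = 0 \<Longrightarrow> x = 0"
  shows "A ** matrix_inv A = mat 1"
proof -
  have "\<exists>B. B ** A = mat 1" unfolding matrix_left_invertible_ker using assms by blast
  then obtain B where "B ** A = mat 1" by blast
  hence "A ** B = mat 1 \<and> B ** A = mat 1" by (simp add: matrix_left_right_inverse)
  thus ?thesis unfolding matrix_inv_def by (rule someI2) simp
qed

lemma sum_triangle:
  fixes f :: "nat \<Rightarrow> nat \<Rightarrow> 'b::comm_monoid_add"
  shows "(\<Sum>q\<le>n. \<Sum>s\<le>q. f s (q - s)) = (\<Sum>s\<le>n. \<Sum>u\<le>n - s. f s u)"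
proof (induction n)
  case (Suc n)
  have "(\<Sum>s\<le>Suc n. \<Sum>u\<le>Suc n - s. f s u) = (\<Sum>s\<le>n. (\<Sum>u\<le>n - s. f s u) + f s (Suc n - s)) + f (Suc n) 0"
    by (simp add: Suc_diff_le)
  thus ?case using Suc by (simp add: sum.distrib ac_simps)
qed simp

lemma matrix_vector_mult_sum_right: "A *v (\<Sum>i\<in>I. x i) = (\<Sum>i\<in>I. A *v x i)" for A :: "real^'n^'m"
  by (induction I rule: infinite_finite_induct) (auto simp: matrix_vector_right_distrib)

lemma matrix_vector_mult_sum_left: "(\<Sum>i\<in>I. A i) *v x = (\<Sum>i\<in>I. A i *v x)" for A :: "'i \<Rightarrow> real^'n^'m"
  by (induction I rule: infinite_finite_induct) (auto simp: matrix_vector_mult_add_rdistrib)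

text \<open>
  The matrices \<open>U\<close> are the coefficients of the formal inverse of \<open>1 - \<Sum> P[0, q] \<epsilon>\<^sup>q\<close>; convolving
  with them solves the linear system order by order.
\<close>

lemma U_mat_solves:
  fixes pc :: "'n::finite \<Rightarrow> 'n \<Rightarrow> nat \<Rightarrow> nat \<Rightarrow> real" and v :: "nat \<Rightarrow> real^'n"
  assumes inj: "\<And>x. (mat 1 - P_mat pc i 0 0) *v x = 0 \<Longrightarrow> x = 0"
  defines "V n \<equiv> (\<Sum>q\<le>n. U_mat pc i q *v v (n - q))"
  shows "V n = v n + (\<Sum>q\<le>n. P_mat pc i 0 q *v V (n - q))"
proof -
  let ?A = "mat 1 - P_mat pc i 0 0" and ?U = "U_mat pc i" and ?P = "P_mat pc i 0"
  \<comment> \<open>Dropping the term of order zero lets all sums start at zero.\<close>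
  define P' where "P' q = (if q = 0 then 0 else ?P q)" for q
  have inv: "?A ** ?U 0 = mat 1" unfolding U_mat.simps by (rule matrix_inv_right[OF inj])
  have AU: "?A ** ?U q = (if q = 0 then mat 1 else 0) + (\<Sum>s\<le>q. P' s ** ?U (q - s))" for q
  proof (cases q)
    case 0
    have "P' 0 ** ?U 0 = 0" by (simp add: P'_def)
    thus ?thesis using 0 inv by simp
  next
    case (Suc m)
    have "?A ** ?U (Suc m) = (\<Sum>s=1..Suc m. ?P s ** ?U (Suc m - s))"
      unfolding U_mat.simps(2) matrix_mul_assoc inv matrix_mul_lid ..
    also have "\<dots> = (\<Sum>s=1..Suc m. P' s ** ?U (Suc m - s))" by (intro sum.cong) (auto simp: P'_def)
    also have "\<dots> = (\<Sum>s\<le>Suc m. P' s ** ?U (Suc m - s))"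
      by (rule sum.mono_neutral_left) (auto simp: P'_def not_less_eq_eq)
    finally show ?thesis using Suc by simp
  qed
  have "?A *v V n = (\<Sum>q\<le>n. (?A ** ?U q) *v v (n - q))"
    by (simp add: V_def matrix_vector_mult_sum_right matrix_vector_mul_assoc)
  also have "\<dots> = (\<Sum>q\<le>n. (if q = 0 then v (n - q) else 0) + (\<Sum>s\<le>q. P' s *v (?U (q - s) *v v (n - s - (q - s)))))"
  proof (intro sum.cong refl)
    fix q assume "q \<in> {..n}"
    have "(\<Sum>s\<le>q. P' s ** ?U (q - s)) *v v (n - q) = (\<Sum>s\<le>q. P' s *v (?U (q - s) *v v (n - s - (q - s))))"
      unfolding matrix_vector_mult_sum_left by (intro sum.cong refl) (simp add: matrix_vector_mul_assoc)
    thus "(?A ** ?U q) *v v (n - q) = (if q = 0 then v (n - q) else 0) + (\<Sum>s\<le>q. P' s *v (?U (q - s) *v v (n - s - (q - s))))"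
      unfolding AU by (simp add: matrix_vector_mult_add_rdistrib)
  qed
  also have "\<dots> = v n + (\<Sum>q\<le>n. \<Sum>s\<le>q. P' s *v (?U (q - s) *v v (n - s - (q - s))))"
    by (simp add: sum.distrib)
  also have "(\<Sum>q\<le>n. \<Sum>s\<le>q. P' s *v (?U (q - s) *v v (n - s - (q - s)))) = (\<Sum>s\<le>n. \<Sum>u\<le>n - s. P' s *v (?U u *v v (n - s - u)))"
    by (rule sum_triangle[where f = "\<lambda>s u. P' s *v (?U u *v v (n - s - u))"])
  also have "\<dots> = (\<Sum>s\<le>n. P' s *v V (n - s))"
    by (simp add: V_def matrix_vector_mult_sum_right)
  finally have "V n = v n + (?P 0 *v V n + (\<Sum>s\<le>n. P' s *v V (n - s)))"
    by (simp add: matrix_vector_mult_diff_rdistrib algebra_simps)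
  also have "?P 0 *v V n + (\<Sum>s\<le>n. P' s *v V (n - s)) = (\<Sum>s\<le>n. ?P s *v V (n - s))"
  proof -
    have "(\<Sum>s\<le>n. P' s *v V (n - s)) = P' 0 *v V n + (\<Sum>s\<in>{..n} - {0}. P' s *v V (n - s))"
      by (subst sum.remove[of _ 0]) auto
    also have "\<dots> = (\<Sum>s\<in>{..n} - {0}. ?P s *v V (n - s))" by (simp add: P'_def)
    finally show ?thesis by (subst (2) sum.remove[of _ 0]) auto
  qed
  finally show ?thesis .
qed

lemma P_mat_mult: "(P_mat pc i r n *v x) $ s = (\<Sum>l\<in>-{i}. pc s l r n * x $ l)" for pc :: "'n::finite \<Rightarrow> _"
proof -
  have "(P_mat pc i r n *v x) $ s = (\<Sum>l\<in>UNIV. (if l = i then 0 else pc s l r n * x $ l))"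
    unfolding matrix_vector_mult_def P_mat_def by (simp, intro sum.cong) auto
  also have "\<dots> = (\<Sum>l\<in>-{i}. (if l = i then 0 else pc s l r n * x $ l))"
    by (rule sum.mono_neutral_right) auto
  finally show ?thesis by simp
qed

lemma exp_moment_nonneg:
  assumes "\<And>n. a n \<ge> 0" "\<And>n. \<bar>a n\<bar> \<le> C * exp (- \<rho>1 * real n)" "\<sigma> < \<rho>1"
  shows "exp_moment r \<sigma> a \<ge> 0"
  unfolding exp_moment_def
  by (rule suminf_nonneg[OF sums_summable[OF exp_moment_sums[OF assms(2,3)]]]) (simp add: moment_seq_def assms(1))

lemma lambda_vec_nth:
  fixes S :: "('n::finite, 'a) smp_family"
  shows "lambda_vec S pc i r n $ s = pc s i r n +
    (\<Sum>m=1..r. real (r choose m) * (\<Sum>l\<in>-{i}. \<Sum>q\<le>n. pc s l m q * Phi_vec S pc i (r - m) (n - q) $ l))"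
proof -
  have "(\<Sum>q=0..n. P_mat pc i m q *v Phi_vec S pc i (r - m) (n - q)) $ s =
      (\<Sum>l\<in>-{i}. \<Sum>q\<le>n. pc s l m q * Phi_vec S pc i (r - m) (n - q) $ l)" for m
    by (simp add: P_mat_mult atLeast0AtMost sum.swap[of _ "{..n}" "-{i}"])
  thus ?thesis by (simp add: p_vec_def del: Phi_vec.simps)
qed

declare lambda_vec.simps [simp del] Phi_vec.simps [simp del]

lemma lambda_vec_0: "lambda_vec S pc i 0 n = p_vec pc i 0 n"
  by (simp add: lambda_vec.simps)

lemma Phi_vec_pos:
  "Phi_vec S pc i r (Suc n) = (\<Sum>q\<le>Suc n. U_mat pc i q *v lambda_vec S pc i r (Suc n - q))"
  by (cases r) (simp_all only: Phi_vec.simps lambda_vec_0 atLeast0AtMost)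

context perturbed_smp
begin

abbreviation (input) kmoment where "kmoment \<epsilon> r s l \<equiv> exp_moment r (char_root S 0) (kmass S \<epsilon> s l)"
abbreviation (input) pmoment where "pmoment i \<epsilon> r s \<equiv> exp_moment r (char_root S 0) (fpass S \<epsilon> s i)"

text \<open>
  The bracket is the quantity whose expansion has the coefficients \<open>\<lambda>\<close>; the term of order zero in the
  transition moments is the one that has to be solved for.
\<close>

lemma first_passage_moment_equation:
  assumes e: "\<epsilon> \<ge> 0" and kb: "kernel_decay \<epsilon>"
    and fb: "passage_decay C \<rho>1 i \<epsilon>" and r: "char_root S 0 < \<rho>1"
  shows "pmoment i \<epsilon> r s = (kmoment \<epsilon> r s i + (\<Sum>m=1..r. real (r choose m) * (\<Sum>l\<in>-{i}. kmoment \<epsilon> m s l * pmoment i \<epsilon> (r - m) l))) +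
     (\<Sum>l\<in>-{i}. kmoment \<epsilon> 0 s l * pmoment i \<epsilon> r l)"
proof -
  interpret fp: first_passage "\<lambda>s l. kmass S \<epsilon> s l" "\<lambda>s i. fpass S \<epsilon> s i" by (rule first_passage_axioms[OF e])
  interpret ft: first_passage "\<lambda>s l. tilt (char_root S 0) (kmass S \<epsilon> s l)" "\<lambda>s i. tilt (char_root S 0) (fpass S \<epsilon> s i)"
    by (rule fp.first_passage_tilt)
  have P: "moment_seq m (tilt (char_root S 0) (kmass S \<epsilon> s l)) sums kmoment \<epsilon> m s l" for m l
    by (rule transition_gf_sums[OF kb char_root_0(1)])
  have F: "moment_seq m (tilt (char_root S 0) (fpass S \<epsilon> l i)) sums pmoment i \<epsilon> m l" for m l
    by (rule exp_moment_sums[of _ C \<rho>1]) (use fb r in auto)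
  have "pmoment i \<epsilon> r s = kmoment \<epsilon> r s i + (\<Sum>m\<le>r. real (r choose m) * (\<Sum>l\<in>-{i}. kmoment \<epsilon> m s l * pmoment i \<epsilon> (r - m) l))"
    by (rule moment_equation[where f = "\<lambda>s. tilt (char_root S 0) (fpass S \<epsilon> s i)" and y = "\<lambda>s. tilt (char_root S 0) (kmass S \<epsilon> s i)",
          OF ft.q_nonneg ft.g_nonneg ft.g_eq P F P])
  also have "(\<Sum>m\<le>r. real (r choose m) * (\<Sum>l\<in>-{i}. kmoment \<epsilon> m s l * pmoment i \<epsilon> (r - m) l)) =
    (\<Sum>l\<in>-{i}. kmoment \<epsilon> 0 s l * pmoment i \<epsilon> r l) + (\<Sum>m=1..r. real (r choose m) * (\<Sum>l\<in>-{i}. kmoment \<epsilon> m s l * pmoment i \<epsilon> (r - m) l))"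
  proof -
    have "{..r} = insert 0 {1..r}" by auto
    thus ?thesis by simp
  qed
  finally show ?thesis by simp
qed

lemma transition_expansion:
  assumes "cond_D S k pc" "r \<le> k"
  shows "pc s l r 0 = kmoment 0 r s l" and "expands (k - r) (\<lambda>\<epsilon>. kmoment \<epsilon> r s l) (pc s l r)"
proof -
  have eq: "enn2real (p_gen S \<epsilon> (Some s) (Some l) (char_root S 0) r) = kmoment \<epsilon> r s l"
    if "kernel_decay \<epsilon>" for \<epsilon>
    by (rule enn2real_p_gen[OF transition_gf_sums[OF that char_root_0(1)]])
  show "pc s l r 0 = kmoment 0 r s l"
    using assms eq[OF kernel_term_bound_0] unfolding cond_D_def by auto
  have ev: "eventually (\<lambda>\<epsilon>. enn2real (p_gen S \<epsilon> (Some s) (Some l) (char_root S 0) r) = kmoment \<epsilon> r s l) (at_right 0)"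
    by (rule eventually_mono[OF filter_leD[OF at_right_le_small_eps kernel_term_bound] eq])
  have ex: "expands (k - r) (\<lambda>\<epsilon>. enn2real (p_gen S \<epsilon> (Some s) (Some l) (char_root S 0) r)) (pc s l r)"
    using assms unfolding cond_D_def expands_def atLeast0AtMost by blast
  show "expands (k - r) (\<lambda>\<epsilon>. kmoment \<epsilon> r s l) (pc s l r)"
    by (rule expands_cong[OF ex ev refl])
qed

text \<open>
  The coefficients solve the system in the sense of formal power series. So the truncated series satisfies
  the equation of the true moments up to a small error, and the remainder solves the same
  linear equation with a small right-hand side. The contraction bound, uniform in \<open>\<epsilon>\<close>, makes the
  remainder small; the perturbed inverse matrices never have to be expanded.
\<close>

lemma first_passage_expansion:
  assumes D: "cond_D S k pc" and rk: "r \<le> k"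
  shows "expands (k - r) (\<lambda>\<epsilon>. pmoment i \<epsilon> r s) (\<lambda>n. Phi_vec S pc i r n $ s)"
proof -
  obtain \<rho>1 w \<theta> C where u: "char_root S 0 < \<rho>1" "\<rho>1 < \<beta>" "\<And>s. w s > 0" "0 \<le> \<theta>" "\<theta> < 1"
    "eventually (\<lambda>\<epsilon>. contracting i \<rho>1 w \<theta> \<epsilon>) small_eps"
    "eventually (\<lambda>\<epsilon>. passage_decay C \<rho>1 i \<epsilon>) small_eps"
    by (rule uniform_control[of i]) blast
  have P_nonneg: "kmoment \<epsilon> 0 s l \<ge> 0" if "kernel_decay \<epsilon>" for \<epsilon> s l
    by (rule exp_moment_nonneg[of _ M \<beta>]) (use that char_root_0(1) in auto)
  have contr: "(\<Sum>l\<in>-{i}. kmoment \<epsilon> 0 s l * w l) \<le> \<theta> * w s"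
    if kb: "kernel_decay \<epsilon>"
      and sup: "contracting i \<rho>1 w \<theta> \<epsilon>" for \<epsilon> s
  proof -
    have "kmoment \<epsilon> 0 s l \<le> exp_moment 0 \<rho>1 (kmass S \<epsilon> s l)" for l
      using exp_moment_increase[of "kmass S \<epsilon> s l" M \<beta> "char_root S 0" \<rho>1 0] kb u(1,2) by auto
    hence "(\<Sum>l\<in>-{i}. kmoment \<epsilon> 0 s l * w l) \<le> (\<Sum>l\<in>-{i}. exp_moment 0 \<rho>1 (kmass S \<epsilon> s l) * w l)"
      by (intro sum_mono mult_right_mono less_imp_le[OF u(3)])
    thus ?thesis using sup by (meson order_trans)
  qed
  have sup0: "contracting i \<rho>1 w \<theta> 0"
    and fb0: "passage_decay C \<rho>1 i 0"
    using u(6,7) unfolding eventually_small_eps by blast+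
  note pc0 = transition_expansion(1)[OF D] and pc = transition_expansion(2)[OF D]
  have Phi_0: "Phi_vec S pc i m 0 $ s = pmoment i 0 m s" for m s
  proof -
    have "moment_seq m (tilt (char_root S 0) (fpass S 0 s i)) sums pmoment i 0 m s"
      by (rule exp_moment_sums[of _ C \<rho>1]) (use fb0 u(1) in auto)
    thus ?thesis by (simp add: Phi_vec.simps Phi0_def enn2real_phi)
  qed
  have inj: "x = 0" if "(mat 1 - P_mat pc i 0 0) *v x = 0" for x
  proof -
    have x: "x $ s = (\<Sum>l\<in>-{i}. kmoment 0 0 s l * x $ l)" for s
    proof -
      have "x = P_mat pc i 0 0 *v x" using that by (simp add: matrix_vector_mult_diff_rdistrib)
      hence "x $ s = (P_mat pc i 0 0 *v x) $ s" by metis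
      thus ?thesis by (simp add: P_mat_mult pc0)
    qed
    have "\<bar>x $ s\<bar> \<le> 0 / (1 - \<theta>) * w s" for s
    proof (rule contraction_bound[where P = "kmoment 0 0" and J = "-{i}" and R = "\<lambda>s. x $ s"])
      show "\<bar>x $ s\<bar> \<le> 0 * w s + (\<Sum>l\<in>-{i}. kmoment 0 0 s l * \<bar>x $ l\<bar>)" for s
        by (subst x) (use P_nonneg[OF kernel_term_bound_0] in \<open>auto intro!: order_trans[OF sum_abs] sum_mono simp: abs_mult\<close>)
    qed (use P_nonneg[OF kernel_term_bound_0] u contr[OF kernel_term_bound_0 sup0] in auto)
    thus "x = 0" by (simp add: vec_eq_iff)
  qed
  have Phi_conv: "Phi_vec S pc i m n = (\<Sum>q\<le>n. U_mat pc i q *v lambda_vec S pc i m (n - q))" if "m \<le> k" for m n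
  proof (cases n)
    case 0
    let ?A = "mat 1 - P_mat pc i 0 0"
    have "?A *v Phi_vec S pc i m 0 = lambda_vec S pc i m 0"
    proof (rule vec_eq_iff[THEN iffD2], rule allI)
      fix s
      have "(?A *v Phi_vec S pc i m 0) $ s = pmoment i 0 m s - (\<Sum>l\<in>-{i}. kmoment 0 0 s l * pmoment i 0 m l)"
        by (simp add: matrix_vector_mult_diff_rdistrib P_mat_mult pc0 Phi_0)
      also have "\<dots> = kmoment 0 m s i + (\<Sum>j=1..m. real (m choose j) * (\<Sum>l\<in>-{i}. kmoment 0 j s l * pmoment i 0 (m - j) l))"
        using first_passage_moment_equation[OF order_refl kernel_term_bound_0 fb0 u(1), of m s] by simp
      also have "\<dots> = lambda_vec S pc i m 0 $ s"
      proof -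
        have "pc s l j 0 = kmoment 0 j s l" if "j \<in> {1..m}" for l j using pc0[of j s l] that \<open>m \<le> k\<close> by simp
        thus ?thesis using pc0[OF \<open>m \<le> k\<close>, of s i] unfolding lambda_vec_nth by (simp add: Phi_0)
      qed
      finally show "(?A *v Phi_vec S pc i m 0) $ s = lambda_vec S pc i m 0 $ s" .
    qed
    moreover have "U_mat pc i 0 ** ?A = mat 1"
      using matrix_inv_right[OF inj] by (simp add: matrix_left_right_inverse)
    hence "Phi_vec S pc i m 0 = U_mat pc i 0 *v (?A *v Phi_vec S pc i m 0)"
      by (simp only: matrix_vector_mul_assoc matrix_vector_mul_lid)
    ultimately show ?thesis using 0 by simp
  next
    case (Suc n') thus ?thesis by (simp only: Phi_vec_pos)
  qed
  have Phi_eq: "Phi_vec S pc i m n $ s = lambda_vec S pc i m n $ s + (\<Sum>l\<in>-{i}. \<Sum>q\<le>n. pc s l 0 q * Phi_vec S pc i m (n - q) $ l)"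
    if "m \<le> k" for m n s
  proof -
    have "Phi_vec S pc i m n = lambda_vec S pc i m n + (\<Sum>q\<le>n. P_mat pc i 0 q *v Phi_vec S pc i m (n - q))"
      using U_mat_solves[OF inj, where v = "lambda_vec S pc i m" and n = n] by (simp only: Phi_conv[OF that])
    hence "Phi_vec S pc i m n $ s = (lambda_vec S pc i m n + (\<Sum>q\<le>n. P_mat pc i 0 q *v Phi_vec S pc i m (n - q))) $ s"
      by metis
    thus ?thesis by (simp add: P_mat_mult sum.swap[of _ "{..n}" "-{i}"])
  qed
  show ?thesis
    using rk
  proof (induction r arbitrary: s rule: less_induct)
    case (less r)
    define K where "K = k - r"
    define \<Lambda> where "\<Lambda> \<epsilon> s = kmoment \<epsilon> r s i + (\<Sum>m=1..r. real (r choose m) * (\<Sum>l\<in>-{i}. kmoment \<epsilon> m s l * pmoment i \<epsilon> (r - m) l))" for \<epsilon> s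
    have lam: "expands K (\<lambda>\<epsilon>. \<Lambda> \<epsilon> s) (\<lambda>n. lambda_vec S pc i r n $ s)" for s
      unfolding \<Lambda>_def lambda_vec_nth
    proof (intro expands_add expands_sum expands_cmult expands_mult)
      show "expands K (\<lambda>\<epsilon>. kmoment \<epsilon> r s i) (pc s i r)" unfolding K_def by (rule pc[OF less.prems])
    next
      fix m l assume m: "m \<in> {1..r}"
      show "expands K (\<lambda>\<epsilon>. kmoment \<epsilon> m s l) (pc s l m)"
        by (rule expands_mono[OF pc]) (use m less.prems in \<open>auto simp: K_def\<close>)
      show "expands K (\<lambda>\<epsilon>. pmoment i \<epsilon> (r - m) l) (\<lambda>n. Phi_vec S pc i (r - m) n $ l)"
        by (rule expands_mono[OF less.IH]) (use m less.prems in \<open>auto simp: K_def\<close>)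
    qed
    define p where "p s \<epsilon> = (\<Sum>n\<le>K. Phi_vec S pc i r n $ s * \<epsilon> ^ n)" for s \<epsilon>
    define R where "R \<epsilon> s = pmoment i \<epsilon> r s - p s \<epsilon>" for \<epsilon> s
    \<comment> \<open>The defect of the truncated series \<open>p\<close> in the first-step equation.\<close>
    define y where "y \<epsilon> s = (\<Lambda> \<epsilon> s + (\<Sum>l\<in>-{i}. kmoment \<epsilon> 0 s l * p l \<epsilon>)) - p s \<epsilon>" for \<epsilon> s
    have ysmall: "(\<lambda>\<epsilon>. y \<epsilon> s) \<in> o[at_right 0](\<lambda>\<epsilon>. \<epsilon> ^ K)" for s
    proof -
      have pe: "expands K (p l) (\<lambda>n. Phi_vec S pc i r n $ l)" for l
        unfolding p_def by (rule expands_polynomial) simp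
      have P0e: "expands K (\<lambda>\<epsilon>. kmoment \<epsilon> 0 s l) (pc s l 0)" for l
        by (rule expands_mono[OF pc]) (auto simp: K_def)
      have "expands K (\<lambda>\<epsilon>. \<Lambda> \<epsilon> s + (\<Sum>l\<in>-{i}. kmoment \<epsilon> 0 s l * p l \<epsilon>))
          (\<lambda>n. lambda_vec S pc i r n $ s + (\<Sum>l\<in>-{i}. \<Sum>q\<le>n. pc s l 0 q * Phi_vec S pc i r (n - q) $ l))"
        by (intro expands_add lam expands_sum expands_mult P0e pe)
      thus ?thesis unfolding Phi_eq[OF less.prems, symmetric] expands_def y_def p_def .
    qed
    define Y where "Y \<epsilon> = (\<Sum>s\<in>UNIV. \<bar>y \<epsilon> s\<bar> / w s)" for \<epsilon>
    have "(\<lambda>\<epsilon>. 1 / w s * \<bar>y \<epsilon> s\<bar>) \<in> o[at_right 0](\<lambda>\<epsilon>. 1 * \<epsilon> ^ K)" for s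
      by (rule landau_o.big_small_mult) (use ysmall in auto)
    hence Ysmall: "Y \<in> o[at_right 0](\<lambda>\<epsilon>. \<epsilon> ^ K)" unfolding Y_def by (intro smallo_sum) simp
    have "eventually (\<lambda>\<epsilon>. \<forall>s. \<bar>R \<epsilon> s\<bar> \<le> Y \<epsilon> / (1 - \<theta>) * w s) small_eps"
      using small_eps_nonneg kernel_term_bound u(6,7)
    proof eventually_elim
      case (elim \<epsilon>)
      have eq: "R \<epsilon> s = y \<epsilon> s + (\<Sum>l\<in>-{i}. kmoment \<epsilon> 0 s l * R \<epsilon> l)" for s
        using first_passage_moment_equation[OF elim(1,2,4) u(1), of r s]
        unfolding R_def y_def \<Lambda>_def by (simp add: right_diff_distrib sum_subtractf)
      show ?case
      proof (rule allI, rule contraction_bound[where P = "kmoment \<epsilon> 0" and J = "-{i}" and R = "R \<epsilon>"])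
        show "Y \<epsilon> \<ge> 0" unfolding Y_def using u(3) by (intro sum_nonneg divide_nonneg_nonneg) (auto intro: less_imp_le)
        fix s
        have "\<bar>y \<epsilon> s\<bar> / w s \<le> Y \<epsilon>" unfolding Y_def
          by (rule member_le_sum) (simp_all add: less_imp_le[OF u(3)])
        hence "\<bar>y \<epsilon> s\<bar> \<le> Y \<epsilon> * w s" using u(3)[of s] by (simp add: field_simps)
        moreover have "\<bar>\<Sum>l\<in>-{i}. kmoment \<epsilon> 0 s l * R \<epsilon> l\<bar> \<le> (\<Sum>l\<in>-{i}. kmoment \<epsilon> 0 s l * \<bar>R \<epsilon> l\<bar>)"
          by (rule order_trans[OF sum_abs]) (use P_nonneg[OF elim(2)] in \<open>simp add: abs_mult\<close>)
        ultimately show "\<bar>R \<epsilon> s\<bar> \<le> Y \<epsilon> * w s + (\<Sum>l\<in>-{i}. kmoment \<epsilon> 0 s l * \<bar>R \<epsilon> l\<bar>)"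
          using eq[of s] by linarith
      qed (use P_nonneg[OF elim(2)] u contr[OF elim(2,3)] in auto)
    qed
    hence ev: "eventually (\<lambda>\<epsilon>. norm (R \<epsilon> s) \<le> norm (w s / (1 - \<theta>) * Y \<epsilon>)) (at_right 0)"
    proof -
      assume "eventually (\<lambda>\<epsilon>. \<forall>s. \<bar>R \<epsilon> s\<bar> \<le> Y \<epsilon> / (1 - \<theta>) * w s) small_eps"
      from filter_leD[OF at_right_le_small_eps this] show ?thesis
        by eventually_elim (metis abs_ge_self mult.commute order_trans real_norm_def times_divide_eq_left times_divide_eq_right)
    qed
    have "(\<lambda>\<epsilon>. w s / (1 - \<theta>) * Y \<epsilon>) \<in> o[at_right 0](\<lambda>\<epsilon>. 1 * \<epsilon> ^ K)"
      by (rule landau_o.big_small_mult[OF _ Ysmall]) simp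
    hence "(\<lambda>\<epsilon>. R \<epsilon> s) \<in> o[at_right 0](\<lambda>\<epsilon>. \<epsilon> ^ K)"
      using landau_o.big_small_trans[OF landau_o.big_mono[OF ev]] by simp
    thus ?case unfolding expands_def R_def p_def K_def .
  qed
qed

end

section \<open>Powers of a polynomial\<close>

lemma finite_compositions:
  assumes "finite A" shows "finite {ns \<in> A \<rightarrow>\<^sub>E (UNIV :: nat set). sum ns A = m}"
proof (rule finite_subset)
  show "{ns \<in> A \<rightarrow>\<^sub>E (UNIV :: nat set). sum ns A = m} \<subseteq> A \<rightarrow>\<^sub>E {..m}"
  proof
    fix ns assume ns: "ns \<in> {ns \<in> A \<rightarrow>\<^sub>E (UNIV :: nat set). sum ns A = m}"
    have "ns a \<le> sum ns A" if "a \<in> A" for a by (rule member_le_sum) (use that assms in auto)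
    thus "ns \<in> A \<rightarrow>\<^sub>E {..m}" using ns by (simp add: PiE_iff)
  qed
  show "finite (A \<rightarrow>\<^sub>E {..m})" using assms by (intro finite_PiE) auto
qed

text \<open>
  The multinomial theorem with the factorials distributed over the factors.
\<close>

lemma multinomial_expansion:
  fixes x :: "'i \<Rightarrow> real"
  assumes "finite A"
  shows "(\<Sum>a\<in>A. x a) ^ m / fact m =
    (\<Sum>ns\<in>{ns \<in> A \<rightarrow>\<^sub>E UNIV. sum ns A = m}. \<Prod>a\<in>A. x a ^ ns a / fact (ns a))"
  using assms
proof (induction A arbitrary: m rule: finite_induct)
  case empty
  have "{ns. ns = (\<lambda>_. undefined) \<and> m = 0} = (if m = 0 then {\<lambda>_. undefined :: nat} else {})" by auto
  thus ?case by (cases m) auto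
next
  case (insert b A)
  let ?N = "\<lambda>A m. {ns \<in> A \<rightarrow>\<^sub>E (UNIV :: nat set). sum ns A = m}"
  let ?t = "\<lambda>A ns. \<Prod>a\<in>A. x a ^ ns a / fact (ns a)"
  have fin: "finite (?N A j)" for j using insert.hyps(1) by (rule finite_compositions)
  have "(\<Sum>a\<in>insert b A. x a) ^ m / fact m = (x b + (\<Sum>a\<in>A. x a)) ^ m / fact m"
    using insert.hyps by simp
  also have "\<dots> = (\<Sum>j\<le>m. real (m choose j) * x b ^ j * (\<Sum>a\<in>A. x a) ^ (m - j) / fact m)"
    by (simp add: binomial_ring sum_divide_distrib)
  also have "\<dots> = (\<Sum>j\<le>m. x b ^ j / fact j * ((\<Sum>a\<in>A. x a) ^ (m - j) / fact (m - j)))"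
  proof (intro sum.cong refl)
    fix j assume "j \<in> {..m}"
    hence "real (m choose j) = fact m / (fact j * fact (m - j))" by (simp add: binomial_fact)
    thus "real (m choose j) * x b ^ j * (\<Sum>a\<in>A. x a) ^ (m - j) / fact m =
        x b ^ j / fact j * ((\<Sum>a\<in>A. x a) ^ (m - j) / fact (m - j))" by simp
  qed
  also have "\<dots> = (\<Sum>j\<le>m. \<Sum>ns\<in>?N A (m - j). x b ^ j / fact j * ?t A ns)"
    unfolding insert.IH by (simp only: sum_distrib_left)
  also have "\<dots> = (\<Sum>(j, ns)\<in>(SIGMA j:{..m}. ?N A (m - j)). x b ^ j / fact j * ?t A ns)"
    by (rule sum.Sigma) (use fin in auto)
  also have "\<dots> = (\<Sum>ns\<in>?N (insert b A) m. ?t (insert b A) ns)"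
  proof (rule sum.reindex_bij_witness[where i = "\<lambda>ns. (ns b, ns(b := undefined))" and j = "\<lambda>(j, ns). ns(b := j)"])
    fix z assume "z \<in> (SIGMA j:{..m}. ?N A (m - j))"
    then obtain j ns where z: "z = (j, ns)" "j \<le> m" "ns \<in> A \<rightarrow>\<^sub>E UNIV" "sum ns A = m - j" by auto
    have "ns b = undefined" using z(3) insert.hyps(2) by (auto simp: PiE_def extensional_def)
    thus "(((case z of (j, ns) \<Rightarrow> ns(b := j)) b), (case z of (j, ns) \<Rightarrow> ns(b := j))(b := undefined)) = z"
      using z(1) by (auto simp: fun_upd_idem)
    have s: "sum (ns(b := j)) A = sum ns A" using insert.hyps(2) by (intro sum.cong) auto
    show "(case z of (j, ns) \<Rightarrow> ns(b := j)) \<in> ?N (insert b A) m"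
      using z insert.hyps s by (auto simp: PiE_def extensional_def)
    have "?t A (ns(b := j)) = ?t A ns" using insert.hyps(2) by (intro prod.cong) auto
    thus "?t (insert b A) (case z of (j, ns) \<Rightarrow> ns(b := j)) = (case z of (j, ns) \<Rightarrow> x b ^ j / fact j * ?t A ns)"
      using z(1) insert.hyps by simp
  next
    fix ns assume ns: "ns \<in> ?N (insert b A) m"
    show "(case (ns b, ns(b := undefined)) of (j, ns) \<Rightarrow> ns(b := j)) = ns" by simp
    have "sum (ns(b := undefined)) A = sum ns A" using insert.hyps(2) by (intro sum.cong) auto
    moreover have "ns b + sum ns A = m" using ns insert.hyps by simp
    ultimately show "(ns b, ns(b := undefined)) \<in> (SIGMA j:{..m}. ?N A (m - j))"
      using ns by (auto simp: PiE_def extensional_def)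
  qed
  finally show ?case .
qed

text \<open>
  The coefficient of \<open>\<epsilon>\<^sup>q\<close> in the \<open>m\<close>-th power, over \<open>m!\<close>, of the polynomial with coefficients
  \<open>c\<^sub>1, \<dots>, c\<^sub>k\<close>. The tuples range over all \<open>k\<close> indices, in contrast to those of \<open>D_set\<close>.
\<close>

definition power_coeff :: "nat \<Rightarrow> (nat \<Rightarrow> real) \<Rightarrow> nat \<Rightarrow> nat \<Rightarrow> real" where
  "power_coeff k c m q =
     (\<Sum>ns\<in>{ns \<in> {1..k} \<rightarrow>\<^sub>E UNIV. sum ns {1..k} = m \<and> (\<Sum>p\<in>{1..k}. p * ns p) = q}.
        \<Prod>p\<in>{1..k}. c p ^ ns p / fact (ns p))"

lemma power_coeff_expansion:
  assumes N: "N \<ge> m * k"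
  shows "(\<Sum>p=1..k. c p * \<epsilon> ^ p) ^ m / fact m = (\<Sum>q\<le>N. power_coeff k c m q * \<epsilon> ^ q)"
proof -
  let ?A = "{1..k}"
  let ?N = "{ns \<in> ?A \<rightarrow>\<^sub>E (UNIV :: nat set). sum ns ?A = m}"
  let ?w = "\<lambda>ns. \<Sum>p\<in>?A. p * ns p"
  have fin: "finite ?N" by (rule finite_compositions) simp
  have wN: "?w ns \<le> N" if "ns \<in> ?N" for ns
  proof -
    have "?w ns \<le> (\<Sum>p\<in>?A. k * ns p)" by (intro sum_mono mult_right_mono) auto
    also have "\<dots> = k * m" using that by (simp add: sum_distrib_left[symmetric])
    finally show ?thesis using N by (simp add: mult.commute)
  qed
  have "(\<Sum>p=1..k. c p * \<epsilon> ^ p) ^ m / fact m = (\<Sum>ns\<in>?N. \<Prod>p\<in>?A. (c p * \<epsilon> ^ p) ^ ns p / fact (ns p))"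
    by (rule multinomial_expansion) simp
  also have "\<dots> = (\<Sum>ns\<in>?N. (\<Prod>p\<in>?A. c p ^ ns p / fact (ns p)) * \<epsilon> ^ ?w ns)"
  proof (intro sum.cong refl)
    fix ns
    have "(\<Prod>p\<in>?A. (c p * \<epsilon> ^ p) ^ ns p / fact (ns p)) = (\<Prod>p\<in>?A. (c p ^ ns p / fact (ns p)) * \<epsilon> ^ (p * ns p))"
      by (intro prod.cong) (auto simp: power_mult_distrib power_mult)
    thus "(\<Prod>p\<in>?A. (c p * \<epsilon> ^ p) ^ ns p / fact (ns p)) = (\<Prod>p\<in>?A. c p ^ ns p / fact (ns p)) * \<epsilon> ^ ?w ns"
      by (simp only: prod.distrib power_sum)
  qed
  also have "\<dots> = (\<Sum>q\<le>N. \<Sum>ns\<in>{ns \<in> ?N. ?w ns = q}. (\<Prod>p\<in>?A. c p ^ ns p / fact (ns p)) * \<epsilon> ^ ?w ns)"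
    by (rule sum.group[symmetric]) (use fin wN in auto)
  also have "\<dots> = (\<Sum>q\<le>N. power_coeff k c m q * \<epsilon> ^ q)"
    unfolding power_coeff_def sum_distrib_right by (intro sum.cong) auto
  finally show ?thesis .
qed

lemma power_coeff_below:
  assumes "q < m" shows "power_coeff k c m q = 0"
proof -
  have "sum ns {1..k} \<le> (\<Sum>p\<in>{1..k}. p * ns p)" for ns :: "nat \<Rightarrow> nat"
    by (rule sum_mono) auto
  hence "{ns \<in> {1..k} \<rightarrow>\<^sub>E UNIV. sum ns {1..k} = m \<and> (\<Sum>p\<in>{1..k}. p * ns p) = q} = {}"
    using assms by (fastforce simp: not_le[symmetric])
  thus ?thesis unfolding power_coeff_def by (simp only: sum.empty)
qed

lemma power_coeff_0: "q \<le> k \<Longrightarrow> power_coeff k c 0 q = (if q = 0 then 1 else 0)"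
proof -
  assume q: "q \<le> k"
  have "expands k (\<lambda>_. 1) (power_coeff k c 0)"
    using expands_polynomial[of k k "power_coeff k c 0"] power_coeff_expansion[of 0 k k c, symmetric] by simp
  moreover have "expands k (\<lambda>_. 1) (\<lambda>q. if q = 0 then 1 else 0)"
    unfolding expands_def by (simp add: if_distrib[of "\<lambda>x. x * _"] cong: if_cong)
  ultimately show ?thesis using expands_unique q by blast
qed

lemma power_coeff_1: "q \<le> k \<Longrightarrow> power_coeff k c 1 q = (if q = 0 then 0 else c q)"
proof -
  assume q: "q \<le> k"
  have "expands k (\<lambda>\<epsilon>. \<Sum>p=1..k. c p * \<epsilon> ^ p) (power_coeff k c 1)"
    using expands_polynomial[of k k "power_coeff k c 1"] power_coeff_expansion[of 1 k k c, symmetric] by simp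
  moreover have "(\<Sum>q\<le>k. (if q = 0 then 0 else c q) * \<epsilon> ^ q) = (\<Sum>p=1..k. c p * \<epsilon> ^ p)" for \<epsilon> :: real
  proof -
    have "{..k} = insert 0 {1..k}" by auto
    thus ?thesis by simp
  qed
  hence "expands k (\<lambda>\<epsilon>. \<Sum>p=1..k. c p * \<epsilon> ^ p) (\<lambda>q. if q = 0 then 0 else c q)"
    unfolding expands_def by simp
  ultimately show ?thesis using expands_unique q by blast
qed

text \<open>
  For \<open>m \<ge> 2\<close> a tuple of weight \<open>q\<close> has no entries at indices \<open>p \<ge> q\<close>: such an entry would use up
  the whole weight, and a further entry would exceed it. Restriction to the indices below \<open>q\<close> is therefore a
  bijection.
\<close>

lemma power_coeff_D_set:
  assumes "2 \<le> m" "q \<le> k"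
  shows "power_coeff k c m q = (\<Sum>ns\<in>D_set m q. \<Prod>p=1..q-1. c p ^ ns p / fact (ns p))"
proof -
  let ?E = "{ns \<in> {1..k} \<rightarrow>\<^sub>E (UNIV :: nat set). sum ns {1..k} = m \<and> (\<Sum>p\<in>{1..k}. p * ns p) = q}"
  let ?ext = "\<lambda>ns p. if p \<in> {1..<q} then ns p else if p \<in> {1..k} then 0 else undefined :: nat"
  have sub: "{1..<q} \<subseteq> {1..k}" using assms(2) by auto
  have iv: "{1..q - 1} = {1..<q}" by auto
  have zero: "ns p = 0" if ns: "ns \<in> ?E" and p: "p \<in> {1..k}" "q \<le> p" for ns p
  proof (rule ccontr)
    assume "ns p \<noteq> 0"
    have tot: "p * ns p + (\<Sum>r\<in>{1..k} - {p}. r * ns r) = q" "ns p + sum ns ({1..k} - {p}) = m"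
      using ns p(1) by (auto simp: sum.remove)
    have le: "sum ns ({1..k} - {p}) \<le> (\<Sum>r\<in>{1..k} - {p}. r * ns r)" by (rule sum_mono) auto
    show False
    proof (cases "ns p = 1")
      case True
      thus False using tot le p(2) assms(1) by simp
    next
      case False
      hence "2 * p \<le> p * ns p" using \<open>ns p \<noteq> 0\<close> by (cases "ns p") auto
      moreover have "p * ns p \<le> q" "p \<ge> 1" using tot(1) p(1) by auto
      ultimately show False using p(2) by linarith
    qed
  qed
  have sums: "sum (f ns) {1..k} = sum (f ns) {1..<q}" if "ns \<in> ?E" "\<And>p. ns p = 0 \<Longrightarrow> f ns p = 0" for ns and f :: "_ \<Rightarrow> _ \<Rightarrow> nat"
    by (rule sum.mono_neutral_right) (use sub zero[OF that(1)] that(2) in auto)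
  show ?thesis
    unfolding power_coeff_def iv
  proof (rule sum.reindex_bij_witness[where i = ?ext and j = "\<lambda>ns. restrict ns {1..<q}"])
    fix ns assume ns: "ns \<in> ?E"
    show "?ext (restrict ns {1..<q}) = ns"
    proof
      fix p show "?ext (restrict ns {1..<q}) p = ns p"
        using zero[OF ns, of p] ns by (auto simp: PiE_def extensional_def)
    qed
    have "sum (restrict ns {1..<q}) {1..<q} = sum ns {1..<q}" by (intro sum.cong) auto
    also have "\<dots> = m" using sums[OF ns, of "\<lambda>ns. ns"] ns by simp
    finally have 1: "sum (restrict ns {1..<q}) {1..<q} = m" .
    have "(\<Sum>p\<in>{1..<q}. p * restrict ns {1..<q} p) = (\<Sum>p\<in>{1..<q}. p * ns p)" by (intro sum.cong) auto
    also have "\<dots> = q" using sums[OF ns, of "\<lambda>ns p. p * ns p"] ns by simp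
    finally have "(\<Sum>p\<in>{1..<q}. p * restrict ns {1..<q} p) = q" .
    with 1 show "restrict ns {1..<q} \<in> D_set m q" unfolding D_set_def by simp
    show "(\<Prod>p\<in>{1..<q}. c p ^ restrict ns {1..<q} p / fact (restrict ns {1..<q} p)) = (\<Prod>p\<in>{1..k}. c p ^ ns p / fact (ns p))"
    proof -
      have "(\<Prod>p\<in>{1..k}. c p ^ ns p / fact (ns p)) = (\<Prod>p\<in>{1..<q}. c p ^ ns p / fact (ns p))"
        by (rule prod.mono_neutral_right) (use sub zero[OF ns] in auto)
      also have "\<dots> = (\<Prod>p\<in>{1..<q}. c p ^ restrict ns {1..<q} p / fact (restrict ns {1..<q} p))"
        by (intro prod.cong) auto
      finally show ?thesis by simp
    qed
  next
    fix ns assume ns: "ns \<in> D_set m q"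
    show "restrict (?ext ns) {1..<q} = ns"
    proof
      fix p show "restrict (?ext ns) {1..<q} p = ns p"
        using ns unfolding D_set_def by (auto simp: PiE_def extensional_def)
    qed
    have D: "sum ns {1..<q} = m" "(\<Sum>p\<in>{1..<q}. p * ns p) = q" using ns unfolding D_set_def by blast+
    have "sum (?ext ns) {1..k} = sum ns {1..<q}"
      by (rule sum.mono_neutral_cong_right) (use sub in auto)
    hence 1: "sum (?ext ns) {1..k} = m" using D(1) by (rule trans)
    have "(\<Sum>p\<in>{1..k}. p * ?ext ns p) = (\<Sum>p\<in>{1..<q}. p * ns p)"
      by (rule sum.mono_neutral_cong_right) (use sub in auto)
    hence 2: "(\<Sum>p\<in>{1..k}. p * ?ext ns p) = q" using D(2) by (rule trans)
    have 3: "?ext ns \<in> {1..k} \<rightarrow>\<^sub>E UNIV"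
    proof (rule PiE_I)
      fix p assume "p \<notin> {1..k}"
      hence "p \<notin> {1..<q}" using sub by blast
      thus "?ext ns p = undefined" using \<open>p \<notin> {1..k}\<close> by (simp only: if_False)
    qed simp
    show "?ext ns \<in> ?E" by (intro CollectI conjI 1 2 3)
  qed
qed

section \<open>Expansion of the characteristic root\<close>

lemmas [fundef_cong] = prod.cong

text \<open>
  A function of the array \<open>b\<close> alone: every state has its own array, and the resulting sequences are compared
  only afterwards, by uniqueness of the expansion of the common root.
\<close>

function root_coeff :: "(nat \<Rightarrow> nat \<Rightarrow> real) \<Rightarrow> nat \<Rightarrow> real" where
  "root_coeff b n = (if n = 0 then 0 else - (1 / b 1 0) *
     (b 0 n + (\<Sum>q=1..n-1. b 1 (n - q) * root_coeff b q)
      + (\<Sum>m=2..n. \<Sum>q=m..n. b m (n - q) *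
           (\<Sum>ns\<in>D_set m q. \<Prod>p=1..q-1. root_coeff b p ^ ns p / fact (ns p)))))"
  by pat_completeness auto
termination by (relation "Wellfounded.measure snd") auto

declare root_coeff.simps [simp del]

lemma sum_reflect:
  fixes f :: "nat \<Rightarrow> nat \<Rightarrow> real"
  assumes "r \<le> n" shows "(\<Sum>q\<le>n - r. f q (n - q)) = (\<Sum>q=r..n. f (n - q) q)"
  by (rule sum.reindex_bij_witness[where i = "\<lambda>q. n - q" and j = "\<lambda>q. n - q"]) (use assms in auto)

text \<open>
  The recursion solves the equation \<open>\<Sum>\<^sub>r \<phi>\<^sub>r(\<epsilon>) P(\<epsilon>)\<^sup>r / r! = 1\<close> order by order for a polynomial \<open>P\<close>
  without constant term. As \<open>P(\<epsilon>)\<^sup>r\<close> is divisible by \<open>\<epsilon>\<^sup>r\<close>, expansions of \<open>\<phi>\<^sub>r\<close> to order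
  \<open>k - r\<close> are enough.
\<close>

lemma root_polynomial_solves:
  assumes k: "k \<ge> 1" and phi: "\<And>r. r \<le> k \<Longrightarrow> expands (k - r) (\<phi> r) (b r)"
    and b: "b 0 0 = 1" "b 1 0 \<noteq> 0"
  shows "expands k (\<lambda>\<epsilon>. \<Sum>r\<le>k. \<phi> r \<epsilon> * ((\<Sum>p=1..k. root_coeff b p * \<epsilon> ^ p) ^ r / fact r))
    (\<lambda>n. if n = 0 then 1 else 0)"
proof -
  let ?c = "root_coeff b"
  let ?d = "power_coeff k ?c"
  have term_exp: "expands k (\<lambda>\<epsilon>. \<phi> r \<epsilon> * ((\<Sum>p=1..k. ?c p * \<epsilon> ^ p) ^ r / fact r))
      (\<lambda>n. if n < r then 0 else \<Sum>q\<le>n - r. b r q * ?d r (n - q))" if r: "r \<le> k" for r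
  proof -
    \<comment> \<open>The degree of the power is at most \<open>r * k\<close>; the extra \<open>k\<close> gives \<open>k - r \<le> N - r\<close> also for \<open>r = 0\<close>.\<close>
    define N where "N = r * k + k"
    have Nr: "N \<ge> r" "k - r \<le> N - r" using r by (auto simp: N_def)
    have pw: "(\<Sum>p=1..k. ?c p * \<epsilon> ^ p) ^ r / fact r = \<epsilon> ^ r * (\<Sum>u\<le>N - r. ?d r (u + r) * \<epsilon> ^ u)" for \<epsilon>
    proof -
      have "(\<Sum>p=1..k. ?c p * \<epsilon> ^ p) ^ r / fact r = (\<Sum>q\<le>N. ?d r q * \<epsilon> ^ q)"
        by (rule power_coeff_expansion) (simp add: N_def)
      also have "\<dots> = (\<Sum>q\<in>(\<lambda>u. u + r) ` {..N - r}. ?d r q * \<epsilon> ^ q)"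
      proof (rule sum.mono_neutral_right)
        show "\<forall>q\<in>{..N} - (\<lambda>u. u + r) ` {..N - r}. ?d r q * \<epsilon> ^ q = 0"
        proof
          fix q assume q: "q \<in> {..N} - (\<lambda>u. u + r) ` {..N - r}"
          have "q < r"
          proof (rule ccontr)
            assume "\<not> q < r"
            hence "q = (q - r) + r" "q - r \<le> N - r" using q by auto
            thus False using q by blast
          qed
          thus "?d r q * \<epsilon> ^ q = 0" by (simp add: power_coeff_below)
        qed
      qed (use Nr in auto)
      also have "\<dots> = \<epsilon> ^ r * (\<Sum>u\<le>N - r. ?d r (u + r) * \<epsilon> ^ u)"
        by (subst sum.reindex) (auto simp: sum_distrib_left power_add mult_ac)
      finally show ?thesis .
    qed
    have "expands (k - r) (\<lambda>\<epsilon>. \<phi> r \<epsilon> * (\<Sum>u\<le>N - r. ?d r (u + r) * \<epsilon> ^ u)) (\<lambda>n. \<Sum>q\<le>n. b r q * ?d r (n - q + r))"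
      by (intro expands_mult phi r expands_polynomial Nr)
    from expands_shift[OF this, of r]
    have shifted: "expands k (\<lambda>\<epsilon>. \<epsilon> ^ r * (\<phi> r \<epsilon> * (\<Sum>u\<le>N - r. ?d r (u + r) * \<epsilon> ^ u)))
        (\<lambda>n. if n < r then 0 else \<Sum>q\<le>n - r. b r q * ?d r (n - r - q + r))"
      by (simp only: le_add_diff_inverse2[OF r])
    show ?thesis
    proof (rule expands_cong[OF shifted])
      show "eventually (\<lambda>\<epsilon>. \<epsilon> ^ r * (\<phi> r \<epsilon> * (\<Sum>u\<le>N - r. ?d r (u + r) * \<epsilon> ^ u)) =
        \<phi> r \<epsilon> * ((\<Sum>p=1..k. ?c p * \<epsilon> ^ p) ^ r / fact r)) (at_right 0)"
        unfolding pw by (simp add: mult_ac)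
      show "(if n < r then 0 else \<Sum>q\<le>n - r. b r q * ?d r (n - r - q + r)) = (if n < r then 0 else \<Sum>q\<le>n - r. b r q * ?d r (n - q))" for n
        by (auto intro!: sum.cong arg_cong2[where f = "(*)"] arg_cong[where f = "?d r"])
    qed
  qed
  have coeff: "(\<Sum>r\<le>k. if n < r then 0 else \<Sum>q\<le>n - r. b r q * ?d r (n - q)) = (if n = 0 then 1 else 0)" if n: "n \<le> k" for n
  proof -
    let ?g = "\<lambda>r. \<Sum>q=r..n. b r (n - q) * ?d r q"
    have "(\<Sum>r\<le>k. if n < r then 0 else \<Sum>q\<le>n - r. b r q * ?d r (n - q)) = (\<Sum>r\<le>n. \<Sum>q\<le>n - r. b r q * ?d r (n - q))"
      by (rule sum.mono_neutral_cong_right) (use n in auto)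
    also have "\<dots> = (\<Sum>r\<le>n. ?g r)"
      by (intro sum.cong refl sum_reflect[where f = "\<lambda>q q'. b _ q * ?d _ q'"]) simp
    finally have 1: "(\<Sum>r\<le>k. if n < r then 0 else \<Sum>q\<le>n - r. b r q * ?d r (n - q)) = (\<Sum>r\<le>n. ?g r)" .
    show ?thesis
    proof (cases "n = 0")
      case True
      thus ?thesis using 1 b(1) power_coeff_0[of 0 k ?c] by simp
    next
      case False
      have "{..n} = insert 0 (insert 1 {2..n})" using False by auto
      hence "(\<Sum>r\<le>n. ?g r) = ?g 0 + (?g 1 + (\<Sum>r=2..n. ?g r))" by simp
      moreover have "?g 0 = b 0 n"
      proof -
        have "?g 0 = (\<Sum>q\<in>{0..n}. if q = 0 then b 0 n else 0)"
          using n by (intro sum.cong refl) (auto simp: power_coeff_0)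
        thus ?thesis by simp
      qed
      moreover have "?g 1 = (\<Sum>q=1..n-1. b 1 (n - q) * ?c q) + b 1 0 * ?c n"
      proof -
        have "?g 1 = (\<Sum>q=1..n. b 1 (n - q) * ?c q)"
          using n by (intro sum.cong refl) (auto simp: power_coeff_1[unfolded One_nat_def])
        also have "\<dots> = (\<Sum>q\<in>insert n {1..n-1}. b 1 (n - q) * ?c q)"
          using False by (intro sum.cong) auto
        also have "\<dots> = (\<Sum>q=1..n-1. b 1 (n - q) * ?c q) + b 1 0 * ?c n"
          using False by (subst sum.insert) auto
        finally show ?thesis .
      qed
      moreover have "(\<Sum>r=2..n. ?g r) = (\<Sum>m=2..n. \<Sum>q=m..n. b m (n - q) *
           (\<Sum>ns\<in>D_set m q. \<Prod>p=1..q-1. ?c p ^ ns p / fact (ns p)))"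
        using n by (intro sum.cong refl) (auto simp: power_coeff_D_set)
      moreover have "b 1 0 * ?c n = - (b 0 n + (\<Sum>q=1..n-1. b 1 (n - q) * ?c q) + (\<Sum>m=2..n. \<Sum>q=m..n. b m (n - q) *
           (\<Sum>ns\<in>D_set m q. \<Prod>p=1..q-1. ?c p ^ ns p / fact (ns p))))"
        by (subst root_coeff.simps) (use False b(2) in simp)
      ultimately show ?thesis using 1 False by simp
    qed
  qed
  have "expands k (\<lambda>\<epsilon>. \<Sum>r\<le>k. \<phi> r \<epsilon> * ((\<Sum>p=1..k. ?c p * \<epsilon> ^ p) ^ r / fact r))
     (\<lambda>n. \<Sum>r\<le>k. if n < r then 0 else \<Sum>q\<le>n - r. b r q * ?d r (n - q))"
    by (intro expands_sum term_exp) simp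
  thus ?thesis by (rule expands_cong) (use coeff in auto)
qed

context perturbed_smp
begin

lemma b_coeff_0:
  "b_coeff S pc i r 0 = pmoment i 0 r i" "b_coeff S pc i 0 0 = 1" "b_coeff S pc i 1 0 > 0"
proof -
  obtain \<rho>1 w \<theta> C where u: "char_root S 0 < \<rho>1" "\<rho>1 < \<beta>"
    "eventually (\<lambda>\<epsilon>. passage_decay C \<rho>1 i \<epsilon>) small_eps"
    by (rule uniform_control[of i]) blast
  have fb0: "\<bar>fpass S 0 s i n\<bar> \<le> C * exp (- \<rho>1 * real n)" for s n
    using u(3) unfolding eventually_small_eps by blast
  have F: "moment_seq r (tilt (char_root S 0) (fpass S 0 s i)) sums pmoment i 0 r s" for r s
    by (rule exp_moment_sums[OF fb0 u(1)])
  show b: "b_coeff S pc i r 0 = pmoment i 0 r i" for r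
    using enn2real_phi[OF F] by (simp add: b_coeff_def Phi_vec.simps Phi0_def)
  show "b_coeff S pc i 0 0 = 1"
    unfolding b using sums_unique2[OF F[of 0 i], of 1] char_root_0(2)[of i] by simp
  interpret fp: first_passage "\<lambda>s l. kmass S 0 s l" "\<lambda>s i. fpass S 0 s i" by (rule first_passage_axioms) simp
  obtain m where m: "fpass S 0 i i m > 0" using irreducible_0 by blast
  have "m \<noteq> 0" using m fp.g_0[of i i] by (metis less_irrefl)
  have "0 < (\<Sum>n. moment_seq 1 (tilt (char_root S 0) (fpass S 0 i i)) n)"
  proof (rule suminf_pos2[OF sums_summable[OF F]])
    show "0 \<le> moment_seq 1 (tilt (char_root S 0) (fpass S 0 i i)) n" for n
      by (simp add: moment_seq_def g_time_nonneg)
    show "0 < moment_seq 1 (tilt (char_root S 0) (fpass S 0 i i)) m"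
      using m \<open>m \<noteq> 0\<close> by (simp add: moment_seq_def)
  qed
  thus "b_coeff S pc i 1 0 > 0" unfolding b exp_moment_def .
qed

text \<open>
  The polynomial \<open>\<rho>\<^sup>(\<^sup>0\<^sup>) + P(\<epsilon>)\<close> solves the characteristic equation up to an error \<open>o(\<epsilon>\<^sup>k)\<close>, by
  the Taylor formula and the choice of the coefficients. The generating function increases with a slope
  bounded away from zero uniformly in \<open>\<epsilon>\<close>, so an approximate root is close to the true one, with an
  error of the same order.
\<close>

lemma char_root_expansion:
  fixes i :: 'n
  assumes k: "k \<ge> 1" and D: "cond_D S k pc"
  defines "c \<equiv> root_coeff (b_coeff S pc i)"
  shows "(\<lambda>\<epsilon>. char_root S \<epsilon> - (char_root S 0 + (\<Sum>n=1..k. c n * \<epsilon> ^ n))) \<in> o[at_right 0](\<lambda>\<epsilon>. \<epsilon> ^ k)"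
proof -
  obtain \<rho>1 w \<theta> C where u: "char_root S 0 < \<rho>1" "\<rho>1 < \<beta>"
    "eventually (\<lambda>\<epsilon>. passage_decay C \<rho>1 i \<epsilon>) small_eps"
    by (rule uniform_control[of i]) blast
  define \<rho>0 where "\<rho>0 = char_root S 0"
  note u = u[folded \<rho>0_def]
  define p where "p \<epsilon> = (\<Sum>n=1..k. c n * \<epsilon> ^ n)" for \<epsilon>
  define a where "a \<epsilon> = fpass S \<epsilon> i i" for \<epsilon>
  define T where "T \<epsilon> = (\<Sum>r\<le>k. exp_moment r \<rho>0 (a \<epsilon>) * (p \<epsilon> ^ r / fact r))" for \<epsilon>
  define G where "G \<epsilon> = exp_moment 0 (\<rho>0 + p \<epsilon>) (a \<epsilon>)" for \<epsilon>
  have ab: "eventually (\<lambda>\<epsilon>. \<forall>n. \<bar>a \<epsilon> n\<bar> \<le> C * exp (- \<rho>1 * real n)) (at_right 0)"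
    using filter_leD[OF at_right_le_small_eps u(3)] by eventually_elim (simp add: a_def)
  have b0: "b_coeff S pc i 1 0 \<noteq> 0" using b_coeff_0(3)[of pc i] by simp
  have phi: "expands (k - r) (\<lambda>\<epsilon>. exp_moment r \<rho>0 (a \<epsilon>)) (b_coeff S pc i r)" if "r \<le> k" for r
    unfolding a_def b_coeff_def \<rho>0_def by (rule first_passage_expansion[OF D that])
  have Texp: "expands k T (\<lambda>n. if n = 0 then 1 else 0)"
    unfolding T_def p_def c_def by (rule root_polynomial_solves[OF k phi b_coeff_0(2) b0])
  moreover have "(\<Sum>n\<le>k. (if n = 0 then 1 else 0) * \<epsilon> ^ n) = 1" for \<epsilon> :: real
    by (simp add: if_distrib[of "\<lambda>x. x * _"] cong: if_cong)
  ultimately have T1: "(\<lambda>\<epsilon>. T \<epsilon> - 1) \<in> o[at_right 0](\<lambda>\<epsilon>. \<epsilon> ^ k)" unfolding expands_def by simp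
  have plim: "(p \<longlongrightarrow> 0) (at_right 0)"
  proof -
    have "(p \<longlongrightarrow> (\<Sum>n=1..k. c n * 0 ^ n)) (at_right 0)" unfolding p_def by (intro tendsto_intros)
    thus ?thesis by (simp add: power_0_left)
  qed
  define \<delta> where "\<delta> = (\<rho>1 - \<rho>0) / 2"
  have d: "\<delta> > 0" "\<rho>0 + \<delta> < \<rho>1" using u(1) by (simp_all add: \<delta>_def field_simps)
  have psmall: "eventually (\<lambda>\<epsilon>. \<bar>p \<epsilon>\<bar> \<le> \<delta>) (at_right 0)"
    using tendstoD[OF plim d(1)] by eventually_elim (simp add: dist_real_def)
  have pO: "p \<in> O[at_right 0](\<lambda>\<epsilon>. \<epsilon>)"
    unfolding p_def
  proof (intro big_sum_in_bigo)
    fix n assume "n \<in> {1..k}"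
    hence "(\<lambda>\<epsilon>. \<epsilon> ^ n) \<in> O[at_right 0](\<lambda>\<epsilon>::real. \<epsilon> ^ 1)" by (intro power_bigo) simp
    thus "(\<lambda>\<epsilon>. c n * \<epsilon> ^ n) \<in> O[at_right 0](\<lambda>\<epsilon>. \<epsilon>)" by simp
  qed
  define KT where "KT = C / fact k * (\<Sum>n. real n ^ Suc k * exp (- (\<rho>1 - (\<rho>0 + \<delta>)) * real n))"
  have "eventually (\<lambda>\<epsilon>. norm (G \<epsilon> - T \<epsilon>) \<le> norm (KT * p \<epsilon> ^ Suc k)) (at_right 0)"
    using ab psmall
  proof eventually_elim
    case (elim \<epsilon>)
    have "\<bar>G \<epsilon> - T \<epsilon>\<bar> \<le> KT * \<bar>p \<epsilon>\<bar> ^ Suc k"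
      unfolding G_def T_def KT_def by (rule exp_moment_taylor) (use elim d in auto)
    also have "\<dots> \<le> \<bar>KT * p \<epsilon> ^ Suc k\<bar>"
      by (simp add: abs_mult power_abs mult_right_mono)
    finally show ?case by simp
  qed
  hence "(\<lambda>\<epsilon>. G \<epsilon> - T \<epsilon>) \<in> O[at_right 0](\<lambda>\<epsilon>. KT * p \<epsilon> ^ Suc k)" by (rule landau_o.big_mono)
  also have "(\<lambda>\<epsilon>. KT * p \<epsilon> ^ Suc k) \<in> O[at_right 0](\<lambda>\<epsilon>. \<epsilon> ^ Suc k)"
    using landau_o.big_power[OF pO, of "Suc k"] by simp
  also have "(\<lambda>\<epsilon>::real. \<epsilon> ^ Suc k) \<in> o[at_right 0](\<lambda>\<epsilon>. \<epsilon> ^ k)" by (rule power_smallo) simp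
  finally have GT: "(\<lambda>\<epsilon>. G \<epsilon> - T \<epsilon>) \<in> o[at_right 0](\<lambda>\<epsilon>. \<epsilon> ^ k)" .
  have G1: "(\<lambda>\<epsilon>. G \<epsilon> - 1) \<in> o[at_right 0](\<lambda>\<epsilon>. \<epsilon> ^ k)"
    using sum_in_smallo(1)[OF GT T1] by simp
  interpret fp: first_passage "\<lambda>s l. kmass S 0 s l" "\<lambda>s i. fpass S 0 s i" by (rule first_passage_axioms) simp
  obtain m where m: "a 0 m > 0" unfolding a_def using irreducible_0 by blast
  have "m \<noteq> 0" using m fp.g_0[of i i] unfolding a_def by (metis less_irrefl)
  \<comment> \<open>A lower bound for the slope near the root, from the single term \<open>m\<close>.\<close>
  define \<mu> where "\<mu> = real m * exp ((\<rho>0 - \<delta>) * real m) * (a 0 m / 2)"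
  have mu: "\<mu> > 0" using m \<open>m \<noteq> 0\<close> by (simp add: \<mu>_def)
  have am: "eventually (\<lambda>\<epsilon>. a 0 m / 2 < a \<epsilon> m) (at_right 0)"
    unfolding a_def
    by (rule filter_leD[OF at_right_le_small_eps order_tendstoD(1)[OF fpass_tendsto]]) (use m in \<open>simp add: a_def\<close>)
  have rsmall: "eventually (\<lambda>\<epsilon>. \<bar>char_root S \<epsilon> - \<rho>0\<bar> \<le> \<delta>) (at_right 0)"
    using filter_leD[OF at_right_le_small_eps tendstoD[OF char_root_tendsto d(1)]]
    by eventually_elim (simp add: dist_real_def \<rho>0_def)
  have root: "eventually (\<lambda>\<epsilon>. exp_moment 0 (char_root S \<epsilon>) (a \<epsilon>) = 1) (at_right 0)"
    using filter_leD[OF at_right_le_small_eps char_root_small_eps]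
  proof eventually_elim
    case (elim \<epsilon>)
    have "tilt (char_root S \<epsilon>) (a \<epsilon>) sums 1" unfolding a_def using elim by blast
    from sums_unique[OF this] show ?case by (simp add: exp_moment_def)
  qed
  have "eventually (\<lambda>\<epsilon>. norm (char_root S \<epsilon> - (\<rho>0 + p \<epsilon>)) \<le> norm (1 / \<mu> * (G \<epsilon> - 1))) (at_right 0)"
    using ab psmall am rsmall root
  proof eventually_elim
    case (elim \<epsilon>)
    have nn: "a \<epsilon> n \<ge> 0" for n by (simp add: a_def g_time_nonneg)
    have gap: "\<mu> * (x - y) \<le> exp_moment 0 x (a \<epsilon>) - exp_moment 0 y (a \<epsilon>)"
      if "y \<le> x" "\<bar>x - \<rho>0\<bar> \<le> \<delta>" "\<bar>y - \<rho>0\<bar> \<le> \<delta>" for x y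
    proof -
      have "exp ((\<rho>0 - \<delta>) * real m) \<le> exp (y * real m)" using that(3) by (auto intro!: mult_right_mono)
      hence "\<mu> \<le> real m * exp (y * real m) * a \<epsilon> m"
        unfolding \<mu>_def using elim(3) m by (intro mult_mono) auto
      hence "\<mu> * (x - y) \<le> (x - y) * (real m * exp (y * real m) * a \<epsilon> m)"
        using that(1) by (subst mult.commute) (intro mult_left_mono, auto)
      also have "\<dots> \<le> exp_moment 0 x (a \<epsilon>) - exp_moment 0 y (a \<epsilon>)"
        by (rule exp_moment_increase[of _ C \<rho>1]) (use elim(1) nn that d in auto)
      finally show ?thesis .
    qed
    have "\<mu> * \<bar>char_root S \<epsilon> - (\<rho>0 + p \<epsilon>)\<bar> \<le> \<bar>G \<epsilon> - 1\<bar>"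
    proof (cases "\<rho>0 + p \<epsilon> \<le> char_root S \<epsilon>")
      case True
      have "\<mu> * (char_root S \<epsilon> - (\<rho>0 + p \<epsilon>)) \<le> 1 - G \<epsilon>"
        using gap[OF True elim(4)] elim(2,5) unfolding G_def by simp
      thus ?thesis using True by simp
    next
      case False
      have "\<mu> * ((\<rho>0 + p \<epsilon>) - char_root S \<epsilon>) \<le> G \<epsilon> - 1"
        using gap[of "char_root S \<epsilon>" "\<rho>0 + p \<epsilon>"] False elim(2,4,5) unfolding G_def by simp
      thus ?thesis using False by (simp add: abs_if split: if_splits)
    qed
    thus ?case using mu by (simp add: abs_mult field_simps)
  qed
  hence "(\<lambda>\<epsilon>. char_root S \<epsilon> - (\<rho>0 + p \<epsilon>)) \<in> O[at_right 0](\<lambda>\<epsilon>. 1 / \<mu> * (G \<epsilon> - 1))" by (rule landau_o.big_mono)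
  also have "(\<lambda>\<epsilon>. 1 / \<mu> * (G \<epsilon> - 1)) \<in> o[at_right 0](\<lambda>\<epsilon>. 1 * \<epsilon> ^ k)"
    by (rule landau_o.big_small_mult[OF _ G1]) simp
  finally show ?thesis unfolding \<rho>0_def p_def by simp
qed

end

lemma expands_constant_term:
  "(\<lambda>\<epsilon>. f \<epsilon> - (f0 + (\<Sum>n=1..k. c n * \<epsilon> ^ n))) \<in> o[at_right 0](\<lambda>\<epsilon>. \<epsilon> ^ k) \<longleftrightarrow>
    expands k f (\<lambda>n. if n = 0 then f0 else c n)"
proof -
  have "{..k} = insert 0 {1..k}" by auto
  hence "(\<Sum>n\<le>k. (if n = 0 then f0 else c n) * \<epsilon> ^ n) = f0 + (\<Sum>n=1..k. c n * \<epsilon> ^ n)" for \<epsilon> :: real by simp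
  thus ?thesis unfolding expands_def by simp
qed

text \<open>
  The first term of the expansion that is left out is \<open>c\<^sub>r \<epsilon>\<^sup>r\<close>, exactly the order at which multiplication
  by the time has a finite limit.
\<close>

lemma expansion_times_time:
  fixes T :: "real \<Rightarrow> nat"
  assumes f: "expands k f (\<lambda>n. if n = 0 then f0 else c n)" and r: "1 \<le> r" "r \<le> k"
    and T: "((\<lambda>\<epsilon>. \<epsilon> ^ r * real (T \<epsilon>)) \<longlongrightarrow> l) (at_right 0)"
  shows "((\<lambda>\<epsilon>. (f \<epsilon> - (f0 + (\<Sum>n=1..r-1. c n * \<epsilon> ^ n))) * real (T \<epsilon>)) \<longlongrightarrow> c r * l) (at_right 0)"
proof -
  have "(\<lambda>\<epsilon>. f \<epsilon> - (f0 + (\<Sum>n=1..r. c n * \<epsilon> ^ n))) \<in> o[at_right 0](\<lambda>\<epsilon>. \<epsilon> ^ r)"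
    unfolding expands_constant_term by (rule expands_mono[OF f r(2)])
  from smalloD_tendsto[OF this]
  have "((\<lambda>\<epsilon>. ((f \<epsilon> - (f0 + (\<Sum>n=1..r. c n * \<epsilon> ^ n))) / \<epsilon> ^ r + c r) * (\<epsilon> ^ r * real (T \<epsilon>))) \<longlongrightarrow> (0 + c r) * l) (at_right 0)"
    by (intro tendsto_intros T)
  hence lim: "((\<lambda>\<epsilon>. ((f \<epsilon> - (f0 + (\<Sum>n=1..r. c n * \<epsilon> ^ n))) / \<epsilon> ^ r + c r) * (\<epsilon> ^ r * real (T \<epsilon>))) \<longlongrightarrow> c r * l) (at_right 0)"
    by simp
  have "{1..r} = insert r {1..r-1}" using r(1) by auto
  hence split: "(\<Sum>n=1..r. c n * \<epsilon> ^ n) = c r * \<epsilon> ^ r + (\<Sum>n=1..r-1. c n * \<epsilon> ^ n)" for \<epsilon> :: real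
    using r(1) by simp
  have "eventually (\<lambda>\<epsilon>. ((f \<epsilon> - (f0 + (\<Sum>n=1..r. c n * \<epsilon> ^ n))) / \<epsilon> ^ r + c r) * (\<epsilon> ^ r * real (T \<epsilon>)) =
      (f \<epsilon> - (f0 + (\<Sum>n=1..r-1. c n * \<epsilon> ^ n))) * real (T \<epsilon>)) (at_right 0)"
    using eventually_at_right_less
  proof eventually_elim
    case (elim \<epsilon>)
    thus ?case unfolding split by (simp add: field_simps)
  qed
  from Lim_transform_eventually[OF lim this] show ?thesis .
qed

theorem theorem8p1:
  fixes S :: "('n::finite, 'a) smp_family"
    and k :: nat
    and pc :: "'n \<Rightarrow> 'n \<Rightarrow> nat \<Rightarrow> nat \<Rightarrow> real"
  assumes "semi_markov_family S"
    and "k \<ge> 1"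
    and "cond_A S" and "cond_B S" and "cond_C S" and "cond_D S k pc" and "cond_E S"
  shows "(\<exists>\<delta>>0. \<forall>\<epsilon>\<in>{0..\<delta>}. \<forall>i.
            (\<exists>!\<rho>. phi S \<epsilon> (Some i) (Some i) \<rho> 0 = 1) \<and>
            phi S \<epsilon> (Some i) (Some i) (char_root S \<epsilon>) 0 = 1) \<and>
         (\<exists>c :: nat \<Rightarrow> real.
            (\<forall>i. c 1 = - b_coeff S pc i 0 1 / b_coeff S pc i 1 0 \<and>
                 (\<forall>n\<in>{2..k}. c n =
                    - (1 / b_coeff S pc i 1 0) *
                      (b_coeff S pc i 0 n
                       + (\<Sum>q=1..n-1. b_coeff S pc i 1 (n - q) * c q)
                       + (\<Sum>m=2..n. \<Sum>q=m..n. b_coeff S pc i m (n - q) *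
                            (\<Sum>ns\<in>D_set m q. \<Prod>p=1..q-1. c p ^ ns p / fact (ns p)))))) \<and>
            (\<lambda>\<epsilon>. char_root S \<epsilon> - (char_root S 0 + (\<Sum>n=1..k. c n * \<epsilon> ^ n)))
              \<in> o[at_right 0](\<lambda>\<epsilon>. \<epsilon> ^ k) \<and>
            (\<forall>(T :: real \<Rightarrow> nat) r (l :: real) i j.
               1 \<le> r \<longrightarrow> r \<le> k \<longrightarrow> 0 \<le> l \<longrightarrow>
               filterlim T at_top (at_right 0) \<longrightarrow>
               ((\<lambda>\<epsilon>. \<epsilon> ^ r * real (T \<epsilon>)) \<longlongrightarrow> l) (at_right 0) \<longrightarrow>
               ((\<lambda>\<epsilon>. \<P>(\<omega> in law S \<epsilon> (Some i). semi_markov S \<epsilon> (T \<epsilon>) \<omega> = Some j \<and>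
                          hit_time S \<epsilon> None \<omega> > enat (T \<epsilon>))
                      / exp (- (char_root S 0 + (\<Sum>n=1..r-1. c n * \<epsilon> ^ n)) * real (T \<epsilon>)))
                  \<longlongrightarrow> pi_tilde S (Some i) (Some j) / exp (l * c r)) (at_right 0)))"
proof -
  obtain \<beta> M where "perturbed_smp S \<beta> M"
    using perturbed_smp_exists[OF assms(1,3,4,5)] .
  then interpret perturbed_smp S \<beta> M .
  define c where "c = root_coeff (b_coeff S pc undefined)"
  have root: "(\<lambda>\<epsilon>. char_root S \<epsilon> - (char_root S 0 + (\<Sum>n=1..k. c n * \<epsilon> ^ n))) \<in> o[at_right 0](\<lambda>\<epsilon>. \<epsilon> ^ k)"
    unfolding c_def by (rule char_root_expansion[OF assms(2,6)])
  \<comment> \<open>The root does not depend on the state, and an expansion determines its coefficients.\<close>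
  have same: "root_coeff (b_coeff S pc i) n = c n" if "1 \<le> n" "n \<le> k" for i n
  proof -
    have "(if n = 0 then char_root S 0 else root_coeff (b_coeff S pc i) n) = (if n = 0 then char_root S 0 else c n)"
      by (rule expands_unique[OF char_root_expansion[OF assms(2,6), unfolded expands_constant_term] root[unfolded expands_constant_term] that(2)])
    thus ?thesis using that(1) by simp
  qed
  have rec: "c n = - (1 / b_coeff S pc i 1 0) *
      (b_coeff S pc i 0 n + (\<Sum>q=1..n-1. b_coeff S pc i 1 (n - q) * c q)
       + (\<Sum>m=2..n. \<Sum>q=m..n. b_coeff S pc i m (n - q) *
            (\<Sum>ns\<in>D_set m q. \<Prod>p=1..q-1. c p ^ ns p / fact (ns p))))"
    if n: "1 \<le> n" "n \<le> k" for i n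
  proof -
    let ?c = "root_coeff (b_coeff S pc i)"
    have "c n = ?c n" using same[OF n] by simp
    also have "\<dots> = - (1 / b_coeff S pc i 1 0) *
      (b_coeff S pc i 0 n + (\<Sum>q=1..n-1. b_coeff S pc i 1 (n - q) * ?c q)
       + (\<Sum>m=2..n. \<Sum>q=m..n. b_coeff S pc i m (n - q) *
            (\<Sum>ns\<in>D_set m q. \<Prod>p=1..q-1. ?c p ^ ns p / fact (ns p))))"
      using n(1) by (subst root_coeff.simps) simp
    also have "(\<Sum>q=1..n-1. b_coeff S pc i 1 (n - q) * ?c q) = (\<Sum>q=1..n-1. b_coeff S pc i 1 (n - q) * c q)"
      by (rule sum.cong[OF refl]) (use n in \<open>auto simp: same[unfolded One_nat_def]\<close>)
    also have "(\<Sum>m=2..n. \<Sum>q=m..n. b_coeff S pc i m (n - q) * (\<Sum>ns\<in>D_set m q. \<Prod>p=1..q-1. ?c p ^ ns p / fact (ns p))) =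
      (\<Sum>m=2..n. \<Sum>q=m..n. b_coeff S pc i m (n - q) * (\<Sum>ns\<in>D_set m q. \<Prod>p=1..q-1. c p ^ ns p / fact (ns p)))"
      by (intro sum.cong prod.cong refl arg_cong2[where f = "(*)"]) (use n in \<open>auto simp: same[unfolded One_nat_def]\<close>)
    finally show ?thesis .
  qed
  have first: "c 1 = - b_coeff S pc i 0 1 / b_coeff S pc i 1 0" for i
    using rec[of 1 i] assms(2) by simp
  have limit: "((\<lambda>\<epsilon>. \<P>(\<omega> in law S \<epsilon> (Some i). semi_markov S \<epsilon> (T \<epsilon>) \<omega> = Some j \<and> hit_time S \<epsilon> None \<omega> > enat (T \<epsilon>))
        / exp (- (char_root S 0 + (\<Sum>n=1..r-1. c n * \<epsilon> ^ n)) * real (T \<epsilon>)))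
      \<longlongrightarrow> pi_tilde S (Some i) (Some j) / exp (l * c r)) (at_right 0)"
    if r: "1 \<le> r" "r \<le> k" and T: "filterlim T at_top (at_right 0)" "((\<lambda>\<epsilon>. \<epsilon> ^ r * real (T \<epsilon>)) \<longlongrightarrow> l) (at_right 0)"
    for T :: "real \<Rightarrow> nat" and r l i j
  proof -
    let ?A = "\<lambda>\<epsilon>. char_root S 0 + (\<Sum>n=1..r-1. c n * \<epsilon> ^ n)"
    have "((\<lambda>\<epsilon>. (char_root S \<epsilon> - ?A \<epsilon>) * real (T \<epsilon>)) \<longlongrightarrow> c r * l) (at_right 0)"
      by (rule expansion_times_time[OF root[unfolded expands_constant_term] r T(2)])
    hence "((\<lambda>\<epsilon>. (exp (char_root S \<epsilon> * real (T \<epsilon>)) * occupation S \<epsilon> {} i j (T \<epsilon>)) / exp ((char_root S \<epsilon> - ?A \<epsilon>) * real (T \<epsilon>)))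
        \<longlongrightarrow> pi_tilde S (Some i) (Some j) / exp (c r * l)) (at_right 0)"
      by (intro tendsto_divide tilted_occupation_limit[OF T(1) assms(7)] tendsto_exp) simp_all
    moreover have "(exp (char_root S \<epsilon> * real (T \<epsilon>)) * occupation S \<epsilon> {} i j (T \<epsilon>)) / exp ((char_root S \<epsilon> - ?A \<epsilon>) * real (T \<epsilon>)) =
      occupation S \<epsilon> {} i j (T \<epsilon>) / exp (- ?A \<epsilon> * real (T \<epsilon>))" for \<epsilon>
    proof -
      have "exp ((char_root S \<epsilon> - ?A \<epsilon>) * real (T \<epsilon>)) = exp (char_root S \<epsilon> * real (T \<epsilon>)) * exp (- ?A \<epsilon> * real (T \<epsilon>))"
        unfolding exp_add[symmetric] by (simp add: left_diff_distrib distrib_right)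
      thus ?thesis by simp
    qed
    ultimately show ?thesis unfolding occupation_empty by (simp add: mult.commute[of l])
  qed
  show ?thesis
    using roots_on_interval first rec root limit
    by (intro conjI exI[of _ c] allI ballI impI) auto
qed

end
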